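(* For every $d\ge 3$ there exists a planar graph $G_d$ with maximum degree $d$ whose planar slope number is at least $3d-6$. In addition, every non-crossing drawing of $G_d$ with at most one bend per edge uses segments of at least $\frac34(d-1)$ distinct slopes.
   Context: The planar slope number of a planar graph is the smallest $s$ such that the graph has a non-crossing straight-line drawing (vertices distinct points, edges segments not passing through other vertices, no two edges sharing an interior point) whose edges have at most $s$ distinct slopes. A drawing with at most one bend per edge represents each edge by a polygonal path of at most two segments, non-crossing in the same sense; its slopes are those of all segments used. *)

theory Defs
  imports "HOL-Analysis.Analysis" "Graph_Theory.Pair_Digraph"
begin

text \<open>
  A finite simple graph is a \<^locale>\<open>pair_graph\<close>: each undirected edge \<open>uv\<close> is the pair of
  arcs \<open>(u, v)\<close> and \<open>(v, u)\<close>, so the out-degree of a vertex is its degree.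
\<close>

definition max_degree :: "'a pair_pre_digraph \<Rightarrow> nat" where
  "max_degree G = Max (out_degree (with_proj G) ` pverts G)"

text \<open>
  In a drawing, \<open>p\<close> places the vertices and \<open>c\<close> gives the curve of each arc. The symmetry
  condition makes the two arcs of an edge trace the same curve, and the last condition only
  compares arcs of different edges.
\<close>

definition plane_drawing ::
  "'a pair_pre_digraph \<Rightarrow> ('a \<Rightarrow> complex) \<Rightarrow> ('a \<times> 'a \<Rightarrow> real \<Rightarrow> complex) \<Rightarrow> bool" where
  "plane_drawing G p c \<longleftrightarrow>
     inj_on p (pverts G) \<and>
     (\<forall>(u, v)\<in>parcs G.
        arc (c (u, v)) \<and> pathstart (c (u, v)) = p u \<and> pathfinish (c (u, v)) = p v \<and>
        path_image (c (v, u)) = path_image (c (u, v)) \<and>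
        path_image (c (u, v)) \<inter> p ` pverts G = {p u, p v}) \<and>
     (\<forall>(u, v)\<in>parcs G. \<forall>(x, y)\<in>parcs G. {u, v} \<noteq> {x, y} \<longrightarrow>
        (path_image (c (u, v)) - {p u, p v}) \<inter> (path_image (c (x, y)) - {p x, p y}) = {})"

definition planar :: "'a pair_pre_digraph \<Rightarrow> bool" where
  "planar G \<longleftrightarrow> (\<exists>p c. plane_drawing G p c)"

fun polygonal_path :: "complex list \<Rightarrow> real \<Rightarrow> complex" where
  "polygonal_path [] = linepath 0 0"
| "polygonal_path [a] = linepath a a"
| "polygonal_path [a, b] = linepath a b"
| "polygonal_path (a # b # xs) = linepath a b +++ polygonal_path (b # xs)"

text \<open>The slope of a vertical segment is \<open>\<infinity>\<close>.\<close>

definition slope :: "complex \<Rightarrow> complex \<Rightarrow> ereal" where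
  "slope a b = (if Re a = Re b then \<infinity> else ereal ((Im b - Im a) / (Re b - Re a)))"

text \<open>
  In a polygonal drawing, \<open>\<beta> (u, v)\<close> lists the bends on the arc \<open>(u, v)\<close> in order from \<open>u\<close>
  to \<open>v\<close>.
\<close>

definition edge_points :: "('a \<Rightarrow> complex) \<Rightarrow> ('a \<times> 'a \<Rightarrow> complex list) \<Rightarrow> 'a \<times> 'a \<Rightarrow> complex list" where
  "edge_points p \<beta> e = p (fst e) # \<beta> e @ [p (snd e)]"

definition polygonal_drawing ::
  "nat \<Rightarrow> 'a pair_pre_digraph \<Rightarrow> ('a \<Rightarrow> complex) \<Rightarrow> ('a \<times> 'a \<Rightarrow> complex list) \<Rightarrow> bool" where
  "polygonal_drawing k G p \<beta> \<longleftrightarrow>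
     (\<forall>e\<in>parcs G. length (\<beta> e) \<le> k) \<and>
     plane_drawing G p (\<lambda>e. polygonal_path (edge_points p \<beta> e))"

definition drawing_slopes ::
  "'a pair_pre_digraph \<Rightarrow> ('a \<Rightarrow> complex) \<Rightarrow> ('a \<times> 'a \<Rightarrow> complex list) \<Rightarrow> ereal set" where
  "drawing_slopes G p \<beta> =
     {slope (edge_points p \<beta> e ! i) (edge_points p \<beta> e ! Suc i) | e i.
        e \<in> parcs G \<and> Suc i < length (edge_points p \<beta> e)}"

text \<open>
  A straight-line drawing is a polygonal drawing without bends; the minimum exists for
  every planar finite simple graph by the theorem of Fary.
\<close>

definition planar_slope_number :: "'a pair_pre_digraph \<Rightarrow> nat" where
  "planar_slope_number G =
     (LEAST s. \<exists>p \<beta>. polygonal_drawing 0 G p \<beta> \<and> card (drawing_slopes G p \<beta>) \<le> s)"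

end

theory Submission
  imports Defs
begin

text \<open>
  The graph consists of two triangles joined by a perfect matching, where each corner of a triangle
  has \<open>n = d - 3\<close> further neighbours; the \<open>3 n\<close> further neighbours of a triangle form a path, its
  hub. The hub of a triangle and the other triangle both touch all three of its corners, so they
  cannot both lie outside it: on the sphere this is the non-planarity of \<open>K\<^sub>3\<^sub>,\<^sub>3\<close>, proved here by
  splitting a Jordan domain twice. Hence in every drawing one of the two triangles encloses its hub.

  In a straight-line drawing the angles of this triangle contain every direction at most once, so
  its edges and its spokes have distinct slopes.

  With one bend per edge the triangle is a hexagon \<open>a x b y c z\<close> with bends \<open>x, y, z\<close>. If a corner
  is an extreme point of the convex hull, the \<open>d - 1\<close> segments at this corner have distinct slopes.
  Otherwise the hull is the triangle \<open>x y z\<close>, and the three triangles between the hull and the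
  hexagon are empty. For a fixed direction \<open>s\<close> each corner can emit at most one segment in each of
  the directions \<open>s\<close> and \<open>-s\<close>, and at least two of these six possibilities are blocked. So at most
  four of the \<open>3 (d - 1)\<close> segments at the corners share a slope.

  Finally, the graph is a subgraph of a stacked triangulation, and such a triangulation is drawn by
  placing each new vertex at the centroid of an empty triangle.
\<close>

section \<open>Two connected sets touching three points of a Jordan curve\<close>

text \<open>One triangle would not do, since its hub could be drawn outside it. The matching makes
  each triangle a second hub of the other: if both own hubs were outside, each triangle would have
  to lie inside the other, which is impossible for Jordan curves. This part is done for arbitrary
  curves, so it serves straight and bent edges alike. The matching edges themselves are never
  counted, because their position relative to the enclosing triangle is not controlled. With
  \<open>n = d - 3\<close> a corner keeps \<open>n + 2 = d - 1\<close> other neighbours, whose edges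
  all stay on the triangle or inside it. For straight edges each side of the triangle is charged to
  one of its two ends, which gives \<open>3 + 3 * n = 3 * d - 6\<close> slopes. For bent edges the
  sides are counted at both ends, which gives \<open>3 * (d - 1)\<close> segments; with at most four
  of them per slope the constant is 3/4. Vertices of a hub have degree at most 3, so the corners
  attain the maximum as soon as \<open>d\<close> is at least 3; for \<open>d = 3\<close> the hubs
  are empty.\<close>

lemma simple_path_image_diff_nonempty:
  fixes g :: "real \<Rightarrow> complex"
  assumes "simple_path g"
  shows "path_image g - {a, b} \<noteq> {}"
proof
  assume "path_image g - {a, b} = {}"
  then have "countable (path_image g)" by (simp add: countable_finite finite_subset)
  then show False using simple_path_image_uncountable[OF assms] by blast
qed

lemma connected_subset_inside_or_outside:
  fixes S :: "complex set"
  assumes "connected X" "closed S" "X \<inter> S = {}"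
  shows "X \<subseteq> inside S \<or> X \<subseteq> outside S"
proof -
  have "X \<subseteq> inside S \<union> outside S" using assms(3) inside_Un_outside[of S] by auto
  moreover have "inside S \<inter> outside S \<inter> X = {}" by simp
  ultimately have "inside S \<inter> X = {} \<or> outside S \<inter> X = {}"
    using connectedD[OF assms(1) open_inside[OF assms(2)] open_outside[OF assms(2)]] by blast
  then show ?thesis using \<open>X \<subseteq> inside S \<union> outside S\<close> by blast
qed

text \<open>The arc \<open>g\<close> splits the inside of \<open>e\<close> and \<open>f\<close> into
  two parts. The connected set \<open>B\<close> avoids \<open>g\<close>, so it lies in one of them.
  The part bounded by \<open>e\<close> and \<open>g\<close> stays away from the inner points of
  \<open>f\<close>, and one of these, \<open>c\<close>, is in the closure of
  \<open>B\<close>.\<close>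

lemma inside_theta_branch:
  fixes e f g :: "real \<Rightarrow> complex"
  assumes e: "simple_path e" "pathstart e = a" "pathfinish e = b"
    and f: "simple_path f" "pathstart f = a" "pathfinish f = b"
    and g: "simple_path g" "pathstart g = a" "pathfinish g = b"
    and "a \<noteq> b" and ef: "path_image e \<inter> path_image f = {a, b}"
    and gA: "path_image g - {a, b} \<subseteq> A"
    and J: "A \<inter> (path_image e \<union> path_image f) = {}" 
    and AB: "A \<inter> B = {}"
    and B: "connected B" 
    and c: "c \<in> path_image f" "c \<notin> {a, b}" "c \<in> closure B"
    and inA: "A \<subseteq> inside (path_image e \<union> path_image f)"
    and inB: "B \<subseteq> inside (path_image e \<union> path_image f)"
  shows "B \<subseteq> inside (path_image f \<union> path_image g)"
proof -
  have abg: "a \<in> path_image g" "b \<in> path_image g"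
    using g pathstart_in_path_image[of g] pathfinish_in_path_image[of g] by auto
  have "path_image g - {a, b} \<noteq> {}" using simple_path_image_diff_nonempty[OF g(1)] .
  then have ne: "path_image g \<inter> inside (path_image e \<union> path_image f) \<noteq> {}"
    using gA inA by blast
  have eg: "path_image e \<inter> path_image g = {a, b}" "path_image f \<inter> path_image g = {a, b}"
    using abg gA J ef by blast+
  have split: "inside (path_image e \<union> path_image g) \<inter> inside (path_image f \<union> path_image g) = {}"
    "inside (path_image e \<union> path_image g) \<union> inside (path_image f \<union> path_image g) \<union>
      (path_image g - {a, b}) = inside (path_image e \<union> path_image f)"
    using split_inside_simple_closed_curve[OF e f g \<open>a \<noteq> b\<close> ef eg ne] by blast+
  have cl: "closed (path_image e)" "closed (path_image f)" "closed (path_image g)"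
    using e f g by (auto simp: closed_simple_path_image)
  have op: "open (inside (path_image e \<union> path_image g))" "open (inside (path_image f \<union> path_image g))"
    using cl by (auto intro: open_inside)
  have sub: "B \<subseteq> inside (path_image e \<union> path_image g) \<union> inside (path_image f \<union> path_image g)"
    using inB split(2) gA AB by blast
  have "inside (path_image e \<union> path_image g) \<inter> B = {}"
  proof (rule ccontr)
    assume "\<not> ?thesis"
    then have "inside (path_image f \<union> path_image g) \<inter> B = {}"
      using connectedD[OF B op] sub split(1) by blast
    then have "B \<subseteq> inside (path_image e \<union> path_image g)" using sub by blast
    then have "c \<in> closure (inside (path_image e \<union> path_image g))"
      using c closure_mono by blast
    then have "c \<in> path_image e \<union> path_image g \<union> inside (path_image e \<union> path_image g)"
      using closure_inside_subset[of "path_image e \<union> path_image g"] cl by blast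
    then have "c \<in> inside (path_image e \<union> path_image f)"
      using c ef eg split(2) by blast
    then show False using c inside_no_overlap by blast
  qed
  then show ?thesis using sub by blast
qed

text \<open>
  The arc of each hub cuts the inside into two parts, and the other hub lies in the part that has
  \<open>c\<close> on its boundary. Splitting one of these parts by the other arc shows that it contains the
  other one, which then contains an arc of its own boundary.
\<close>

lemma hubs_not_both_inside:
  fixes e f g h :: "real \<Rightarrow> complex"
  assumes e: "simple_path e" "pathstart e = a" "pathfinish e = b"
    and f: "simple_path f" "pathstart f = a" "pathfinish f = b"
    and g: "simple_path g" "pathstart g = a" "pathfinish g = b"
    and h: "simple_path h" "pathstart h = a" "pathfinish h = b"
    and ab: "a \<noteq> b" and ef: "path_image e \<inter> path_image f = {a, b}"
    and gA: "path_image g - {a, b} \<subseteq> A" and hB: "path_image h - {a, b} \<subseteq> B"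
    and J: "A \<inter> (path_image e \<union> path_image f) = {}" "B \<inter> (path_image e \<union> path_image f) = {}"
    and AB: "A \<inter> B = {}"
    and conn: "connected A" "connected B"
    and c: "c \<in> path_image f" "c \<notin> {a, b}" "c \<in> closure A" "c \<in> closure B"
    and inA: "A \<subseteq> inside (path_image e \<union> path_image f)"
    and inB: "B \<subseteq> inside (path_image e \<union> path_image f)"
  shows False
proof -
  have B: "B \<subseteq> inside (path_image f \<union> path_image g)"
    using inside_theta_branch[OF e f g ab ef gA J(1) AB conn(2) c(1,2,4) inA inB] .
  have A: "A \<subseteq> inside (path_image f \<union> path_image h)"
    using inside_theta_branch[OF e f h ab ef hB J(2) _ conn(1) c(1-3) inB inA] AB by blast
  have abg: "a \<in> path_image g" "b \<in> path_image g" "a \<in> path_image h" "b \<in> path_image h"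
      "a \<in> path_image f" "b \<in> path_image f"
    using f g h pathstart_in_path_image[of f] pathfinish_in_path_image[of f]
      pathstart_in_path_image[of g] pathfinish_in_path_image[of g]
      pathstart_in_path_image[of h] pathfinish_in_path_image[of h] by auto
  note ne = simple_path_image_diff_nonempty
  have fg: "path_image f \<inter> path_image g = {a, b}" "path_image f \<inter> path_image h = {a, b}"
      "path_image g \<inter> path_image h = {a, b}"
    using abg gA hB J AB by blast+
  have "path_image h \<inter> inside (path_image f \<union> path_image g) \<noteq> {}"
    using ne[OF h(1), of a b] hB B by blast
  then have "inside (path_image f \<union> path_image h) \<subseteq> inside (path_image f \<union> path_image g)"
    using split_inside_simple_closed_curve[OF f g h ab fg] by blast
  then have "path_image g - {a, b} \<subseteq> inside (path_image f \<union> path_image g)"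
    using gA A by blast
  then show False using ne[OF g(1), of a b] inside_no_overlap[of "path_image f \<union> path_image g"] by blast
qed

text \<open>On the sphere \<open>F\<close> is a homeomorphism taking infinity to \<open>0\<close>
  and the inside point \<open>z0\<close> to infinity, so it exchanges the sides of the curve.
  Connectedness suffices to see this: the image of the outside, with \<open>0\<close> added, is on
  one side of the image curve, and the image of the punctured inside is unbounded. If the former
  were outside as well, nothing would be left for the inside of the image curve.\<close>

lemma inversion_outside:
  fixes j :: "real \<Rightarrow> complex"
  assumes j: "simple_path j" "pathfinish j = pathstart j"
    and z0: "z0 \<in> inside (path_image j)"
  defines "F \<equiv> \<lambda>z. inverse (z - z0)"
  shows "F ` outside (path_image j) \<subseteq> inside (F ` path_image j)"
proof -
  let ?J = "path_image j"
  have z0J: "z0 \<notin> ?J" using z0 inside_no_overlap by blast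
  have F_inv: "z0 + inverse (F z) = z" for z by (simp add: F_def)
  have contF: "continuous_on (- {z0}) F" unfolding F_def by (intro continuous_intros) auto
  have inj_F: "inj F" by (auto simp: F_def inj_def)
  then have injF: "inj_on F (- {z0})" using inj_on_subset by blast
  have FJ: "F ` ?J = path_image (F \<circ> j)" by (simp add: path_image_compose)
  have sp: "simple_path (F \<circ> j)"
    using z0J by (intro simple_path_continuous_image j continuous_on_subset[OF contF] inj_on_subset[OF injF]) auto
  have loop: "pathfinish (F \<circ> j) = pathstart (F \<circ> j)" using j by (simp add: pathfinish_compose pathstart_compose)
  note JJ = Jordan_inside_outside[OF j]
  note JF = Jordan_inside_outside[OF sp loop, folded FJ]
  have JF_bdd: "bounded (inside (F ` ?J))" and JF_ne: "inside (F ` ?J) \<noteq> {}"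
    using JF by auto
  have z0out: "z0 \<notin> outside ?J" using z0 JJ by blast
  have FJ0: "0 \<notin> F ` ?J" using z0J by (auto simp: F_def)
  have disj: "F ` outside ?J \<inter> F ` ?J = {}" "F ` (inside ?J - {z0}) \<inter> F ` ?J = {}"
    using inside_no_overlap[of ?J] outside_no_overlap[of ?J] by (blast dest: injD[OF inj_F])+
  have conn_out: "connected (F ` outside ?J)"
    using JJ z0out by (intro connected_continuous_image continuous_on_subset[OF contF]) auto
  \<comment> \<open>Far away points of the unbounded outside are mapped close to \<open>0\<close>,
    the image of infinity.\<close>
  have "0 \<in> closure (F ` outside ?J)"
  proof (subst closure_approachable, intro allI impI)
    fix r :: real assume "r > 0"
    have "\<not> outside ?J \<subseteq> cball z0 (inverse r)" using JJ bounded_subset bounded_cball by blast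
    then obtain w where w: "w \<in> outside ?J" "dist z0 w > inverse r" by (meson mem_cball not_le subsetI)
    then have "norm (w - z0) > inverse r" by (simp add: dist_norm norm_minus_commute)
    then have "norm (F w) < r" using \<open>r > 0\<close> unfolding F_def norm_inverse
      by (metis inverse_inverse_eq inverse_less_imp_less less_imp_inverse_less positive_imp_inverse_positive)
    then show "\<exists>y\<in>F ` outside ?J. dist y 0 < r" using w by auto
  qed
  then have conn0: "connected (insert 0 (F ` outside ?J))"
    by (intro connected_intermediate_closure[OF conn_out]) (use closure_subset[of "F ` outside ?J"] in auto)
  have clFJ: "closed (F ` ?J)" using sp FJ by (metis closed_simple_path_image)
  note split = connected_subset_inside_or_outside[OF _ clFJ]
  have "insert 0 (F ` outside ?J) \<subseteq> inside (F ` ?J) \<or> insert 0 (F ` outside ?J) \<subseteq> outside (F ` ?J)"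
    using conn0 disj FJ0 by (intro split) auto
  moreover have False if out: "insert 0 (F ` outside ?J) \<subseteq> outside (F ` ?J)"
  proof -
    have "connected (inside ?J - {z0})"
      using JJ by (intro connected_open_delete) auto
    then have conn_in: "connected (F ` (inside ?J - {z0}))"
      by (intro connected_continuous_image continuous_on_subset[OF contF]) auto
    have "\<not> F ` (inside ?J - {z0}) \<subseteq> inside (F ` ?J)"
    proof
      assume *: "F ` (inside ?J - {z0}) \<subseteq> inside (F ` ?J)"
      obtain B where B: "B > 0" "\<And>z. z \<in> inside (F ` ?J) \<Longrightarrow> norm z \<le> B"
        using JF_bdd bounded_pos by metis
      obtain r where r: "r > 0" "ball z0 r \<subseteq> inside ?J" using conjunct1[OF conjunct2[OF JJ]] z0 open_contains_ball by blast
      \<comment> \<open>Small enough to stay inside the curve, and so small that \<open>F\<close>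
        sends the point to distance at least \<open>2 * B\<close> from \<open>0\<close>, beyond the
        bound \<open>B\<close>.\<close>
      define t where "t = min (r / 2) (inverse (2 * B))"
      have t: "t > 0" "t < r" "t \<le> inverse (2 * B)" using r B by (auto simp: t_def)
      have "z0 + of_real t \<in> inside ?J - {z0}" using t r by (auto simp: dist_norm subset_iff)
      then have "norm (F (z0 + of_real t)) \<le> B" using * B(2) by blast
      moreover have "norm (F (z0 + of_real t)) = inverse t" using t by (simp add: F_def norm_inverse)
      moreover have "inverse t \<ge> 2 * B" using t B(1)
        by (metis inverse_inverse_eq le_imp_inverse_le)
      ultimately show False using B(1) by linarith
    qed
    then have "F ` (inside ?J - {z0}) \<subseteq> outside (F ` ?J)" using split[OF conn_in] disj by blast
    \<comment> \<open>Curve, outside, infinity and punctured inside make up the sphere without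
      \<open>z0\<close>, so their images cover the plane.\<close>
    moreover have "z \<in> F ` ?J \<union> insert 0 (F ` outside ?J) \<union> F ` (inside ?J - {z0})" for z
    proof (cases "z = 0")
      case False
      then have "F (z0 + inverse z) = z" "z0 + inverse z \<noteq> z0" by (auto simp: F_def)
      moreover have "z0 + inverse z \<in> ?J \<or> z0 + inverse z \<in> outside ?J \<or> z0 + inverse z \<in> inside ?J"
        using inside_Un_outside[of ?J] by blast
      ultimately show ?thesis by (metis Un_iff DiffI image_eqI insertI2 singletonD)
    qed simp
    ultimately have "inside (F ` ?J) \<subseteq> F ` ?J \<union> outside (F ` ?J)" using out by blast
    then show False using JF_ne inside_no_overlap[of "F ` ?J"] inside_Int_outside[of "F ` ?J"] by (elim notE) blast
  qed
  ultimately show ?thesis by blast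
qed

text \<open>Inversion in a point \<open>z0\<close> inside the curve carries both sets to the inside
  of the image curve, where \<open>hubs_not_both_inside\<close> applies. Curves and sets avoid
  \<open>z0\<close>, so simple paths, disjointness and the closure condition at \<open>c\<close>
  carry over.\<close>

lemma hubs_not_both_outside:
  fixes e f g h :: "real \<Rightarrow> complex"
  assumes e: "simple_path e" "pathstart e = a" "pathfinish e = b"
    and f: "simple_path f" "pathstart f = a" "pathfinish f = b"
    and g: "simple_path g" "pathstart g = a" "pathfinish g = b"
    and h: "simple_path h" "pathstart h = a" "pathfinish h = b"
    and ab: "a \<noteq> b" and ef: "path_image e \<inter> path_image f = {a, b}"
    and gA: "path_image g - {a, b} \<subseteq> A" and hB: "path_image h - {a, b} \<subseteq> B"
    and AB: "A \<inter> B = {}"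
    and conn: "connected A" "connected B"
    and c: "c \<in> path_image f" "c \<notin> {a, b}" "c \<in> closure A" "c \<in> closure B"
    and outA: "A \<subseteq> outside (path_image e \<union> path_image f)"
    and outB: "B \<subseteq> outside (path_image e \<union> path_image f)"
  shows False
proof -
  let ?J = "path_image e \<union> path_image f"
  define j where "j = e +++ reversepath f"
  have Jj: "path_image j = ?J" using e f by (simp add: j_def path_image_join)
  have j: "simple_path j" "pathfinish j = pathstart j" unfolding j_def
    using e f ab ef by (auto simp: simple_path_join_loop_eq arc_simple_path simple_path_reversepath)
  obtain z0 where z0: "z0 \<in> inside ?J" using Jordan_inside_outside[OF j] Jj by auto
  define F where "F = (\<lambda>z. inverse (z - z0))"
  have z0J: "z0 \<notin> ?J" "z0 \<notin> outside ?J"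
    using z0 inside_no_overlap[of ?J] inside_Int_outside[of ?J] by blast+
  have contF: "continuous_on (- {z0}) F" unfolding F_def by (intro continuous_intros) auto
  have injF: "inj_on F (- {z0})" by (auto simp: F_def inj_on_def)
  have Fout: "F ` outside ?J \<subseteq> inside (F ` ?J)"
    using inversion_outside[OF j] z0 unfolding F_def Jj by blast
  have inv: "simple_path (F \<circ> k) \<and> pathstart (F \<circ> k) = F a \<and> pathfinish (F \<circ> k) = F b"
    if "simple_path k" "pathstart k = a" "pathfinish k = b" "z0 \<notin> path_image k" for k
    using that
    by (auto simp: pathfinish_compose pathstart_compose
        intro!: simple_path_continuous_image continuous_on_subset[OF contF] inj_on_subset[OF injF])
  have abJ: "a \<in> ?J" "b \<in> ?J" using e pathstart_in_path_image[of e] pathfinish_in_path_image[of e] by auto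
  have z0g: "z0 \<notin> path_image g" "z0 \<notin> path_image h" "z0 \<notin> A" "z0 \<notin> B"
    using gA hB outA outB z0J abJ by blast+
  have nz: "z0 \<notin> {a,b}" using z0J abJ by blast
  have img: "F ` (X - Y) = F ` X - F ` Y" if "z0 \<notin> X" "z0 \<notin> Y" for X Y
    using that injF by (intro inj_on_image_set_diff[of F "- {z0}"]) auto
  have int: "F ` (X \<inter> Y) = F ` X \<inter> F ` Y" if "z0 \<notin> X" "z0 \<notin> Y" for X Y
    using that injF by (intro inj_on_image_Int[of F "- {z0}"]) auto
  have Fcl: "F c \<in> closure (F ` X)" if "c \<in> closure X" "z0 \<notin> X" for X
  proof -
    have "c \<noteq> z0" using c(1) z0J by auto
    then have "isCont F c" unfolding F_def by (intro continuous_intros) auto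
    have "\<exists>s. (\<forall>n. s n \<in> X) \<and> s \<longlonglongrightarrow> c" using that closure_sequential by blast
    then obtain s where s: "\<And>n. s n \<in> X" "s \<longlonglongrightarrow> c" by blast
    then have "(\<lambda>n. F (s n)) \<longlonglongrightarrow> F c" using isCont_tendsto_compose \<open>isCont F c\<close> by blast
    moreover have "\<forall>n. F (s n) \<in> F ` X" using s(1) by blast
    ultimately show ?thesis unfolding closure_sequential by (intro exI[of _ "\<lambda>n. F (s n)"]) simp
  qed
  note ie = inv[OF e] and if' = inv[OF f] and ig = inv[OF g z0g(1)] and ih = inv[OF h z0g(2)]
  have Fab: "F ` {a, b} = {F a, F b}" by simp
  have FJ: "path_image (F \<circ> e) \<union> path_image (F \<circ> f) = F ` ?J" by (simp add: path_image_compose image_Un)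
  have conn': "connected (F ` A)" "connected (F ` B)"
    using conn z0g by (auto intro!: connected_continuous_image continuous_on_subset[OF contF])
  have inn: "F ` A \<subseteq> inside (F ` ?J)" "F ` B \<subseteq> inside (F ` ?J)" using outA outB Fout by blast+
  show False
  proof (rule hubs_not_both_inside[of "F \<circ> e" "F a" "F b" "F \<circ> f" "F \<circ> g" "F \<circ> h" "F ` A" "F ` B" "F c"])
    show "F a \<noteq> F b" using injF ab nz by (auto simp: inj_on_def)
    show "path_image (F \<circ> e) \<inter> path_image (F \<circ> f) = {F a, F b}"
      using int[of "path_image e" "path_image f"] ef z0J by (simp add: path_image_compose)
    show "path_image (F \<circ> g) - {F a, F b} \<subseteq> F ` A" "path_image (F \<circ> h) - {F a, F b} \<subseteq> F ` B"
      using img[of "path_image g" "{a, b}"] img[of "path_image h" "{a, b}"] z0g nz gA hB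
      unfolding path_image_compose by (metis Fab image_mono)+
    show "F ` A \<inter> F ` B = {}" using int[of A B] z0g AB by simp
    show "F c \<in> path_image (F \<circ> f)" using c by (simp add: path_image_compose)
    show "F c \<notin> {F a, F b}" using injF c z0J nz by (auto simp: inj_on_def)
    show "F c \<in> closure (F ` A)" "F c \<in> closure (F ` B)" using Fcl c z0g by auto
    show "F ` A \<inter> (path_image (F \<circ> e) \<union> path_image (F \<circ> f)) = {}"
      "F ` B \<inter> (path_image (F \<circ> e) \<union> path_image (F \<circ> f)) = {}"
      using inn inside_no_overlap[of "F ` ?J"] unfolding FJ by blast+
  qed (use ie if' ig ih z0J conn' inn FJ in auto)
qed

text \<open>The closure of the outside of \<open>j\<close> is connected and unbounded, contains the
  curve and misses \<open>S\<close>. So it joins every point of the curve to infinity without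
  meeting \<open>S\<close>.\<close>

lemma nested_closed_curve_outside:
  fixes j :: "real \<Rightarrow> complex"
  assumes j: "simple_path j" "pathfinish j = pathstart j"
    and S: "S \<subseteq> inside (path_image j)"
  shows "path_image j \<subseteq> outside S"
proof
  fix x assume x: "x \<in> path_image j"
  let ?O = "outside (path_image j)"
  have conn: "connected ?O" and unb: "\<not> bounded ?O" and fr: "frontier ?O = path_image j"
    using Jordan_inside_outside[OF j] by auto
  have eq: "closure ?O = ?O \<union> path_image j"
    using fr closure_Un_frontier[of ?O] by simp
  have "x \<in> closure ?O" using x eq by blast
  moreover have "connected (closure ?O)" using conn by (rule connected_imp_connected_closure)
  moreover have sub: "closure ?O \<subseteq> - S"
    using eq S inside_no_overlap[of "path_image j"] inside_Int_outside[of "path_image j"] by blast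
  ultimately have "closure ?O \<subseteq> connected_component_set (- S) x"
    using connected_component_maximal by blast
  then have "\<not> bounded (connected_component_set (- S) x)"
    using unb closure_subset bounded_subset by meson
  then show "x \<in> outside S" using \<open>x \<in> closure ?O\<close> sub by (auto simp: outside_def)
qed

section \<open>Directions in a hexagon whose convex hull is spanned by its bends\<close>

definition cross2 :: "complex \<Rightarrow> complex \<Rightarrow> real" where
  "cross2 u v = Re u * Im v - Im u * Re v"

lemma cross2_simps [simp]:
  "cross2 (u + v) w = cross2 u w + cross2 v w" "cross2 w (u + v) = cross2 w u + cross2 w v"
  "cross2 (u - v) w = cross2 u w - cross2 v w" "cross2 w (u - v) = cross2 w u - cross2 w v"
  "cross2 (r *\<^sub>R u) w = r * cross2 u w" "cross2 w (r *\<^sub>R u) = r * cross2 w u"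
  "cross2 (- u) w = - cross2 u w" "cross2 w (- u) = - cross2 w u"
  "cross2 u u = 0" "cross2 0 u = 0" "cross2 u 0 = 0"
  by (simp_all add: cross2_def algebra_simps)

lemma cross2_commute: "cross2 u v = - cross2 v u"
  by (simp add: cross2_def)

lemma continuous_on_cross2 [continuous_intros]:
  "continuous_on S f \<Longrightarrow> continuous_on S g \<Longrightarrow> continuous_on S (\<lambda>x. cross2 (f x) (g x))"
  unfolding cross2_def by (intro continuous_intros)

lemma cross2_eq_0_imp_scaled:
  assumes "cross2 s v = 0" "s \<noteq> 0"
  obtains k where "v = k *\<^sub>R s"
proof -
  \<comment> \<open>The factor is the coefficient of the orthogonal projection of \<open>v\<close>
    to the line of \<open>s\<close>.\<close>
  have "v = ((Re s * Re v + Im s * Im v) / (Re s ^ 2 + Im s ^ 2)) *\<^sub>R s"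
  proof -
    have n: "Re s ^ 2 + Im s ^ 2 \<noteq> 0" using assms(2) by (simp add: complex_eq_iff sum_power2_eq_zero_iff)
    have eq: "Re s * Im v = Im s * Re v" using assms(1) by (simp add: cross2_def)
    have "Re v * (Re s ^ 2 + Im s ^ 2) = (Re s * Re v + Im s * Im v) * Re s"
      using eq by (simp add: power2_eq_square algebra_simps)
    moreover have "Im v * (Re s ^ 2 + Im s ^ 2) = (Re s * Re v + Im s * Im v) * Im s"
      using eq by (simp add: power2_eq_square algebra_simps)
    ultimately show ?thesis using n by (simp add: complex_eq_iff field_simps)
  qed
  then show thesis by (rule that)
qed

text \<open>Replaces slopes by a bilinear condition in which vertical segments are no special
  case.\<close>

lemma slope_eq_iff:
  assumes "a \<noteq> b" "a' \<noteq> b'"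
  shows "slope a b = slope a' b' \<longleftrightarrow> cross2 (b - a) (b' - a') = 0"
proof -
  consider "Re a = Re b" "Re a' = Re b'" | "Re a = Re b" "Re a' \<noteq> Re b'"
    | "Re a \<noteq> Re b" "Re a' = Re b'" | "Re a \<noteq> Re b" "Re a' \<noteq> Re b'" by blast
  then show ?thesis
  proof cases
    case 4
    then show ?thesis
      by (auto simp: slope_def cross2_def field_simps)
  qed (use assms in \<open>auto simp: slope_def cross2_def complex_eq_iff\<close>)
qed

text \<open>This takes the place of the angle sum of a triangle: every term of the determinant
  carries the sign of the orientation of \<open>a b c\<close>, so the cones at consecutive corners
  contain no parallel vectors. The strict coefficients remove one boundary ray from each cone, so
  each side of the triangle belongs to one corner only.\<close>

lemma cross2_corner_cones_pos:
  assumes "cross2 (b - a) (c - a) \<noteq> 0" "s > 0" "r \<ge> 0" "s' > 0" "r' \<ge> 0"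
  shows "cross2 (s *\<^sub>R (b - a) + r *\<^sub>R (c - a)) (s' *\<^sub>R (c - b) + r' *\<^sub>R (a - b)) \<noteq> 0"
proof -
  have "cross2 (s *\<^sub>R (b - a) + r *\<^sub>R (c - a)) (s' *\<^sub>R (c - b) + r' *\<^sub>R (a - b))
     = (s * s' + r * (s' + r')) * cross2 (b - a) (c - a)"
    by (simp add: cross2_def algebra_simps)
  moreover have "s * s' + r * (s' + r') > 0" using assms by (simp add: add_pos_nonneg)
  ultimately show ?thesis using assms(1) by simp
qed

text \<open>
  The triangle \<open>x b y\<close> is bounded inside the large triangle only by the roof \<open>x b y\<close>, so removing
  the roof makes it open and closed.
\<close>

lemma connected_avoids_roof:
  fixes x y z b :: complex
  assumes ncol: "cross2 (y - x) (z - x) \<noteq> 0"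
    and b: "b \<in> convex hull {x, y, z}"
    and W: "connected W" "W \<subseteq> convex hull {x, y, z}" "z \<in> W"
    and disj: "W \<inter> (closed_segment x b \<union> closed_segment b y) = {}"
  shows "W \<inter> convex hull {x, b, y} = {}"
proof -
  obtain \<beta>2 \<beta>3 where b_eq: "b = x + \<beta>2 *\<^sub>R (y - x) + \<beta>3 *\<^sub>R (z - x)"
    and \<beta>: "0 \<le> \<beta>2" "0 \<le> \<beta>3" "\<beta>2 + \<beta>3 \<le> 1"
    using b unfolding convex_hull_3_alt by blast
  show ?thesis
  proof (cases "\<beta>3 = 0")
    \<comment> \<open>The coordinate \<open>\<beta>3\<close> is the height of \<open>b\<close> over
      the side from \<open>x\<close> to \<open>y\<close>. At height \<open>0\<close> the triangle
      degenerates to its roof.\<close>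
    case True
    have "b \<in> closed_segment x y"
      unfolding in_segment by (rule exI[of _ \<beta>2]) (use b_eq \<beta> True in \<open>auto simp: algebra_simps\<close>)
    then have "closed_segment x b \<union> closed_segment b y = closed_segment x y"
      by (rule Un_closed_segment)
    moreover have "convex hull {x, b, y} = closed_segment x y"
      using \<open>b \<in> closed_segment x y\<close> unfolding segment_convex_hull
      by (metis hull_redundant insert_commute)
    ultimately show ?thesis using disj by simp
  next
    case False
    define D where "D = cross2 (y - x) (z - x)"
    have D0: "D \<noteq> 0" using ncol D_def by metis
    \<comment> \<open>Barycentric coordinates belonging to \<open>y\<close> and \<open>z\<close>. Of
      the functions built from them, \<open>L1\<close> vanishes on the line through \<open>x\<close>
      and \<open>b\<close> and \<open>L2\<close> on the line through \<open>b\<close> and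
      \<open>y\<close>. Inside the large triangle \<open>?A\<close> is the part strictly under the
      roof.\<close>
    define P2 where "P2 = (\<lambda>p. cross2 (p - x) (z - x) / D)"
    define P3 where "P3 = (\<lambda>p. cross2 (y - x) (p - x) / D)"
    define L1 where "L1 = (\<lambda>p. P2 p * \<beta>3 - P3 p * \<beta>2)"
    define L2 where "L2 = (\<lambda>p. (1 - P2 p - P3 p) * \<beta>3 - P3 p * (1 - \<beta>2 - \<beta>3))"
    have coord: "P2 (x + u *\<^sub>R (y - x) + v *\<^sub>R (z - x)) = u" "P3 (x + u *\<^sub>R (y - x) + v *\<^sub>R (z - x)) = v" for u v
    proof -
      have "x + A + B - x = A + B" for A B :: complex by simp
      moreover have "cross2 (z - x) (z - x) = 0" "cross2 (y - x) (y - x) = 0" by simp_all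
      ultimately show "P2 (x + u *\<^sub>R (y - x) + v *\<^sub>R (z - x)) = u" "P3 (x + u *\<^sub>R (y - x) + v *\<^sub>R (z - x)) = v"
        using D0 by (simp_all only: P2_def P3_def cross2_simps(1,2,5,6) flip: D_def) simp_all
    qed
    have cont: "continuous_on UNIV L1" "continuous_on UNIV L2"
      unfolding L1_def L2_def P2_def P3_def by (intro continuous_intros; use D0 in simp)+
    let ?A = "{p. 0 < L1 p} \<inter> {p. 0 < L2 p}" and ?B = "{p. L1 p < 0} \<union> {p. L2 p < 0}"
    have "open ?A" "open ?B"
      by (intro open_Int open_Un open_Collect_less cont continuous_intros)+
    have "p \<in> ?A \<union> ?B" if "p \<in> W" for p
    proof (rule ccontr)
      assume *: "p \<notin> ?A \<union> ?B"
      have "p \<in> convex hull {x, y, z}" using that W(2) by blast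
      then obtain u v where p: "p = x + u *\<^sub>R (y - x) + v *\<^sub>R (z - x)" and uv: "0 \<le> u" "0 \<le> v" "u + v \<le> 1"
        unfolding convex_hull_3_alt by blast
      have L: "L1 p = u * \<beta>3 - v * \<beta>2" "L2 p = (1 - u - v) * \<beta>3 - v * (1 - \<beta>2 - \<beta>3)"
        unfolding L1_def L2_def p coord by simp_all
      \<comment> \<open>The height of \<open>p\<close> relative to that of \<open>b\<close>. It is
        at most \<open>1\<close>, so a zero of \<open>L1\<close> or \<open>L2\<close> lies on the
        roof and not on the extension of one of its segments beyond \<open>b\<close>.\<close>
      define q where "q = v / \<beta>3"
      have v: "v = q * \<beta>3" and q0: "q \<ge> 0" using False uv \<beta> by (simp_all add: q_def)
      have q1: "q \<le> 1"
      proof -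
        have "u * \<beta>3 \<ge> v * \<beta>2" "(1 - u - v) * \<beta>3 \<ge> v * (1 - \<beta>2 - \<beta>3)" using * L by auto
        then have "u * \<beta>3 \<ge> (q * \<beta>2) * \<beta>3" "(1 - u - v) * \<beta>3 \<ge> (q * (1 - \<beta>2 - \<beta>3)) * \<beta>3"
          unfolding v by (simp_all add: algebra_simps)
        then have "u \<ge> q * \<beta>2" "1 - u - v \<ge> q * (1 - \<beta>2 - \<beta>3)" using False \<beta>
          by (metis mult_le_cancel_right less_eq_real_def)+
        then show ?thesis unfolding v by (simp add: algebra_simps)
      qed
      consider "L1 p = 0" | "L2 p = 0" using * by fastforce
      then have "p \<in> closed_segment x b \<union> closed_segment b y"
      proof cases
        case 1
        then have "u * \<beta>3 = (q * \<beta>2) * \<beta>3" using L v by simp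
        then have "u = q * \<beta>2" using False by simp
        then have "p = (1 - q) *\<^sub>R x + q *\<^sub>R b" unfolding p b_eq v by (simp add: algebra_simps)
        then show ?thesis using q0 q1 by (auto simp: in_segment)
      next
        case 2
        then have "(1 - u - v) * \<beta>3 = (q * (1 - \<beta>2 - \<beta>3)) * \<beta>3" using L v by simp
        then have "1 - u - v = q * (1 - \<beta>2 - \<beta>3)" using False by simp
        then have u: "u = 1 - q + q * \<beta>2" unfolding v by (simp add: algebra_simps)
        have "p = (1 - (1 - q)) *\<^sub>R b + (1 - q) *\<^sub>R y" unfolding p b_eq v u by (simp add: algebra_simps)
        moreover have "0 \<le> 1 - q" "1 - q \<le> 1" using q0 q1 by auto
        ultimately have "p \<in> closed_segment b y" unfolding in_segment by blast
        then show ?thesis by blast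
      qed
      then show False using disj that by blast
    qed
    then have WAB: "W \<subseteq> ?A \<union> ?B" by blast
    have "b \<noteq> z" using disj W(3) by auto
    have "L1 z = - \<beta>2" "L2 z = - (1 - \<beta>2 - \<beta>3)"
      using coord[of 0 1] unfolding L1_def L2_def by simp_all
    moreover have "\<beta>2 \<noteq> 0 \<or> \<beta>2 + \<beta>3 \<noteq> 1" using \<open>b \<noteq> z\<close> b_eq by auto
    ultimately have "z \<in> ?B" using \<beta> by auto
    then have "?A \<inter> W = {}"
      using connectedD[OF W(1) \<open>open ?A\<close> \<open>open ?B\<close> _ WAB] W(3) by fastforce
    then have WB: "W \<subseteq> ?B" using WAB by blast
    have "p \<notin> ?B" if "p \<in> convex hull {x, b, y}" for p
    proof -
      have "p \<in> convex hull {x, y, b}" using that by (simp add: insert_commute)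
      then obtain w v where p: "p = x + w *\<^sub>R (y - x) + v *\<^sub>R (b - x)" and wv: "0 \<le> w" "0 \<le> v" "w + v \<le> 1"
        unfolding convex_hull_3_alt by blast
      have p': "p = x + (w + v * \<beta>2) *\<^sub>R (y - x) + (v * \<beta>3) *\<^sub>R (z - x)"
        unfolding p b_eq by (simp add: algebra_simps)
      have "L1 p = w * \<beta>3" "L2 p = (1 - w - v) * \<beta>3"
        unfolding L1_def L2_def p' coord by (simp_all add: algebra_simps)
      then show ?thesis using wv \<beta> by (auto simp: not_less)
    qed
    then show ?thesis using WB by blast
  qed
qed

text \<open>
  The hexagon is \<open>a x b y c z\<close>, with corners \<open>a, b, c\<close> and bends \<open>x, y, z\<close>.
\<close>

locale reflex_hexagon =
  fixes \<Gamma> :: "complex set" and a b c x y z :: complex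
  assumes ncol: "cross2 (y - x) (z - x) \<noteq> 0"
    and \<Gamma>: "\<Gamma> \<subseteq> convex hull {x, y, z}"
    and roofs: "closed_segment z a \<union> closed_segment a x \<subseteq> \<Gamma>"
      "closed_segment x b \<union> closed_segment b y \<subseteq> \<Gamma>"
      "closed_segment y c \<union> closed_segment c z \<subseteq> \<Gamma>"
    and empty: "\<Gamma> \<inter> convex hull {z, a, x} \<subseteq> closed_segment z a \<union> closed_segment a x"
      "\<Gamma> \<inter> convex hull {x, b, y} \<subseteq> closed_segment x b \<union> closed_segment b y"
      "\<Gamma> \<inter> convex hull {y, c, z} \<subseteq> closed_segment y c \<union> closed_segment c z"
    and simple: "(closed_segment z a \<union> closed_segment a x) \<inter> (closed_segment x b \<union> closed_segment b y) = {x}"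
      "(closed_segment x b \<union> closed_segment b y) \<inter> (closed_segment y c \<union> closed_segment c z) = {y}"
      "(closed_segment y c \<union> closed_segment c z) \<inter> (closed_segment z a \<union> closed_segment a x) = {z}"
    and corners: "a \<notin> {x, y, z}" "b \<notin> {x, y, z}" "c \<notin> {x, y, z}"
begin

text \<open>Together with \<open>reflect\<close> this yields all six relabellings of the corners, so
  later arguments may fix the order of the heights of the bends.\<close>

lemma rotate: "reflex_hexagon \<Gamma> b c a y z x"
proof
  show "cross2 (z - y) (x - y) \<noteq> 0" using ncol by (simp add: cross2_def algebra_simps)
  show "\<Gamma> \<subseteq> convex hull {y, z, x}" using \<Gamma> by (simp add: insert_commute)
qed (use roofs empty simple corners in auto)

lemma reflect: "reflex_hexagon \<Gamma> c b a y x z"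
proof
  show "cross2 (x - y) (z - y) \<noteq> 0" using ncol by (simp add: cross2_def algebra_simps)
  show "\<Gamma> \<subseteq> convex hull {y, x, z}" using \<Gamma> by (simp add: insert_commute)
qed (use roofs empty simple corners in \<open>auto simp: closed_segment_commute Un_commute insert_commute\<close>)

text \<open>Refers to the set \<open>\<Gamma>\<close> instead of edges: an edge that leaves
  \<open>v\<close> in direction \<open>s\<close> is a witness, and a positive rescaling of
  \<open>s\<close> changes nothing.\<close>

definition sees :: "complex \<Rightarrow> complex \<Rightarrow> bool" where
  "sees v s \<longleftrightarrow> (\<exists>\<delta>>0. \<forall>t. 0 \<le> t \<and> t \<le> \<delta> \<longrightarrow> v + t *\<^sub>R s \<in> \<Gamma>)"

lemma xyz_in: "x \<in> \<Gamma>" "y \<in> \<Gamma>" "z \<in> \<Gamma>" "a \<in> \<Gamma>" "b \<in> \<Gamma>" "c \<in> \<Gamma>"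
  using roofs by auto

text \<open>
  The functional \<open>cross2 s\<close> is constant along \<open>s\<close>, so it orders points by height above a line of
  direction \<open>s\<close>.
\<close>

lemma not_sees_both:
  assumes s: "s \<noteq> 0" and h: "cross2 s z < cross2 s a" "cross2 s a < cross2 s x"
  shows "\<not> (sees a s \<and> sees a (- s))"
proof
  assume "sees a s \<and> sees a (- s)"
  then obtain \<delta>1 \<delta>2 where \<delta>: "\<delta>1 > 0" "\<And>t. 0 \<le> t \<Longrightarrow> t \<le> \<delta>1 \<Longrightarrow> a + t *\<^sub>R s \<in> \<Gamma>"
    "\<delta>2 > 0" "\<And>t. 0 \<le> t \<Longrightarrow> t \<le> \<delta>2 \<Longrightarrow> a + t *\<^sub>R (- s) \<in> \<Gamma>"
    unfolding sees_def by metis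
  define \<delta> where "\<delta> = min \<delta>1 \<delta>2"
  have \<delta>0: "\<delta> > 0" using \<delta> by (simp add: \<delta>_def)
  have near: "a + t *\<^sub>R s \<in> \<Gamma>" if "\<bar>t\<bar> \<le> \<delta>" for t
  proof (cases "t \<ge> 0")
    case True then show ?thesis using \<delta>(2)[of t] that by (simp add: \<delta>_def)
  next
    case False
    then show ?thesis using \<delta>(4)[of "- t"] that by (simp add: \<delta>_def)
  qed
  define \<tau> where "\<tau> = (cross2 s x - cross2 s a) / (cross2 s x - cross2 s z)"
  have \<tau>: "0 < \<tau>" "\<tau> < 1" using h by (auto simp: \<tau>_def field_simps)
  \<comment> \<open>The point of the side from \<open>x\<close> to \<open>z\<close> at the height of
    \<open>a\<close>, so \<open>m - a\<close> is a multiple of \<open>s\<close>. If \<open>m\<close>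
    differs from \<open>a\<close>, a short step towards \<open>m\<close> stays in
    \<open>\<Gamma>\<close> by \<open>near\<close> and lies in the triangle \<open>z a x\<close>,
    which is empty up to its roof. But both segments of the roof leave the height of
    \<open>a\<close> at once.\<close>
  define m where "m = x + \<tau> *\<^sub>R (z - x)"
  have "\<tau> * (cross2 s x - cross2 s z) = cross2 s x - cross2 s a" using h by (simp add: \<tau>_def)
  then have "cross2 s (m - a) = 0" by (simp add: m_def algebra_simps)
  then obtain k where k: "m - a = k *\<^sub>R s" using cross2_eq_0_imp_scaled s by blast
  show False
  proof (cases "k = 0")
    case False
    define \<epsilon> where "\<epsilon> = min 1 (\<delta> / \<bar>k\<bar>)"
    have \<epsilon>: "\<epsilon> > 0" "\<epsilon> \<le> 1" "\<bar>\<epsilon> * k\<bar> \<le> \<delta>" using \<delta>0 False by (auto simp: \<epsilon>_def abs_mult min_def field_simps)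
    define p where "p = a + (\<epsilon> * k) *\<^sub>R s"
    have "p \<in> \<Gamma>" unfolding p_def using near \<epsilon>(3) .
    have p2: "p = a + \<epsilon> *\<^sub>R (m - a)" unfolding p_def k by simp
    then have "p = (\<epsilon> * \<tau>) *\<^sub>R z + (1 - \<epsilon>) *\<^sub>R a + (\<epsilon> * (1 - \<tau>)) *\<^sub>R x"
      by (simp add: m_def algebra_simps)
    moreover have "(\<epsilon> * \<tau>) + (1 - \<epsilon>) + (\<epsilon> * (1 - \<tau>)) = 1" by (simp add: algebra_simps)
    ultimately have "p \<in> convex hull {z, a, x}"
      unfolding convex_hull_3 using \<epsilon> \<tau>
      by (intro CollectI exI[of _ "\<epsilon> * \<tau>"] exI[of _ "1 - \<epsilon>"] exI[of _ "\<epsilon> * (1 - \<tau>)"]) auto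
    then have "p \<in> closed_segment a z \<union> closed_segment a x" using empty(1) \<open>p \<in> \<Gamma>\<close> by (auto simp: closed_segment_commute)
    then obtain w where "p \<in> closed_segment a w" and w: "w \<in> {z, x}" by blast
    then obtain q where "p = (1 - q) *\<^sub>R a + q *\<^sub>R w" unfolding in_segment by blast
    with w have qw: "p = a + q *\<^sub>R (w - a)" "w \<in> {z, x}" by (simp_all add: algebra_simps)
    have "cross2 s p = cross2 s a" unfolding p_def by simp
    then have "q * (cross2 s w - cross2 s a) = 0" unfolding qw(1) by simp
    then have "q = 0" using qw(2) h by auto
    then have "p = a" using qw by simp
    then show False using \<epsilon>(1) False s unfolding p_def by simp
  next
    case True
    \<comment> \<open>Now \<open>a\<close> lies on a side of the hull. The line of direction
      \<open>s\<close> crosses this side, so \<open>L\<close>, which is nonnegative on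
      \<open>\<Gamma>\<close>, would change sign along it.\<close>
    then have a: "a = x + \<tau> *\<^sub>R (z - x)" using k m_def by simp
    define L where "L = (\<lambda>p. cross2 (z - x) (p - x) * cross2 (z - x) (y - x))"
    have Lpos: "L p \<ge> 0" if "p \<in> \<Gamma>" for p
    proof -
      have "p \<in> convex hull {x, y, z}" using that \<Gamma> by blast
      then obtain u v where "p = x + u *\<^sub>R (y - x) + v *\<^sub>R (z - x)" "0 \<le> u"
        unfolding convex_hull_3_alt by blast
      then have "L p = u * (cross2 (z - x) (y - x))\<^sup>2"
        by (simp add: L_def power2_eq_square del: cross2_simps(3,4))
      then show ?thesis using \<open>0 \<le> u\<close> by simp
    qed
    have La: "L (a + t *\<^sub>R s) = t * (cross2 (z - x) s * cross2 (z - x) (y - x))" for t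
      unfolding L_def a by (simp add: del: cross2_simps(3,4))
    have "cross2 (z - x) s \<noteq> 0" using h cross2_commute[of s] by simp
    moreover have "cross2 (z - x) (y - x) \<noteq> 0" using ncol cross2_commute[of "z - x"] by (simp del: cross2_simps(3,4))
    ultimately have ne: "cross2 (z - x) s * cross2 (z - x) (y - x) \<noteq> 0" by simp
    have "L (a + \<delta> *\<^sub>R s) \<ge> 0" "L (a + (- \<delta>) *\<^sub>R s) \<ge> 0"
      using near[of \<delta>] near[of "- \<delta>"] \<delta>0 Lpos by auto
    then show False unfolding La using ne \<delta>0 by (auto simp: mult_le_0_iff zero_le_mult_iff)
  qed
qed

text \<open>
  Seen from \<open>y\<close>, the rays to \<open>x\<close>, \<open>b\<close>, \<open>c\<close>, \<open>z\<close> follow each other in this order within an angle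
  less than \<open>\<pi>\<close>, so their heights change sign only once.
\<close>

lemma not_both_turn:
  assumes h: "cross2 s z < cross2 s y" "cross2 s y < cross2 s x"
    "cross2 s b \<le> cross2 s y" "cross2 s y \<le> cross2 s c"
  shows False
proof -
  have coords: "\<exists>u v. p - y = u *\<^sub>R (x - y) + v *\<^sub>R (z - y) \<and> 0 \<le> u \<and> 0 \<le> v" if "p \<in> \<Gamma>" for p
  proof -
    have "p \<in> convex hull {y, x, z}" using that \<Gamma> by (auto simp: insert_commute)
    then obtain u v where "p = y + u *\<^sub>R (x - y) + v *\<^sub>R (z - y)" "0 \<le> u" "0 \<le> v"
      unfolding convex_hull_3_alt by blast
    then show ?thesis by (auto simp: algebra_simps)
  qed
  obtain \<beta>1 \<beta>2 where b: "b - y = \<beta>1 *\<^sub>R (x - y) + \<beta>2 *\<^sub>R (z - y)" "0 \<le> \<beta>1" "0 \<le> \<beta>2"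
    using coords xyz_in by blast
  obtain \<gamma>1 \<gamma>2 where c: "c - y = \<gamma>1 *\<^sub>R (x - y) + \<gamma>2 *\<^sub>R (z - y)" "0 \<le> \<gamma>1" "0 \<le> \<gamma>2"
    using coords xyz_in by blast
  define X Z where "X = cross2 s (x - y)" and "Z = cross2 s (y - z)"
  have XZ: "X > 0" "Z > 0" using h by (simp_all add: X_def Z_def)
  have "cross2 s (b - y) = \<beta>1 * X - \<beta>2 * Z" "cross2 s (c - y) = \<gamma>1 * X - \<gamma>2 * Z"
    unfolding b c X_def Z_def by (simp_all add: algebra_simps)
  then have bc: "\<beta>1 * X \<le> \<beta>2 * Z" "\<gamma>2 * Z \<le> \<gamma>1 * X" using h by simp_all
  have "\<beta>2 \<noteq> 0"
  proof
    assume "\<beta>2 = 0"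
    then have "\<beta>1 = 0" using bc(1) XZ b by (simp add: mult_le_0_iff)
    then show False using b \<open>\<beta>2 = 0\<close> corners by simp
  qed
  then have \<beta>2: "\<beta>2 > 0" using b by simp
  \<comment> \<open>Multiplying the two height conditions compares two rays from \<open>y\<close>:
    the ray to \<open>c\<close> is at least as close to the ray to \<open>x\<close> as the ray to
    \<open>b\<close> is.\<close>
  have "(\<beta>1 * X) * (\<gamma>2 * Z) \<le> (\<beta>2 * Z) * (\<gamma>1 * X)"
    using b c XZ by (intro mult_mono[OF bc]) auto
  then have "(\<beta>1 * \<gamma>2) * (X * Z) \<le> (\<beta>2 * \<gamma>1) * (X * Z)" by (simp add: algebra_simps)
  then have cross: "\<beta>1 * \<gamma>2 \<le> \<beta>2 * \<gamma>1" using XZ by simp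
  \<comment> \<open>Coordinates of \<open>c - y\<close> with respect to \<open>x - y\<close> and
    \<open>b - y\<close>. Since they are nonnegative, the segment from \<open>y\<close> to
    \<open>c\<close> starts in the triangle \<open>x b y\<close>, which is empty up to its
    roof.\<close>
  define u v where "u = \<gamma>1 - \<gamma>2 * \<beta>1 / \<beta>2" and "v = \<gamma>2 / \<beta>2"
  have uv: "u \<ge> 0" "v \<ge> 0" using cross \<beta>2 c by (simp_all add: u_def v_def field_simps)
  have cuv: "c - y = u *\<^sub>R (x - y) + v *\<^sub>R (b - y)"
    unfolding b c u_def v_def using \<beta>2 by (simp add: algebra_simps)
  define \<epsilon> where "\<epsilon> = 1 / (1 + u + v)"
  have \<epsilon>: "0 < \<epsilon>" "\<epsilon> \<le> 1" "\<epsilon> * u + \<epsilon> * v \<le> 1"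
    using uv by (simp_all add: \<epsilon>_def field_simps flip: distrib_left add_divide_distrib)
  define p where "p = y + \<epsilon> *\<^sub>R (c - y)"
  have "p = y + (\<epsilon> * u) *\<^sub>R (x - y) + (\<epsilon> * v) *\<^sub>R (b - y)" unfolding p_def cuv by (simp add: algebra_simps)
  then have "p \<in> convex hull {y, x, b}" unfolding convex_hull_3_alt
    using \<epsilon> uv by (intro CollectI exI[of _ "\<epsilon> * u"] exI[of _ "\<epsilon> * v"]) auto
  then have p1: "p \<in> convex hull {x, b, y}" by (simp add: insert_commute)
  have "p = (1 - \<epsilon>) *\<^sub>R y + \<epsilon> *\<^sub>R c" unfolding p_def by (simp add: algebra_simps)
  then have p2: "p \<in> closed_segment y c"
    unfolding in_segment using \<epsilon> by (intro exI[of _ \<epsilon>]) simp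
  then have "p \<in> closed_segment x b \<union> closed_segment b y" using p1 empty(2) roofs by blast
  then have "p = y" using p2 simple(2) by blast
  then show False using \<epsilon> corners by (simp add: p_def)
qed

lemma cross2_hull_bounds:
  assumes "p \<in> \<Gamma>" "cross2 s z \<le> cross2 s y" "cross2 s y \<le> cross2 s x"
  obtains u v where "p = x + u *\<^sub>R (y - x) + v *\<^sub>R (z - x)" "0 \<le> u" "0 \<le> v" "u + v \<le> 1"
    "cross2 s x - cross2 s p = u * (cross2 s x - cross2 s y) + v * (cross2 s x - cross2 s z)"
    "cross2 s p - cross2 s z = (1 - u - v) * (cross2 s x - cross2 s z) + u * (cross2 s y - cross2 s z)"
proof -
  obtain u v where "p = x + u *\<^sub>R (y - x) + v *\<^sub>R (z - x)" "0 \<le> u" "0 \<le> v" "u + v \<le> 1"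
    using assms(1) \<Gamma> unfolding convex_hull_3_alt by blast
  moreover from this(1) have "cross2 s p = cross2 s x + u * (cross2 s y - cross2 s x) + v * (cross2 s z - cross2 s x)"
    by simp
  ultimately show thesis by (intro that) (auto simp: algebra_simps)
qed

text \<open>A corner at the height of \<open>x\<close> differs from \<open>x\<close>, so it would
  lie on the side from \<open>x\<close> to \<open>y\<close>, hence in the triangle
  \<open>x b y\<close> and on its roof. Only \<open>b\<close> can be there, and only if
  \<open>y\<close> is as high as \<open>x\<close>.\<close>

lemma below_top:
  assumes h: "cross2 s z \<le> cross2 s y" "cross2 s y \<le> cross2 s x" "cross2 s z < cross2 s x"
    and p: "p \<in> {a, b, c}" and "cross2 s y = cross2 s x \<Longrightarrow> p \<noteq> b"
  shows "cross2 s p < cross2 s x"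
proof -
  have "p \<in> \<Gamma>" using p xyz_in by blast
  then obtain u v where uv: "p = x + u *\<^sub>R (y - x) + v *\<^sub>R (z - x)" "0 \<le> u" "0 \<le> v" "u + v \<le> 1"
    and hp: "cross2 s x - cross2 s p = u * (cross2 s x - cross2 s y) + v * (cross2 s x - cross2 s z)"
    using cross2_hull_bounds h by metis
  have nonneg: "u * (cross2 s x - cross2 s y) \<ge> 0" "v * (cross2 s x - cross2 s z) \<ge> 0" using uv h by simp_all
  show ?thesis
  proof (rule ccontr)
    assume "\<not> ?thesis"
    then have "u * (cross2 s x - cross2 s y) = 0" "v * (cross2 s x - cross2 s z) = 0" using nonneg hp by linarith+
    then have v: "v = 0" and u: "u = 0 \<or> cross2 s y = cross2 s x" using h by auto
    have "u \<noteq> 0" using uv v corners p by auto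
    then have "p \<noteq> b" using u assms(5) by blast
    have "p = (1 - u) *\<^sub>R x + u *\<^sub>R y" using uv v by (simp add: algebra_simps)
    then have "p \<in> closed_segment x y" using uv v by (auto simp: in_segment)
    also have "\<dots> \<subseteq> convex hull {x, b, y}" unfolding segment_convex_hull by (intro hull_mono) auto
    finally have "p \<in> closed_segment x b \<union> closed_segment b y" using empty(2) \<open>p \<in> \<Gamma>\<close> by blast
    then show False using p \<open>p \<noteq> b\<close> simple corners by auto
  qed
qed

lemma above_bottom:
  assumes h: "cross2 s z \<le> cross2 s y" "cross2 s y \<le> cross2 s x" "cross2 s z < cross2 s x"
    and p: "p \<in> {a, b, c}" and "cross2 s y = cross2 s z \<Longrightarrow> p \<noteq> c"
  shows "cross2 s z < cross2 s p"
proof -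
  \<comment> \<open>The mirror image exchanges \<open>x\<close> with \<open>z\<close> and
    \<open>b\<close> with \<open>c\<close>; together with \<open>- s\<close> it turns the bottom
    into the top.\<close>
  interpret r: reflex_hexagon \<Gamma> a c b z y x
    using reflex_hexagon.reflect[OF rotate] .
  show ?thesis
    using r.below_top[of "- s" p] assms by (simp add: insert_commute)
qed

text \<open>\<open>f v\<close> says that one of the two directions is blocked at \<open>v\<close>.
  This holds if the height of \<open>v\<close> is strictly between the heights of its two bends. The
  bends of \<open>a\<close> are the lowest and the highest one, so \<open>a\<close> qualifies. If
  \<open>y\<close> ties with one of them, \<open>c\<close> or \<open>b\<close> qualifies as well;
  otherwise \<open>not_both_turn\<close> provides one of the two.\<close>

lemma two_not_sees_both_ordered:
  assumes s: "s \<noteq> 0" and h: "cross2 s z \<le> cross2 s y" "cross2 s y \<le> cross2 s x"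
  defines "f \<equiv> \<lambda>v. \<not> (sees v s \<and> sees v (- s))"
  shows "f a \<and> f b \<or> f b \<and> f c \<or> f a \<and> f c"
proof -
  have zx: "cross2 s z < cross2 s x"
  proof (rule ccontr)
    assume "\<not> ?thesis"
    then have 1: "cross2 s (y - x) = 0" "cross2 s (z - x) = 0" using h by simp_all
    then obtain k l where "y - x = k *\<^sub>R s" "z - x = l *\<^sub>R s" using cross2_eq_0_imp_scaled[OF _ s] by metis
    then show False using ncol by (simp del: cross2_simps(3,4))
  qed
  interpret rb: reflex_hexagon \<Gamma> b c a y z x by (rule rotate)
  interpret rc: reflex_hexagon \<Gamma> c a b z x y by (rule rb.rotate)
  have ne: "a \<noteq> b" "b \<noteq> c" "a \<noteq> c" using simple corners by auto
  have fa: "f a"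
    using not_sees_both[OF s] below_top[OF h zx, of a] above_bottom[OF h zx, of a] ne by (simp add: f_def)
  have fb: "f b" if "cross2 s y < cross2 s b" "cross2 s b < cross2 s x"
    using rb.not_sees_both[of "- s"] s that by (auto simp: f_def)
  have fc: "f c" if "cross2 s z < cross2 s c" "cross2 s c < cross2 s y"
    using rc.not_sees_both[of "- s"] s that by (auto simp: f_def)
  consider "cross2 s y = cross2 s x" | "cross2 s y = cross2 s z" "cross2 s y < cross2 s x"
    | "cross2 s z < cross2 s y" "cross2 s y < cross2 s x" using h by linarith
  then show ?thesis
  proof cases
    case 1
    then have "f c" using fc below_top[OF h zx, of c] above_bottom[OF h zx, of c] ne zx by auto
    then show ?thesis using fa by simp
  next
    case 2
    then have "f b" using fb below_top[OF h zx, of b] above_bottom[OF h zx, of b] ne zx by auto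
    then show ?thesis using fa by simp
  next
    case 3
    then consider "cross2 s y < cross2 s b" | "cross2 s c < cross2 s y" using not_both_turn by force
    then have "f b \<or> f c"
    proof cases
      case 1
      then show ?thesis using fb below_top[OF h zx, of b] 3 by simp
    next
      case 2
      then show ?thesis using fc above_bottom[OF h zx, of c] 3 by simp
    qed
    then show ?thesis using fa by blast
  qed
qed

lemma two_not_sees_both:
  assumes s: "s \<noteq> 0"
  defines "f \<equiv> \<lambda>v. \<not> (sees v s \<and> sees v (- s))"
  shows "f a \<and> f b \<or> f b \<and> f c \<or> f a \<and> f c"
proof -
  interpret rb: reflex_hexagon \<Gamma> b c a y z x by (rule rotate)
  interpret rc: reflex_hexagon \<Gamma> c a b z x y by (rule rb.rotate)
  interpret sa: reflex_hexagon \<Gamma> c b a y x z by (rule reflect)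
  interpret sb: reflex_hexagon \<Gamma> a c b z y x by (rule rb.reflect)
  interpret sc: reflex_hexagon \<Gamma> b a c x z y by (rule rc.reflect)
  note * = two_not_sees_both_ordered[OF s] rb.two_not_sees_both_ordered[OF s]
    rc.two_not_sees_both_ordered[OF s] sa.two_not_sees_both_ordered[OF s]
    sb.two_not_sees_both_ordered[OF s] sc.two_not_sees_both_ordered[OF s]
  \<comment> \<open>The six relabellings cover all orders of the heights of \<open>x\<close>,
    \<open>y\<close> and \<open>z\<close>.\<close>
  show ?thesis unfolding f_def
    by (cases "cross2 s x \<le> cross2 s y"; cases "cross2 s y \<le> cross2 s z"; cases "cross2 s z \<le> cross2 s x")
      (insert *, auto simp: not_le dest: less_imp_le)
qed

end

section \<open>Straight-line drawings of stacked triangulations\<close>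

definition noncollinear :: "complex \<Rightarrow> complex \<Rightarrow> complex \<Rightarrow> bool" where
  "noncollinear a b c \<longleftrightarrow> (\<forall>x y z. x + y + z = 0 \<longrightarrow> x *\<^sub>R a + y *\<^sub>R b + z *\<^sub>R c = 0 \<longrightarrow> x = 0 \<and> y = 0 \<and> z = 0)"

text \<open>\<open>P\<close> restricts the barycentric coordinates. As these are unique for
  noncollinear corners, disjointness of regions becomes incompatibility of inequalities.\<close>

definition bary_region :: "complex \<Rightarrow> complex \<Rightarrow> complex \<Rightarrow> (real \<Rightarrow> real \<Rightarrow> real \<Rightarrow> bool) \<Rightarrow> complex set" where
  "bary_region a b c P = {x *\<^sub>R a + y *\<^sub>R b + z *\<^sub>R c | x y z. x + y + z = 1 \<and> P x y z}"

abbreviation open_triangle :: "complex \<Rightarrow> complex \<Rightarrow> complex \<Rightarrow> complex set" where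
  "open_triangle a b c \<equiv> bary_region a b c (\<lambda>x y z. x > 0 \<and> y > 0 \<and> z > 0)"

lemma bary_region_disjoint:
  assumes "noncollinear a b c" "\<And>x y z. \<not> (P x y z \<and> Q x y z)"
  shows "bary_region a b c P \<inter> bary_region a b c Q = {}"
proof -
  have False if "x + y + z = 1" "x' + y' + z' = 1" "P x y z" "Q x' y' z'"
    and eq: "x *\<^sub>R a + y *\<^sub>R b + z *\<^sub>R c = x' *\<^sub>R a + y' *\<^sub>R b + z' *\<^sub>R c" for x y z x' y' z'
  proof -
    have "(x - x') *\<^sub>R a + (y - y') *\<^sub>R b + (z - z') *\<^sub>R c = 0"
      using eq by (simp add: algebra_simps)
    then have "x - x' = 0 \<and> y - y' = 0 \<and> z - z' = 0"
      using assms(1) that unfolding noncollinear_def by (metis (no_types, lifting) add_diff_add diff_self)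
    then show False using that assms(2) by simp
  qed
  then show ?thesis unfolding bary_region_def by blast
qed

lemma bary_region_mono:
  assumes "\<And>x y z. P x y z \<Longrightarrow> Q x y z"
  shows "bary_region a b c P \<subseteq> bary_region a b c Q"
  using assms unfolding bary_region_def by blast

lemma bary_region_rotate: "bary_region b c a (\<lambda>y z x. P x y z) = bary_region a b c P"
proof (intro set_eqI iffI)
  fix p assume "p \<in> bary_region b c a (\<lambda>y z x. P x y z)"
  then obtain y z x where "p = y *\<^sub>R b + z *\<^sub>R c + x *\<^sub>R a" "y + z + x = 1" "P x y z"
    unfolding bary_region_def by blast
  then show "p \<in> bary_region a b c P" unfolding bary_region_def
    by (intro CollectI exI[of _ x] exI[of _ y] exI[of _ z]) (simp add: algebra_simps)
next
  fix p assume "p \<in> bary_region a b c P"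
  then obtain x y z where "p = x *\<^sub>R a + y *\<^sub>R b + z *\<^sub>R c" "x + y + z = 1" "P x y z"
    unfolding bary_region_def by blast
  then show "p \<in> bary_region b c a (\<lambda>y z x. P x y z)" unfolding bary_region_def
    by (intro CollectI exI[of _ x] exI[of _ y] exI[of _ z]) (simp add: algebra_simps)
qed

lemma open_triangle_rotate: "open_triangle b c a = open_triangle a b c"
  using bary_region_rotate[of b c a "\<lambda>x y z. x > 0 \<and> y > 0 \<and> z > 0"] by (simp add: conj_ac)

lemma noncollinear_rotateI: "noncollinear a b c \<Longrightarrow> noncollinear b c a"
  unfolding noncollinear_def
proof (intro allI impI)
  fix x y z :: real
  assume nc: "\<forall>x y z. x + y + z = 0 \<longrightarrow> x *\<^sub>R a + y *\<^sub>R b + z *\<^sub>R c = 0 \<longrightarrow> x = 0 \<and> y = 0 \<and> z = 0"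
    and "x + y + z = 0" "x *\<^sub>R b + y *\<^sub>R c + z *\<^sub>R a = 0"
  moreover have "z + x + y = x + y + z" "z *\<^sub>R a + x *\<^sub>R b + y *\<^sub>R c = x *\<^sub>R b + y *\<^sub>R c + z *\<^sub>R a"
    by simp_all
  ultimately have "z + x + y = 0" "z *\<^sub>R a + x *\<^sub>R b + y *\<^sub>R c = 0" by metis+
  then show "x = 0 \<and> y = 0 \<and> z = 0" using nc by blast
qed

definition centroid :: "complex \<Rightarrow> complex \<Rightarrow> complex \<Rightarrow> complex" where
  "centroid a b c = (1/3) *\<^sub>R a + (1/3) *\<^sub>R b + (1/3) *\<^sub>R c"

lemma centroid_region:
  assumes "P (1/3) (1/3) (1/3)"
  shows "centroid a b c \<in> bary_region a b c P"
proof -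
  have "1/3 + 1/3 + 1/3 = (1::real)" by simp
  then show ?thesis using assms unfolding bary_region_def centroid_def by blast
qed

text \<open>A third of the weight of the centroid goes to each corner, which leaves \<open>c\<close>
  with the strictly smallest coordinate.\<close>

lemma open_triangle_centroid:
  "open_triangle a b (centroid a b c) \<subseteq> bary_region a b c (\<lambda>x y z. 0 < z \<and> z < x \<and> z < y)"
proof
  fix p assume "p \<in> open_triangle a b (centroid a b c)"
  then obtain x y z where p: "p = x *\<^sub>R a + y *\<^sub>R b + z *\<^sub>R centroid a b c"
    and xyz: "x + y + z = 1" "0 < x" "0 < y" "0 < z" unfolding bary_region_def by blast
  have "p = (x + z/3) *\<^sub>R a + (y + z/3) *\<^sub>R b + (z/3) *\<^sub>R c"
    unfolding p centroid_def by (simp add: algebra_simps)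
  then show "p \<in> bary_region a b c (\<lambda>x y z. 0 < z \<and> z < x \<and> z < y)"
    unfolding bary_region_def using xyz
    by (intro CollectI exI[of _ "x + z/3"] exI[of _ "y + z/3"] exI[of _ "z/3"]) simp
qed

lemma open_segment_centroid:
  "open_segment (centroid a b c) a \<subseteq> bary_region a b c (\<lambda>x y z. 0 < y \<and> y = z \<and> y < x)"
proof
  fix p assume "p \<in> open_segment (centroid a b c) a"
  then obtain t where p: "p = (1 - t) *\<^sub>R centroid a b c + t *\<^sub>R a" and t: "0 < t" "t < 1"
    unfolding in_segment by blast
  have "p = ((1 - t)/3 + t) *\<^sub>R a + ((1 - t)/3) *\<^sub>R b + ((1 - t)/3) *\<^sub>R c"
    unfolding p centroid_def by (simp add: algebra_simps)
  then show "p \<in> bary_region a b c (\<lambda>x y z. 0 < y \<and> y = z \<and> y < x)"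
    unfolding bary_region_def using t
    by (intro CollectI exI[of _ "(1 - t)/3 + t"] exI[of _ "(1 - t)/3"]) (simp add: field_simps)
qed

lemma noncollinear_centroid:
  assumes "noncollinear a b c"
  shows "noncollinear a b (centroid a b c)"
  unfolding noncollinear_def
proof (intro allI impI)
  fix x y z :: real
  assume s: "x + y + z = 0" and 0: "x *\<^sub>R a + y *\<^sub>R b + z *\<^sub>R centroid a b c = 0"
  have "(x + z/3) *\<^sub>R a + (y + z/3) *\<^sub>R b + (z/3) *\<^sub>R c = 0"
    using 0 unfolding centroid_def by (simp add: algebra_simps)
  moreover have "(x + z/3) + (y + z/3) + z/3 = 0" using s by simp
  ultimately have "x + z/3 = 0 \<and> y + z/3 = 0 \<and> z/3 = 0"
    using assms unfolding noncollinear_def by blast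
  then show "x = 0 \<and> y = 0 \<and> z = 0" by simp
qed

text \<open>Each piece is recognised by the coordinates that attain the minimum: one of them on an
  open triangle, two on an open segment, all three at \<open>q\<close>.\<close>

lemma centroid_subdivision:
  assumes nc: "noncollinear a b c"
  defines "q \<equiv> centroid a b c"
  shows "q \<in> open_triangle a b c"
    and "open_segment q a \<union> open_segment q b \<union> open_segment q c \<subseteq> open_triangle a b c"
    and "open_segment q a \<inter> open_segment q b = {}" "open_segment q b \<inter> open_segment q c = {}"
      "open_segment q a \<inter> open_segment q c = {}"
    and "noncollinear a b q" "noncollinear q b c" "noncollinear a q c"
    and "open_triangle a b q \<union> open_triangle q b c \<union> open_triangle a q c \<subseteq> open_triangle a b c"
    and "open_triangle a b q \<inter> open_triangle q b c = {}" "open_triangle q b c \<inter> open_triangle a q c = {}"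
      "open_triangle a b q \<inter> open_triangle a q c = {}"
    and "insert q (open_segment q a \<union> open_segment q b \<union> open_segment q c) \<inter>
      (open_triangle a b q \<union> open_triangle q b c \<union> open_triangle a q c) = {}"
proof -
  let ?R = "bary_region a b c"
  have q': "centroid b c a = q" "centroid c a b = q" unfolding q_def by (simp_all add: centroid_def)
  have rot: "bary_region b c a (\<lambda>x y z. P z x y) = ?R P" "bary_region c a b (\<lambda>x y z. P y z x) = ?R P" for P
    using bary_region_rotate[of b c a P] bary_region_rotate[of c a b "\<lambda>y z x. P x y z"] by simp_all
  have S1: "open_segment q a \<subseteq> ?R (\<lambda>x y z. 0 < y \<and> y = z \<and> y < x)"
    unfolding q_def by (rule open_segment_centroid)
  have S2: "open_segment q b \<subseteq> ?R (\<lambda>x y z. 0 < z \<and> z = x \<and> z < y)"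
    using open_segment_centroid[of b c a] rot(1)[of "\<lambda>x y z. 0 < z \<and> z = x \<and> z < y"] q' by simp
  have S3: "open_segment q c \<subseteq> ?R (\<lambda>x y z. 0 < x \<and> x = y \<and> x < z)"
    using open_segment_centroid[of c a b] rot(2)[of "\<lambda>x y z. 0 < x \<and> x = y \<and> x < z"] q' by simp
  have Q: "{q} \<subseteq> ?R (\<lambda>x y z. 0 < x \<and> x = y \<and> y = z)"
    unfolding q_def by (simp add: centroid_region)
  have T1: "open_triangle a b q \<subseteq> ?R (\<lambda>x y z. 0 < z \<and> z < x \<and> z < y)"
    unfolding q_def by (rule open_triangle_centroid)
  have T2: "open_triangle q b c \<subseteq> ?R (\<lambda>x y z. 0 < x \<and> x < y \<and> x < z)"
    using open_triangle_centroid[of b c a] rot(1)[of "\<lambda>x y z. 0 < x \<and> x < y \<and> x < z"] q'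
      open_triangle_rotate[of b c q] by simp
  have T3: "open_triangle a q c \<subseteq> ?R (\<lambda>x y z. 0 < y \<and> y < z \<and> y < x)"
    using open_triangle_centroid[of c a b] rot(2)[of "\<lambda>x y z. 0 < y \<and> y < z \<and> y < x"] q'
      open_triangle_rotate[of c a q] open_triangle_rotate[of a q c] by simp
  have disj: "A \<inter> B = {}" if "A \<subseteq> ?R P" "B \<subseteq> ?R Q" "\<And>x y z. \<not> (P x y z \<and> Q x y z)" for A B P Q
    using bary_region_disjoint[OF nc, of P Q] that by blast
  show "q \<in> open_triangle a b c" unfolding q_def by (rule centroid_region) simp
  show "open_segment q a \<union> open_segment q b \<union> open_segment q c \<subseteq> open_triangle a b c"
    by (intro Un_least S1[THEN order_trans] S2[THEN order_trans] S3[THEN order_trans] bary_region_mono) auto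
  show "open_triangle a b q \<union> open_triangle q b c \<union> open_triangle a q c \<subseteq> open_triangle a b c"
    by (intro Un_least T1[THEN order_trans] T2[THEN order_trans] T3[THEN order_trans] bary_region_mono) auto
  show "open_segment q a \<inter> open_segment q b = {}" by (rule disj[OF S1 S2]) auto
  show "open_segment q b \<inter> open_segment q c = {}" by (rule disj[OF S2 S3]) auto
  show "open_segment q a \<inter> open_segment q c = {}" by (rule disj[OF S1 S3]) auto
  show "open_triangle a b q \<inter> open_triangle q b c = {}" by (rule disj[OF T1 T2]) auto
  show "open_triangle q b c \<inter> open_triangle a q c = {}" by (rule disj[OF T2 T3]) auto
  show "open_triangle a b q \<inter> open_triangle a q c = {}" by (rule disj[OF T1 T3]) auto
  show "noncollinear a b q" unfolding q_def by (rule noncollinear_centroid[OF nc])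
  show "noncollinear q b c"
    using noncollinear_centroid[of b c a] q' nc by (metis noncollinear_rotateI)
  show "noncollinear a q c"
    using noncollinear_centroid[of c a b] q' nc by (metis noncollinear_rotateI)
  have "{q} \<inter> open_triangle a b q = {}" by (rule disj[OF Q T1]) auto
  moreover have "{q} \<inter> open_triangle q b c = {}" by (rule disj[OF Q T2]) auto
  moreover have "{q} \<inter> open_triangle a q c = {}" by (rule disj[OF Q T3]) auto
  moreover have "open_segment q a \<inter> open_triangle a b q = {}" by (rule disj[OF S1 T1]) auto
  moreover have "open_segment q a \<inter> open_triangle q b c = {}" by (rule disj[OF S1 T2]) auto
  moreover have "open_segment q a \<inter> open_triangle a q c = {}" by (rule disj[OF S1 T3]) auto
  moreover have "open_segment q b \<inter> open_triangle a b q = {}" by (rule disj[OF S2 T1]) auto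
  moreover have "open_segment q b \<inter> open_triangle q b c = {}" by (rule disj[OF S2 T2]) auto
  moreover have "open_segment q b \<inter> open_triangle a q c = {}" by (rule disj[OF S2 T3]) auto
  moreover have "open_segment q c \<inter> open_triangle a b q = {}" by (rule disj[OF S3 T1]) auto
  moreover have "open_segment q c \<inter> open_triangle q b c = {}" by (rule disj[OF S3 T2]) auto
  moreover have "open_segment q c \<inter> open_triangle a q c = {}" by (rule disj[OF S3 T3]) auto
  ultimately show "insert q (open_segment q a \<union> open_segment q b \<union> open_segment q c) \<inter>
      (open_triangle a b q \<union> open_triangle q b c \<union> open_triangle a q c) = {}"
    by (subst insert_is_Un) (simp only: Int_Un_distrib Int_Un_distrib2 Un_empty_left)
qed

section \<open>Straight-line drawings with a record of empty triangles\<close>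

definition face_triangle :: "('a \<Rightarrow> complex) \<Rightarrow> 'a \<times> 'a \<times> 'a \<Rightarrow> complex set" where
  "face_triangle p = (\<lambda>(u, v, w). open_triangle (p u) (p v) (p w))"

definition edge_segment :: "('a \<Rightarrow> complex) \<Rightarrow> 'a \<times> 'a \<Rightarrow> complex set" where
  "edge_segment p = (\<lambda>(u, v). open_segment (p u) (p v))"

text \<open>
  \<open>F\<close> is a set of triangles that are empty in the drawing; it need not contain all faces. \<open>E\<close> may
  contain one or both orientations of an edge.
\<close>

locale straight_drawing =
  fixes V :: "'a set" and E :: "('a \<times> 'a) set" and F :: "('a \<times> 'a \<times> 'a) set" and p :: "'a \<Rightarrow> complex"
  assumes inj: "inj_on p V"
    and E: "E \<subseteq> V \<times> V" "\<And>u v. (u, v) \<in> E \<Longrightarrow> u \<noteq> v"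
    and F: "F \<subseteq> V \<times> V \<times> V" "\<And>u v w. (u, v, w) \<in> F \<Longrightarrow> noncollinear (p u) (p v) (p w)"
    and EV: "\<And>e. e \<in> E \<Longrightarrow> edge_segment p e \<inter> p ` V = {}"
    and EE: "\<And>u v x y. (u, v) \<in> E \<Longrightarrow> (x, y) \<in> E \<Longrightarrow> {u, v} \<noteq> {x, y} \<Longrightarrow>
      edge_segment p (u, v) \<inter> edge_segment p (x, y) = {}"
    and FV: "\<And>f. f \<in> F \<Longrightarrow> face_triangle p f \<inter> p ` V = {}"
    and FE: "\<And>f e. f \<in> F \<Longrightarrow> e \<in> E \<Longrightarrow> face_triangle p f \<inter> edge_segment p e = {}"
    and FF: "\<And>f g. f \<in> F \<Longrightarrow> g \<in> F \<Longrightarrow> f \<noteq> g \<Longrightarrow> face_triangle p f \<inter> face_triangle p g = {}"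

text \<open>Everything new lies in the open triangle of the face \<open>(u, v, w)\<close>, which
  meets nothing old; among themselves the new pieces are separated by
  \<open>centroid_subdivision\<close>.\<close>

lemma straight_drawing_insert:
  assumes "straight_drawing V E F p" and f: "(u, v, w) \<in> F" and x: "x \<notin> V"
  shows "straight_drawing (insert x V) (E \<union> {(x, u), (x, v), (x, w)})
    (F - {(u, v, w)} \<union> {(x, v, w), (u, x, w), (u, v, x)}) (p(x := centroid (p u) (p v) (p w)))"
proof -
  interpret straight_drawing V E F p by fact
  define q where "q = centroid (p u) (p v) (p w)"
  define p' where "p' = p(x := q)"
  have uvw: "u \<in> V" "v \<in> V" "w \<in> V" and nc: "noncollinear (p u) (p v) (p w)" using F(1) F(2)[OF f] f by auto
  note sub = centroid_subdivision[OF nc, folded q_def]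
  have ne: "u \<noteq> x" "v \<noteq> x" "w \<noteq> x" using uvw x by auto
  let ?T = "open_triangle (p u) (p v) (p w)"
  let ?NE = "{(x, u), (x, v), (x, w)}" and ?NF = "{(x, v, w), (u, x, w), (u, v, x)}"
  have p'x: "p' x = q" and p'V: "\<And>a. a \<in> V \<Longrightarrow> p' a = p a" using x by (auto simp: p'_def)
  have TV: "?T \<inter> p ` V = {}" using FV[OF f] by (simp add: face_triangle_def)
  have TE: "?T \<inter> edge_segment p e = {}" if "e \<in> E" for e using FE[OF f that] by (simp add: face_triangle_def)
  have TF: "?T \<inter> face_triangle p g = {}" if "g \<in> F - {(u, v, w)}" for g
    using FF[OF f] that by (auto simp: face_triangle_def)
  have img: "p' ` insert x V = insert q (p ` V)" using p'x p'V by auto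
  have oldE: "edge_segment p' e = edge_segment p e" if "e \<in> E" for e
    using that E(1) p'V by (auto simp: edge_segment_def)
  have oldF: "face_triangle p' g = face_triangle p g" if "g \<in> F" for g
    using that F(1) p'V by (auto simp: face_triangle_def)
  have newE: "edge_segment p' (x, u) = open_segment q (p u)" "edge_segment p' (x, v) = open_segment q (p v)"
    "edge_segment p' (x, w) = open_segment q (p w)"
    using p'x p'V uvw by (simp_all add: edge_segment_def)
  have newF: "face_triangle p' (x, v, w) = open_triangle q (p v) (p w)"
    "face_triangle p' (u, x, w) = open_triangle (p u) q (p w)"
    "face_triangle p' (u, v, x) = open_triangle (p u) (p v) q"
    using p'x p'V uvw by (simp_all add: face_triangle_def)
  have newET: "edge_segment p' e \<subseteq> ?T" "q \<notin> edge_segment p' e" if "e \<in> ?NE" for e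
    using that sub(2) newE by (auto simp: open_segment_def)
  have newFT: "face_triangle p' g \<subseteq> ?T" "q \<notin> face_triangle p' g" if "g \<in> ?NF" for g
    using that sub(9,13) newF by auto
  have qT: "q \<in> ?T" by (rule sub(1))
  have newFE: "face_triangle p' g \<inter> edge_segment p' e = {}" if "g \<in> ?NF" "e \<in> ?NE" for g e
    using that sub(13) newE newF by auto
  have newFF: "face_triangle p' g \<inter> face_triangle p' h = {}" if "g \<in> ?NF" "h \<in> ?NF" "g \<noteq> h" for g h
    using that sub(10-12) newF by auto
  have newEE: "edge_segment p' e \<inter> edge_segment p' e' = {}" if "e \<in> ?NE" "e' \<in> ?NE" "e \<noteq> e'" for e e'
    using that sub(3-5) newE by auto
  have "straight_drawing (insert x V) (E \<union> ?NE) (F - {(u, v, w)} \<union> ?NF) p'"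
  proof
    show "inj_on p' (insert x V)"
    proof -
      have "inj_on p' V" using inj p'V inj_on_cong[of V p' p] by blast
      moreover have "q \<notin> p' ` V" using qT TV p'V by auto
      ultimately show ?thesis using p'x by auto
    qed
    show "E \<union> ?NE \<subseteq> insert x V \<times> insert x V" using E uvw by auto
    show "a \<noteq> b" if "(a, b) \<in> E \<union> ?NE" for a b using that E ne by auto
    show "F - {(u, v, w)} \<union> ?NF \<subseteq> insert x V \<times> insert x V \<times> insert x V"
    proof (rule Un_least)
      show "F - {(u, v, w)} \<subseteq> insert x V \<times> insert x V \<times> insert x V"
        by (rule order_trans[OF Diff_subset order_trans[OF F(1) Sigma_mono[OF subset_insertI Sigma_mono[OF subset_insertI subset_insertI]]]])
      show "?NF \<subseteq> insert x V \<times> insert x V \<times> insert x V" using uvw by simp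
    qed
    show "noncollinear (p' a) (p' b) (p' c)" if "(a, b, c) \<in> F - {(u, v, w)} \<union> ?NF" for a b c
    proof (cases "(a, b, c) \<in> ?NF")
      case True
      then consider "a = x" "b = v" "c = w" | "a = u" "b = x" "c = w" | "a = u" "b = v" "c = x" by blast
      then show ?thesis by cases (simp_all add: sub(6-8) p'x p'V uvw)
    next
      case False
      then have "(a, b, c) \<in> F" using that by blast
      moreover from this have "a \<in> V" "b \<in> V" "c \<in> V" using F(1) by auto
      ultimately show ?thesis using F(2) p'V by simp
    qed
    show "edge_segment p' e \<inter> p' ` insert x V = {}" if "e \<in> E \<union> ?NE" for e
    proof (cases "e \<in> ?NE")
      case True
      then show ?thesis using newET[OF True] TV unfolding img by blast
    next
      case False
      then have "e \<in> E" using that by blast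
      then show ?thesis using EV[of e] TE[of e] oldE[of e] qT unfolding img by blast
    qed
    show "edge_segment p' (a, b) \<inter> edge_segment p' (c, d) = {}"
      if ab: "(a, b) \<in> E \<union> ?NE" and cd: "(c, d) \<in> E \<union> ?NE" and ne: "{a, b} \<noteq> {c, d}" for a b c d
    proof -
      consider "(a, b) \<in> E" "(c, d) \<in> E" | "(a, b) \<in> ?NE" "(c, d) \<in> E" | "(a, b) \<in> E" "(c, d) \<in> ?NE"
        | "(a, b) \<in> ?NE" "(c, d) \<in> ?NE" using ab cd by blast
      then show ?thesis
      proof cases
        case 1 then show ?thesis using EE oldE ne by simp
      next
        case 2 then show ?thesis using newET(1)[of "(a, b)"] TE[of "(c, d)"] oldE[of "(c, d)"] by blast
      next
        case 3 then show ?thesis using newET(1)[of "(c, d)"] TE[of "(a, b)"] oldE[of "(a, b)"] by blast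
      next
        case 4 then show ?thesis using newEE[of "(a, b)" "(c, d)"] ne by blast
      qed
    qed
    show "face_triangle p' g \<inter> p' ` insert x V = {}" if "g \<in> F - {(u, v, w)} \<union> ?NF" for g
    proof (cases "g \<in> ?NF")
      case True
      then show ?thesis using newFT[OF True] TV unfolding img by blast
    next
      case False
      then have "g \<in> F - {(u, v, w)}" using that by blast
      then show ?thesis using FV[of g] TF[of g] oldF[of g] qT unfolding img by blast
    qed
    show "face_triangle p' g \<inter> edge_segment p' e = {}"
      if g: "g \<in> F - {(u, v, w)} \<union> ?NF" and e: "e \<in> E \<union> ?NE" for g e
    proof -
      consider "g \<in> F - {(u, v, w)}" "e \<in> E" | "g \<in> ?NF" "e \<in> E" | "g \<in> F - {(u, v, w)}" "e \<in> ?NE"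
        | "g \<in> ?NF" "e \<in> ?NE" using g e by blast
      then show ?thesis
      proof cases
        case 1 then show ?thesis using FE oldE oldF by simp
      next
        case 2 then show ?thesis using newFT(1)[of g] TE[of e] oldE[of e] by blast
      next
        case 3 then show ?thesis using newET(1)[of e] TF[of g] oldF[of g] by blast
      next
        case 4 then show ?thesis using newFE[of g e] by blast
      qed
    qed
    show "face_triangle p' g \<inter> face_triangle p' h = {}"
      if g: "g \<in> F - {(u, v, w)} \<union> ?NF" and h: "h \<in> F - {(u, v, w)} \<union> ?NF" and ne: "g \<noteq> h" for g h
    proof -
      consider "g \<in> F - {(u, v, w)}" "h \<in> F - {(u, v, w)}" | "g \<in> ?NF" "h \<in> F - {(u, v, w)}"
        | "g \<in> F - {(u, v, w)}" "h \<in> ?NF" | "g \<in> ?NF" "h \<in> ?NF" using g h by blast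
      then show ?thesis
      proof cases
        case 1 then show ?thesis using FF oldF ne by simp
      next
        case 2 then show ?thesis using newFT(1)[of g] TF[of h] oldF[of h] by blast
      next
        case 3 then show ?thesis using newFT(1)[of h] TF[of g] oldF[of g] by blast
      next
        case 4 then show ?thesis using newFF[of g h] ne by blast
      qed
    qed
  qed
  then show ?thesis by (simp add: p'_def q_def)
qed

text \<open>Forgets the placement. Incidences and empty triangles are all that is needed to continue
  a drawing, so the construction becomes purely combinatorial.\<close>

definition stacked :: "'a set \<Rightarrow> ('a \<times> 'a) set \<Rightarrow> ('a \<times> 'a \<times> 'a) set \<Rightarrow> bool" where
  "stacked V E F \<longleftrightarrow> (\<exists>p. straight_drawing V E F p)"

lemma stackedI: "straight_drawing V E F p \<Longrightarrow> stacked V E F"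
  by (auto simp: stacked_def)

lemma stacked_insert:
  assumes "stacked V E F" "(u, v, w) \<in> F" "x \<notin> V"
  shows "stacked (insert x V) (E \<union> {(x, u), (x, v), (x, w)})
    (F - {(u, v, w)} \<union> {(x, v, w), (u, x, w), (u, v, x)})"
proof -
  obtain p where "straight_drawing V E F p" using assms(1) unfolding stacked_def by blast
  from straight_drawing_insert[OF this assms(2,3)] show ?thesis by (rule stackedI)
qed

lemma stacked_triangle:
  assumes "u \<noteq> v" "v \<noteq> w" "u \<noteq> w"
  shows "stacked {u, v, w} {(u, v), (v, w), (w, u)} {(u, v, w)}"
proof -
  define p :: "'a \<Rightarrow> complex" where "p = (\<lambda>a. if a = u then 0 else if a = v then 1 else \<i>)"
  have p: "p u = 0" "p v = 1" "p w = \<i>" using assms by (auto simp: p_def)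
  have "straight_drawing {u, v, w} {(u, v), (v, w), (w, u)} {(u, v, w)} p"
  proof
    show "edge_segment p e \<inter> p ` {u, v, w} = {}" if "e \<in> {(u, v), (v, w), (w, u)}" for e
      using that by (auto simp: edge_segment_def p in_segment complex_eq_iff)
    show "edge_segment p (a, b) \<inter> edge_segment p (c, d) = {}"
      if "(a, b) \<in> {(u, v), (v, w), (w, u)}" "(c, d) \<in> {(u, v), (v, w), (w, u)}" "{a, b} \<noteq> {c, d}" for a b c d
      using that by (auto simp: edge_segment_def p in_segment complex_eq_iff)
    show "face_triangle p f \<inter> p ` {u, v, w} = {}" if "f \<in> {(u, v, w)}" for f
      using that by (auto simp: face_triangle_def p bary_region_def complex_eq_iff)
    show "face_triangle p f \<inter> edge_segment p e = {}" if "f \<in> {(u, v, w)}" "e \<in> {(u, v), (v, w), (w, u)}" for f e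
      using that by (auto simp: face_triangle_def edge_segment_def in_segment p bary_region_def complex_eq_iff)
  qed (use assms p in \<open>auto simp: inj_on_def noncollinear_def complex_eq_iff\<close>)
  then show ?thesis unfolding stacked_def by blast
qed

lemma stacked_face_subset:
  assumes "stacked V E F" "F' \<subseteq> F"
  shows "stacked V E F'"
proof -
  obtain p where "straight_drawing V E F p" using assms(1) unfolding stacked_def by blast
  then interpret straight_drawing V E F p .
  have "straight_drawing V E F' p"
  proof
    show "F' \<subseteq> V \<times> V \<times> V" using F(1) assms(2) by blast
    show "noncollinear (p u) (p v) (p w)" if "(u, v, w) \<in> F'" for u v w using F(2) assms(2) that by blast
    show "face_triangle p f \<inter> p ` V = {}" if "f \<in> F'" for f using FV assms(2) that by blast
    show "face_triangle p f \<inter> edge_segment p e = {}" if "f \<in> F'" "e \<in> E" for f e using FE[of f e] assms(2) that by blast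
    show "face_triangle p f \<inter> face_triangle p g = {}" if "f \<in> F'" "g \<in> F'" "f \<noteq> g" for f g
      using FF[of f g] assms(2) that by blast
  qed (use inj E EV EE in auto)
  then show ?thesis unfolding stacked_def by blast
qed

text \<open>A face is an ordered triple although its triangle is not. Rotation brings the vertex
  from which a chain grows to the last place, where \<open>stacked_chain\<close> expects it.\<close>

lemma stacked_rotate:
  assumes "stacked V E F" "(u, v, w) \<in> F" "F' \<subseteq> insert (v, w, u) (F - {(u, v, w)})"
  shows "stacked V E F'"
proof -
  obtain p where "straight_drawing V E F p" using assms(1) unfolding stacked_def by blast
  then interpret straight_drawing V E F p .
  have rot: "face_triangle p (v, w, u) = face_triangle p (u, v, w)"
    by (simp add: face_triangle_def open_triangle_rotate)
  \<comment> \<open>Sends the rotated face back to its original, so that the conditions for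
    \<open>F'\<close> can be read off from those for \<open>F\<close>.\<close>
  define r where "r = (\<lambda>f. if f = (v, w, u) then (u, v, w) else f)"
  have r: "r f \<in> F" "face_triangle p f = face_triangle p (r f)" if "f \<in> F'" for f
    using that assms(2,3) rot by (auto simp: r_def)
  have r_inj: "f = g" if "r f = r g" "f \<in> F'" "g \<in> F'" for f g
    using that assms(3) by (auto simp: r_def split: if_splits)
  have "straight_drawing V E F' p"
  proof
    show "F' \<subseteq> V \<times> V \<times> V" using assms(2,3) F(1) by auto
    show "noncollinear (p a) (p b) (p c)" if "(a, b, c) \<in> F'" for a b c
      using that assms(2,3) F(2) noncollinear_rotateI by blast
    show "face_triangle p f \<inter> face_triangle p g = {}" if "f \<in> F'" "g \<in> F'" "f \<noteq> g" for f g
      using r[OF that(1)] r[OF that(2)] r_inj that FF by metis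
  qed (use inj E EV EE r FV FE in auto)
  then show ?thesis unfolding stacked_def by blast
qed

text \<open>Each \<open>x (Suc i)\<close> is put into the triangle over \<open>u\<close> and
  \<open>v\<close> with apex \<open>x i\<close>, and the triangle with apex \<open>x (Suc i)\<close>
  is again empty. The nested apexes form a path and are all joined to \<open>u\<close> and
  \<open>v\<close>.\<close>

lemma stacked_chain:
  assumes "stacked V E F" "(u, v, x 0) \<in> F" "inj_on x {..m}" "\<And>i. 0 < i \<Longrightarrow> i \<le> m \<Longrightarrow> x i \<notin> V"
  shows "\<exists>E'. stacked (V \<union> x ` {..m}) E' (F - {(u, v, x 0)}) \<and> E \<subseteq> E' \<and>
    (\<forall>i<m. (x (Suc i), u) \<in> E' \<and> (x (Suc i), v) \<in> E' \<and> (x (Suc i), x i) \<in> E')"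
proof -
  have V0: "F \<subseteq> V \<times> V \<times> V" using assms(1) by (auto simp: stacked_def straight_drawing_def)
  have x0: "x 0 \<in> V" using assms(2) V0 by auto
  have "\<exists>E'. stacked (V \<union> x ` {..k}) E' (insert (u, v, x k) (F - {(u, v, x 0)})) \<and> E \<subseteq> E' \<and>
    (\<forall>i<k. (x (Suc i), u) \<in> E' \<and> (x (Suc i), v) \<in> E' \<and> (x (Suc i), x i) \<in> E')" if "k \<le> m" for k
    using that
  proof (induction k)
    case 0
    then show ?case using assms(1,2) x0 by (auto simp: insert_absorb)
  next
    case (Suc k)
    then obtain E' where E': "stacked (V \<union> x ` {..k}) E' (insert (u, v, x k) (F - {(u, v, x 0)}))" "E \<subseteq> E'"
      "\<And>i. i < k \<Longrightarrow> (x (Suc i), u) \<in> E' \<and> (x (Suc i), v) \<in> E' \<and> (x (Suc i), x i) \<in> E'" by auto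
    let ?y = "x (Suc k)"
    have y: "?y \<notin> V" using assms(4)[of "Suc k"] Suc.prems by simp
    have "?y \<notin> V \<union> x ` {..k}"
      using y inj_onD[OF assms(3), of "Suc k"] Suc.prems by fastforce
    from stacked_insert[OF E'(1) _ this, of u v "x k"]
    have "stacked (V \<union> x ` {..Suc k}) (E' \<union> {(?y, u), (?y, v), (?y, x k)})
      (insert (u, v, x k) (F - {(u, v, x 0)}) - {(u, v, x k)} \<union> {(?y, v, x k), (u, ?y, x k), (u, v, ?y)})"
      by (simp add: atMost_Suc)
    \<comment> \<open>The subdivided face is none of the old faces that are kept, so no old face is
      lost.\<close>
    moreover have "(u, v, x k) \<notin> F - {(u, v, x 0)}" 
      using assms(4)[of k] Suc.prems V0 by (cases k) auto
    ultimately have "stacked (V \<union> x ` {..Suc k}) (E' \<union> {(?y, u), (?y, v), (?y, x k)})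
      (insert (u, v, ?y) (F - {(u, v, x 0)}))"
      by (elim stacked_face_subset) auto
    then show ?case using E'(2,3) by (intro exI[of _ "E' \<union> {(?y, u), (?y, v), (?y, x k)}"]) (auto simp: less_Suc_eq)
  qed
  from this[of m] obtain E' where "stacked (V \<union> x ` {..m}) E' (insert (u, v, x m) (F - {(u, v, x 0)}))" "E \<subseteq> E'"
      "\<forall>i<m. (x (Suc i), u) \<in> E' \<and> (x (Suc i), v) \<in> E' \<and> (x (Suc i), x i) \<in> E'" by blast
  then show ?thesis by (blast intro: stacked_face_subset)
qed

lemma stacked_imp_polygonal_drawing:
  assumes st: "stacked V E F" and G: "pair_graph G" "pverts G \<subseteq> V" "parcs G \<subseteq> E \<union> E\<inverse>"
  shows "\<exists>p. polygonal_drawing 0 G p (\<lambda>_. [])"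
proof -
  obtain p where "straight_drawing V E F p" using st unfolding stacked_def by blast
  then interpret straight_drawing V E F p .
  interpret G: pair_graph G by fact
  have path: "polygonal_path (edge_points p (\<lambda>_. []) (u, v)) = linepath (p u) (p v)" for u v
    by (simp add: edge_points_def)
  have arcE: "u \<in> pverts G \<and> v \<in> pverts G \<and> u \<in> V \<and> v \<in> V \<and> u \<noteq> v \<and> p u \<noteq> p v \<and>
      open_segment (p u) (p v) \<inter> p ` V = {}" if "(u, v) \<in> parcs G" for u v
  proof -
    have "(u, v) \<in> E \<or> (v, u) \<in> E" using that G(3) by auto
    then have *: "u \<in> V" "v \<in> V" "u \<noteq> v" "open_segment (p u) (p v) \<inter> p ` V = {}"
      using E(1) EV[of "(u, v)"] EV[of "(v, u)"] by (auto simp: edge_segment_def open_segment_commute dest: E(2))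
    moreover have "p u \<noteq> p v" using * inj by (auto simp: inj_on_def)
    ultimately show ?thesis using G.in_arcsD1[OF that] G.in_arcsD2[OF that] by simp
  qed
  have open_eq: "closed_segment a b - {a, b} = open_segment a b" for a b :: complex
    by (simp add: open_segment_def)
  have "plane_drawing G p (\<lambda>e. polygonal_path (edge_points p (\<lambda>_. []) e))"
    unfolding plane_drawing_def
  proof (intro conjI ballI; (clarify intro!: conjI)?)
    show "inj_on p (pverts G)" using inj G(2) inj_on_subset by blast
  next
    fix u v assume uv: "(u, v) \<in> parcs G"
    note a = arcE[OF uv]
    have "closed_segment (p u) (p v) = insert (p u) (insert (p v) (open_segment (p u) (p v)))"
      by (auto simp: open_segment_def)
    then have "closed_segment (p u) (p v) \<inter> p ` pverts G = {p u, p v}" using a G(2) by auto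
    then show "arc (polygonal_path (edge_points p (\<lambda>_. []) (u, v))) \<and>
       pathstart (polygonal_path (edge_points p (\<lambda>_. []) (u, v))) = p u \<and>
       pathfinish (polygonal_path (edge_points p (\<lambda>_. []) (u, v))) = p v \<and>
       path_image (polygonal_path (edge_points p (\<lambda>_. []) (v, u))) =
       path_image (polygonal_path (edge_points p (\<lambda>_. []) (u, v))) \<and>
       path_image (polygonal_path (edge_points p (\<lambda>_. []) (u, v))) \<inter> p ` pverts G = {p u, p v}"
      using a by (simp add: path closed_segment_commute)
  next
    fix u v x y assume uv: "(u, v) \<in> parcs G" and xy: "(x, y) \<in> parcs G" and ne: "{u, v} \<noteq> {x, y}"
    have rep: "\<exists>u' v'. (u', v') \<in> E \<and> {u', v'} = {a, b} \<and> edge_segment p (u', v') = open_segment (p a) (p b)"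
      if "(a, b) \<in> parcs G" for a b
    proof -
      have "(a, b) \<in> E \<or> (b, a) \<in> E" using that G(3) by auto
      then show ?thesis unfolding edge_segment_def by (metis case_prod_conv insert_commute open_segment_commute)
    qed
    obtain u' v' where 1: "(u', v') \<in> E" "{u', v'} = {u, v}" "edge_segment p (u', v') = open_segment (p u) (p v)"
      using rep[OF uv] by blast
    obtain x' y' where 2: "(x', y') \<in> E" "{x', y'} = {x, y}" "edge_segment p (x', y') = open_segment (p x) (p y)"
      using rep[OF xy] by blast
    show "(path_image (polygonal_path (edge_points p (\<lambda>_. []) (u, v))) - {p u, p v}) \<inter>
       (path_image (polygonal_path (edge_points p (\<lambda>_. []) (x, y))) - {p x, p y}) = {}"
      using EE[OF 1(1) 2(1)] 1 2 ne by (simp add: path open_eq)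
  qed
  then show ?thesis unfolding polygonal_drawing_def by auto
qed

section \<open>Hubs in plane drawings\<close>

lemma arc_minus_finish:
  assumes "arc g"
  shows "path_image g - {pathfinish g} = g ` {0..<1}"
proof -
  have "{0..1::real} = insert 1 {0..<1}" by auto
  then have "path_image g = insert (pathfinish g) (g ` {0..<1})"
    by (simp add: path_image_def pathfinish_def)
  moreover have "pathfinish g \<notin> g ` {0..<1}"
    using assms by (auto simp: arc_def pathfinish_def dest!: inj_onD)
  ultimately show ?thesis by auto
qed

lemma path_connected_arc_minus_finish:
  assumes "arc g"
  shows "path_connected (path_image g - {pathfinish g})"
  unfolding arc_minus_finish[OF assms]
  using assms by (intro path_connected_continuous_image)
    (auto simp: arc_def path_def intro: continuous_on_subset convex_imp_path_connected)

lemma path_connected_Union_point: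
  assumes "\<And>S. S \<in> F \<Longrightarrow> path_connected S \<and> x \<in> S"
  shows "path_connected (\<Union>F)"
proof -
  have "path_component (\<Union>F) x y" if y: "y \<in> \<Union>F" for y
  proof -
    obtain S where S: "S \<in> F" "y \<in> S" using y by blast
    then have "path_component S x y" using assms[of S] by (simp add: path_connected_component)
    then show ?thesis using path_component_of_subset[of S "\<Union>F"] S by blast
  qed
  then show ?thesis unfolding path_connected_component by (meson path_component_sym path_component_trans)
qed

text \<open>An arc is a connected set with more than one point, so it has no isolated point.\<close>

lemma closure_arc_minus_finish:
  fixes g :: "real \<Rightarrow> complex"
  assumes "arc g"
  shows "pathfinish g \<in> closure (path_image g - {pathfinish g})"
proof -
  have "path_image g \<noteq> {x}" for x
    using arc_distinct_ends[OF assms] pathstart_in_path_image[of g] pathfinish_in_path_image[of g] by auto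
  then have "pathfinish g islimpt path_image g"
    using connected_imp_perfect[of "path_image g" "pathfinish g"] connected_path_image[OF arc_imp_path[OF assms]]
      pathfinish_in_path_image[of g] by blast
  then show ?thesis by (simp add: islimpt_in_closure)
qed

text \<open>General enough for the other triangle to qualify too, as a path of length three linked
  to \<open>T\<close> by the matching.\<close>

definition hub_path :: "'a pair_pre_digraph \<Rightarrow> 'a set \<Rightarrow> (nat \<Rightarrow> 'a) \<Rightarrow> nat \<Rightarrow> bool" where
  "hub_path G T h m \<longleftrightarrow> 0 < m \<and> h ` {..<m} \<inter> T = {} \<and>
     (\<forall>j. Suc j < m \<longrightarrow> (h j, h (Suc j)) \<in> parcs G) \<and> (\<forall>v\<in>T. \<exists>j<m. (h j, v) \<in> parcs G)"

locale drawn_graph =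
  fixes G :: "'a pair_pre_digraph" and p :: "'a \<Rightarrow> complex" and c :: "'a \<times> 'a \<Rightarrow> real \<Rightarrow> complex"
  assumes graph: "pair_graph G" and drawing: "plane_drawing G p c"
begin

lemma wf: "pair_wf_digraph G"
  using graph by (simp add: pair_graph_def pair_sym_digraph_def pair_digraph_def pair_fin_digraph_def)

lemma arc_sym: "(u, v) \<in> parcs G \<Longrightarrow> (v, u) \<in> parcs G"
  using pair_sym_digraph.arcs_symmetric[OF pair_pseudo_graph.axioms(2)[OF pair_graph.axioms(2)[OF graph]]] by blast

lemma arc_verts: "(u, v) \<in> parcs G \<Longrightarrow> u \<in> pverts G \<and> v \<in> pverts G"
  using pair_wf_digraph.in_arcsD1[OF wf] pair_wf_digraph.in_arcsD2[OF wf] by blast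

lemma p_inj: "u \<in> pverts G \<Longrightarrow> v \<in> pverts G \<Longrightarrow> p u = p v \<longleftrightarrow> u = v"
  using drawing by (auto simp: plane_drawing_def inj_on_def)

abbreviation img :: "'a \<Rightarrow> 'a \<Rightarrow> complex set" where "img u v \<equiv> path_image (c (u, v))"

lemma arcD:
  assumes "(u, v) \<in> parcs G"
  shows "arc (c (u, v))" "pathstart (c (u, v)) = p u" "pathfinish (c (u, v)) = p v"
    "img v u = img u v" "img u v \<inter> p ` pverts G = {p u, p v}" "p u \<in> img u v" "p v \<in> img u v"
  using drawing assms unfolding plane_drawing_def by blast+

lemma img_vertex: "(u, v) \<in> parcs G \<Longrightarrow> w \<in> pverts G \<Longrightarrow> p w \<in> img u v \<longleftrightarrow> w = u \<or> w = v"
  using arcD(5)[of u v] arc_verts[of u v] p_inj by blast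

lemma img_Int:
  assumes "(u, v) \<in> parcs G" "(x, y) \<in> parcs G" "{u, v} \<noteq> {x, y}"
  shows "img u v \<inter> img x y = p ` ({u, v} \<inter> {x, y})"
proof
  have *: "(img u v - {p u, p v}) \<inter> (img x y - {p x, p y}) = {}"
    using drawing assms unfolding plane_drawing_def by blast
  show "img u v \<inter> img x y \<subseteq> p ` ({u, v} \<inter> {x, y})"
  proof
    fix z assume z: "z \<in> img u v \<inter> img x y"
    then have "z \<in> {p u, p v} \<or> z \<in> {p x, p y}" using * by blast
    then obtain w where w: "z = p w" "w \<in> pverts G" using arc_verts assms by blast
    then have "w \<in> {u, v}" "w \<in> {x, y}" using z img_vertex assms by auto
    then show "z \<in> p ` ({u, v} \<inter> {x, y})" using w by blast
  qed
  show "p ` ({u, v} \<inter> {x, y}) \<subseteq> img u v \<inter> img x y" using arcD(6,7) assms by blast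
qed

text \<open>
  The drawing of \<open>A\<close> with its edges to \<open>T\<close>, where the points of \<open>T\<close> outside \<open>X\<close> are removed.
\<close>

definition hub :: "'a set \<Rightarrow> 'a set \<Rightarrow> 'a set \<Rightarrow> complex set" where
  "hub A T X = (\<Union>u\<in>A. insert (p u) (\<Union>v\<in>{v \<in> A \<union> T. (u, v) \<in> parcs G}. img u v - p ` (T - X)))"

lemma hub_piece_path_connected:
  assumes uv: "(u, v) \<in> parcs G" and "u \<notin> T" "T \<subseteq> pverts G"
  shows "path_connected (img u v - p ` (T - X)) \<and> p u \<in> img u v - p ` (T - X)"
proof (cases "v \<in> T - X")
  case True
  have "img u v - p ` (T - X) = img u v - {p v}"
  proof -
    have "img u v \<inter> p ` (T - X) \<subseteq> {p v}"
      using img_vertex[OF uv] assms by auto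
    then show ?thesis using True by auto
  qed
  then show ?thesis
    using path_connected_arc_minus_finish[OF arcD(1)[OF uv]] arcD[OF uv] True assms arc_verts[OF uv] p_inj by auto
next
  case False
  have "img u v - p ` (T - X) = img u v"
    using img_vertex[OF uv] assms False by auto
  then show ?thesis using arcD[OF uv] by (simp add: arc_imp_path path_connected_path_image)
qed

text \<open>The star \<open>K j\<close> of a path vertex is path-connected, since all its edges
  contain that vertex, even if their ends in \<open>T\<close> are missing. Consecutive stars share
  the later one of the two vertices, which gives an induction along the path.\<close>

lemma path_connected_hub:
  assumes h: "hub_path G T h m" and T: "T \<subseteq> pverts G"
  shows "path_connected (hub (h ` {..<m}) T X)"
proof -
  let ?A = "h ` {..<m}"
  define K where "K = (\<lambda>j. insert (p (h j)) (\<Union>v\<in>{v \<in> ?A \<union> T. (h j, v) \<in> parcs G}. img (h j) v - p ` (T - X)))"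
  have K: "path_connected (K j)" if "j < m" for j
  proof -
    have "h j \<notin> T" using h that by (auto simp: hub_path_def)
    then have pieces: "\<And>S. S \<in> insert {p (h j)} ((\<lambda>v. img (h j) v - p ` (T - X)) ` {v \<in> ?A \<union> T. (h j, v) \<in> parcs G}) \<Longrightarrow>
        path_connected S \<and> p (h j) \<in> S"
      using hub_piece_path_connected[OF _ _ T] by auto
    then have "path_connected (\<Union>(insert {p (h j)} ((\<lambda>v. img (h j) v - p ` (T - X)) ` {v \<in> ?A \<union> T. (h j, v) \<in> parcs G})))"
      by (intro path_connected_Union_point[of _ "p (h j)"]) blast
    then show ?thesis unfolding K_def by simp
  qed
  have "path_connected (\<Union>j<k. K j)" if "k \<le> m" for k
    using that
  proof (induction k)
    case (Suc k)
    show ?case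
    proof (cases k)
      case 0
      then show ?thesis using K[of 0] Suc.prems by (simp add: lessThan_Suc)
    next
      case (Suc l)
      have arc: "(h l, h k) \<in> parcs G" using h Suc Suc.prems \<open>Suc k \<le> m\<close> by (auto simp: hub_path_def)
      have "h k \<in> ?A" using \<open>Suc k \<le> m\<close> by auto
      then have "h k \<notin> T" using h unfolding hub_path_def by blast
      then have "p (h k) \<notin> p ` (T - X)" using arc_verts[OF arc] T p_inj by auto
      then have "p (h k) \<in> K l" using arc arcD(7)[OF arc] \<open>h k \<in> ?A\<close> by (auto simp: K_def)
      moreover have "p (h k) \<in> K k" by (simp add: K_def)
      ultimately have "(\<Union>j<k. K j) \<inter> K k \<noteq> {}" using Suc by blast
      then have "path_connected ((\<Union>j<k. K j) \<union> K k)"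
        using Suc.IH K[of k] \<open>Suc k \<le> m\<close> by (intro path_connected_Un) auto
      then show ?thesis by (simp add: lessThan_Suc Un_commute)
    qed
  qed simp
  from this[of m] have "path_connected (\<Union>j<m. K j)" by simp
  moreover have "(\<Union>j<m. K j) = hub ?A T X" by (simp add: hub_def K_def)
  ultimately show ?thesis by simp
qed

lemma hub_subset_points:
  assumes "z \<in> hub A T X" "A \<subseteq> pverts G"
  shows "(\<exists>u\<in>A. z = p u) \<or> (\<exists>u\<in>A. \<exists>v\<in>A \<union> T. (u, v) \<in> parcs G \<and> z \<in> img u v \<and> z \<notin> p ` (T - X))"
  using assms unfolding hub_def by blast

lemma hub_disjoint_img:
  assumes "A \<subseteq> pverts G" "T \<subseteq> pverts G" "A \<inter> T = {}" "(x, y) \<in> parcs G" "x \<notin> A" "y \<notin> A"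
    and "x \<in> T" "y \<in> T"
  shows "hub A T {} \<inter> img x y = {}"
proof -
  have *: "\<exists>w\<in>{x,y} - A - T. z = p w" if "z \<in> hub A T {}" "z \<in> img x y" for z
  proof -
    consider u where "u \<in> A" "z = p u" | u v where "u \<in> A" "v \<in> A \<union> T" "(u, v) \<in> parcs G" "z \<in> img u v" "z \<notin> p ` T"
      using hub_subset_points[OF \<open>z \<in> hub A T {}\<close> assms(1)] by auto
    then show ?thesis
    proof cases
      case 1
      then show ?thesis using img_vertex[OF assms(4), of u] that assms by auto
    next
      case 2
      have "u \<noteq> x" "u \<noteq> y" using 2(1) assms(5,6) by auto
      then have "{u, v} \<noteq> {x, y}" by (simp add: doubleton_eq_iff)
      then have "z \<in> p ` ({u, v} \<inter> {x, y})"
        using img_Int[OF 2(3) assms(4)] that 2(4) by blast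
      then show ?thesis using 2 assms by auto
    qed
  qed
  then show ?thesis using assms(7,8) by blast
qed

text \<open>Edges of different hubs are different, so they meet at most in common end vertices. Such
  a vertex belongs to \<open>T\<close>, and the points of \<open>T\<close> have been
  removed.\<close>

lemma hubs_disjoint:
  assumes "A \<subseteq> pverts G" "B \<subseteq> pverts G" "T \<subseteq> pverts G" "A \<inter> T = {}" "B \<inter> T = {}" "A \<inter> B = {}"
  shows "hub A T {} \<inter> hub B T {} = {}"
proof (rule ccontr)
  assume "\<not> ?thesis"
  then obtain z where z: "z \<in> hub A T {}" "z \<in> hub B T {}" by blast
  consider u where "u \<in> B" "z = p u" | u v where "u \<in> B" "v \<in> B \<union> T" "(u, v) \<in> parcs G" "z \<in> img u v" "z \<notin> p ` T"
    using hub_subset_points[OF z(2) assms(2)] by auto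
  then show False
  proof cases
    case 1
    have u: "u \<in> pverts G" "u \<notin> A" "u \<notin> T" using 1 assms by auto
    consider x where "x \<in> A" "z = p x" | x y where "x \<in> A" "y \<in> A \<union> T" "(x, y) \<in> parcs G" "z \<in> img x y"
      using hub_subset_points[OF z(1) assms(1)] by blast
    then show False
    proof cases
      fix x assume x: "x \<in> A" "z = p x"
      then have "x \<in> pverts G" using assms(1) by blast
      then have "x = u" using x 1 u p_inj[of x u] by simp
      then show False using x u by simp
    next
      fix x y assume xy: "x \<in> A" "y \<in> A \<union> T" "(x, y) \<in> parcs G" "z \<in> img x y"
      then have "u = x \<or> u = y" using img_vertex[OF xy(3) u(1)] 1(2) by simp
      then show False using xy u by auto
    qed
  next
    case 2
    have z_hubA: "(\<exists>x\<in>A. z = p x) \<or> (\<exists>x\<in>A. \<exists>y\<in>A \<union> T. (x, y) \<in> parcs G \<and> z \<in> img x y \<and> z \<notin> p ` T)"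
      using hub_subset_points[OF z(1) assms(1)] by simp
    then show False
    proof (elim disjE bexE conjE)
      fix x assume "x \<in> A" "z = p x"
      then have "x = u \<or> x = v" using 2 img_vertex[OF 2(3), of x] assms by blast
      then show False using 2 \<open>x \<in> A\<close> assms by blast
    next
      fix x y assume xy: "x \<in> A" "y \<in> A \<union> T" "(x, y) \<in> parcs G" "z \<in> img x y"
      have "u \<noteq> x" "u \<noteq> y" using 2(1) xy(1,2) assms(5,6) by auto
      then have "{u, v} \<noteq> {x, y}" by (simp add: doubleton_eq_iff)
      then have "z \<in> p ` ({u, v} \<inter> {x, y})"
        using img_Int[OF 2(3) xy(3)] 2(4) xy(4) by blast
      then show False using 2 xy assms by auto
    qed
  qed
qed

text \<open>Only \<open>a\<close> and \<open>b\<close> are put back into the hub, so the arc between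
  them cannot run through another point of \<open>T\<close>.\<close>

lemma hub_arc:
  assumes h: "hub_path G T h m" and T: "T \<subseteq> pverts G" "a \<in> T" "b \<in> T" "a \<noteq> b"
  obtains g where "simple_path g" "pathstart g = p a" "pathfinish g = p b"
    "path_image g - {p a, p b} \<subseteq> hub (h ` {..<m}) T {}"
proof -
  let ?A = "h ` {..<m}"
  have mem: "p x \<in> hub ?A T {a, b}" if "x \<in> {a, b}" for x
  proof -
    have "x \<in> T" using T that by auto
    then obtain j where j: "j < m" "(h j, x) \<in> parcs G" using h by (auto simp: hub_path_def)
    moreover have "p x \<notin> p ` (T - {a, b})" using that T p_inj by auto
    ultimately show ?thesis using arcD(7)[OF j(2)] T that unfolding hub_def by blast
  qed
  have "p a \<noteq> p b" using T p_inj by auto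
  then obtain g where g: "arc g" "path_image g \<subseteq> hub ?A T {a, b}" "pathstart g = p a" "pathfinish g = p b"
    using path_connected_hub[OF h T(1), of "{a, b}"] mem unfolding path_connected_arcwise by (metis insertCI)
  moreover have "hub ?A T {a, b} - {p a, p b} \<subseteq> hub ?A T {}" unfolding hub_def by auto
  ultimately show thesis using that[of g] arc_imp_simple_path by blast
qed

lemma hub_closure:
  assumes h: "hub_path G T h m" and T: "T \<subseteq> pverts G" "v \<in> T"
  shows "p v \<in> closure (hub (h ` {..<m}) T {})"
proof -
  obtain j where j: "j < m" "(h j, v) \<in> parcs G" using h T by (auto simp: hub_path_def)
  have "h j \<notin> T" using h j by (auto simp: hub_path_def)
  have "img (h j) v \<inter> p ` T \<subseteq> {p v}" using img_vertex[OF j(2)] T \<open>h j \<notin> T\<close> by auto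
  then have "img (h j) v - {p v} \<subseteq> img (h j) v - p ` (T - {})" by blast
  also have "\<dots> \<subseteq> hub (h ` {..<m}) T {}" using j T unfolding hub_def by fast
  finally have "img (h j) v - {p v} \<subseteq> hub (h ` {..<m}) T {}" .
  then show ?thesis
    using closure_arc_minus_finish[OF arcD(1)[OF j(2)]] arcD(3)[OF j(2)] closure_mono by auto
qed

section \<open>Drawn triangles and the position of their hubs\<close>

definition tri_curve :: "(nat \<Rightarrow> 'a) \<Rightarrow> complex set" where
  "tri_curve t = img (t 0) (t 1) \<union> img (t 1) (t 2) \<union> img (t 2) (t 0)"

definition tri :: "(nat \<Rightarrow> 'a) \<Rightarrow> bool" where
  "tri t \<longleftrightarrow> t 0 \<noteq> t 1 \<and> t 1 \<noteq> t 2 \<and> t 0 \<noteq> t 2 \<and> (t 0, t 1) \<in> parcs G \<and> (t 1, t 2) \<in> parcs G \<and> (t 2, t 0) \<in> parcs G"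

text \<open>Presents the triangle as two arcs from \<open>t 0\<close> to \<open>t 1\<close> with the
  third corner on \<open>f\<close>, the form required by
  \<open>hubs_not_both_outside\<close>.\<close>

lemma tri_halves:
  assumes "tri t"
  defines "e \<equiv> c (t 0, t 1)" and "f \<equiv> c (t 0, t 2) +++ c (t 2, t 1)"
  shows "simple_path e" "pathstart e = p (t 0)" "pathfinish e = p (t 1)"
    "simple_path f" "pathstart f = p (t 0)" "pathfinish f = p (t 1)"
    "path_image e \<inter> path_image f = {p (t 0), p (t 1)}" "path_image e \<union> path_image f = tri_curve t"
    "p (t 2) \<in> path_image f" "p (t 2) \<notin> {p (t 0), p (t 1)}" "p (t 0) \<noteq> p (t 1)"
proof -
  have a: "(t 0, t 1) \<in> parcs G" "(t 0, t 2) \<in> parcs G" "(t 2, t 1) \<in> parcs G" and ne: "t 0 \<noteq> t 1" "t 1 \<noteq> t 2" "t 0 \<noteq> t 2"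
    using assms(1) arc_sym unfolding tri_def by blast+
  have V: "t 0 \<in> pverts G" "t 1 \<in> pverts G" "t 2 \<in> pverts G" using arc_verts a by blast+
  show "simple_path e" "pathstart e = p (t 0)" "pathfinish e = p (t 1)"
    using arcD[OF a(1)] arc_imp_simple_path by (auto simp: e_def)
  have fi: "path_image f = img (t 0) (t 2) \<union> img (t 2) (t 1)"
    unfolding f_def using arcD[OF a(2)] arcD[OF a(3)] by (simp add: path_image_join)
  have "img (t 0) (t 2) \<inter> img (t 2) (t 1) = {p (t 2)}"
    using img_Int[OF a(2,3)] ne by (auto simp: doubleton_eq_iff)
  then have "arc f" unfolding f_def using arcD[OF a(2)] arcD[OF a(3)] by (intro arc_join) auto
  then show "simple_path f" by (rule arc_imp_simple_path)
  show "pathstart f = p (t 0)" "pathfinish f = p (t 1)"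
    unfolding f_def using arcD[OF a(2)] arcD[OF a(3)] by simp_all
  show "path_image e \<inter> path_image f = {p (t 0), p (t 1)}"
    unfolding fi e_def Int_Un_distrib using img_Int[OF a(1,2)] img_Int[OF a(1,3)] ne
    by (auto simp: doubleton_eq_iff)
  show "path_image e \<union> path_image f = tri_curve t"
    unfolding fi e_def tri_curve_def using arcD(4)[OF a(2)] arcD(4)[OF a(3)] by auto
  show "p (t 2) \<in> path_image f" unfolding fi using arcD[OF a(2)] by blast
  show "p (t 2) \<notin> {p (t 0), p (t 1)}" "p (t 0) \<noteq> p (t 1)" using p_inj V ne by auto
qed

lemma tri_curve_simple_path:
  assumes "tri t"
  obtains j where "simple_path j" "pathfinish j = pathstart j" "path_image j = tri_curve t"
proof -
  note H = tri_halves[OF assms]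
  let ?j = "c (t 0, t 1) +++ reversepath (c (t 0, t 2) +++ c (t 2, t 1))"
  have a: "arc (c (t 0, t 1))" "arc (c (t 0, t 2) +++ c (t 2, t 1))"
    using H by (simp_all add: arc_simple_path)
  have "simple_path ?j"
    using H a by (subst simple_path_join_loop_eq) (auto simp: arc_reversepath)
  moreover have "path_image ?j = tri_curve t" using H by (simp add: path_image_join)
  moreover have "pathfinish ?j = pathstart ?j" using H by simp
  ultimately show thesis using that by blast
qed

lemma closed_tri_curve: "tri t \<Longrightarrow> closed (tri_curve t)"
  by (metis closed_simple_path_image tri_curve_simple_path)

lemma tri_verts: "tri t \<Longrightarrow> t ` {..<3} \<subseteq> pverts G"
  using arc_verts unfolding tri_def by (auto simp: numeral_3_eq_3 lessThan_Suc numeral_2_eq_2)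

lemma image_lessThan_3: "t ` {..<3::nat} = {t 0, t 1, t 2}"
  by (auto simp: numeral_3_eq_3 lessThan_Suc numeral_2_eq_2)

lemma image_lessThan_3_nonempty: "t ` {..<3::nat} \<noteq> {}"
  by (simp add: image_lessThan_3)

lemma hub_path_verts:
  assumes "hub_path G T h m" and T: "T \<noteq> {}"
  shows "h ` {..<m} \<subseteq> pverts G"
proof
  fix x assume "x \<in> h ` {..<m}"
  then obtain j where j: "j < m" "x = h j" by auto
  show "x \<in> pverts G"
  proof (cases "Suc j < m")
    case True
    then show ?thesis using assms j arc_verts unfolding hub_path_def by blast
  next
    case False
    then have "j = m - 1" using j by simp
    show ?thesis
    proof (cases j)
      case 0
      \<comment> \<open>A path with a single vertex has no path edge; that its vertex belongs to the
        graph follows from its edge to \<open>T\<close>.\<close>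
      obtain v i where *: "i < m" "(h i, v) \<in> parcs G" using assms unfolding hub_path_def by blast
      moreover have "i = j" using 0 \<open>j = m - 1\<close> *(1) by simp
      ultimately show ?thesis using arc_verts j by blast
    next
      case (Suc k)
      then show ?thesis using assms j arc_verts unfolding hub_path_def by blast
    qed
  qed
qed

lemma hub_disjoint_tri_curve:
  assumes "tri t" "hub_path G (t ` {..<3}) h m"
  shows "hub (h ` {..<m}) (t ` {..<3}) {} \<inter> tri_curve t = {}"
proof -
  let ?T = "t ` {..<3}" and ?A = "h ` {..<m}"
  have *: "?A \<subseteq> pverts G" "?T \<subseteq> pverts G" "?A \<inter> ?T = {}"
    using hub_path_verts[OF assms(2) image_lessThan_3_nonempty] tri_verts[OF assms(1)] assms(2) by (simp_all add: hub_path_def)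
  have "hub ?A ?T {} \<inter> img x y = {}" if "(x, y) \<in> parcs G" "x \<in> ?T" "y \<in> ?T" for x y
    using that *(3) by (intro hub_disjoint_img[OF *]) auto
  then show ?thesis using assms(1) unfolding tri_curve_def tri_def image_lessThan_3 by auto
qed

lemma hub_inside_or_outside:
  assumes "tri t" "hub_path G (t ` {..<3}) h m"
  shows "hub (h ` {..<m}) (t ` {..<3}) {} \<subseteq> inside (tri_curve t) \<or>
    hub (h ` {..<m}) (t ` {..<3}) {} \<subseteq> outside (tri_curve t)"
  by (rule connected_subset_inside_or_outside[OF path_connected_imp_connected
        [OF path_connected_hub[OF assms(2) tri_verts[OF assms(1)]]]
        closed_tri_curve[OF assms(1)] hub_disjoint_tri_curve[OF assms]])

text \<open>Each hub supplies an arc from \<open>t 0\<close> to \<open>t 1\<close> and has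
  \<open>t 2\<close> in its closure, so \<open>hubs_not_both_outside\<close> applies.\<close>

lemma hub_inside:
  assumes t: "tri t" and h: "hub_path G (t ` {..<3}) h m" "hub_path G (t ` {..<3}) h' m'"
    and disj: "h ` {..<m} \<inter> h' ` {..<m'} = {}"
  shows "hub (h ` {..<m}) (t ` {..<3}) {} \<subseteq> inside (tri_curve t) \<or>
    hub (h' ` {..<m'}) (t ` {..<3}) {} \<subseteq> inside (tri_curve t)"
proof (rule ccontr)
  let ?T = "t ` {..<3}"
  let ?A = "hub (h ` {..<m}) ?T {}" and ?B = "hub (h' ` {..<m'}) ?T {}"
  assume "\<not> ?thesis"
  then have out: "?A \<subseteq> outside (tri_curve t)" "?B \<subseteq> outside (tri_curve t)"
    using hub_inside_or_outside[OF t h(1)] hub_inside_or_outside[OF t h(2)] by blast+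
  note H = tri_halves[OF t] and TV = tri_verts[OF t]
  have T: "t 0 \<in> ?T" "t 1 \<in> ?T" "t 2 \<in> ?T" "t 0 \<noteq> t 1" using t unfolding image_lessThan_3 tri_def by auto
  obtain g where g: "simple_path g" "pathstart g = p (t 0)" "pathfinish g = p (t 1)" "path_image g - {p (t 0), p (t 1)} \<subseteq> ?A"
    using hub_arc[OF h(1) TV T(1,2,4)] .
  obtain g' where g': "simple_path g'" "pathstart g' = p (t 0)" "pathfinish g' = p (t 1)" "path_image g' - {p (t 0), p (t 1)} \<subseteq> ?B"
    using hub_arc[OF h(2) TV T(1,2,4)] .
  have AB: "?A \<inter> ?B = {}"
    using hub_path_verts[OF h(1) image_lessThan_3_nonempty] hub_path_verts[OF h(2) image_lessThan_3_nonempty] TV h disj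
    by (intro hubs_disjoint) (simp_all add: hub_path_def)
  have conn: "connected ?A" "connected ?B"
    by (intro path_connected_imp_connected path_connected_hub[OF h(1) TV] path_connected_hub[OF h(2) TV])+
  show False
    using hubs_not_both_outside[OF H(1-6) g(1-3) g'(1-3) H(11,7) g(4) g'(4) AB conn H(9,10)
        hub_closure[OF h(1) TV T(3)] hub_closure[OF h(2) TV T(3)]] out unfolding H(8) by blast
qed

text \<open>Through the links each triangle is a hub of the other one. If both own hubs were
  outside, \<open>hub_inside\<close> would put each triangle inside the other, against
  \<open>nested_closed_curve_outside\<close>.\<close>

lemma nested_hub_inside:
  assumes t: "tri t" and t': "tri t'" and links: "\<And>i. i < 3 \<Longrightarrow> (t i, t' i) \<in> parcs G"
    and tt': "t ` {..<3} \<inter> t' ` {..<3} = {}"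
    and h: "hub_path G (t ` {..<3}) h m" and h': "hub_path G (t' ` {..<3}) h' m'"
    and disj: "h ` {..<m} \<inter> t' ` {..<3} = {}" "h' ` {..<m'} \<inter> t ` {..<3} = {}"
  shows "hub (h ` {..<m}) (t ` {..<3}) {} \<subseteq> inside (tri_curve t) \<or>
    hub (h' ` {..<m'}) (t' ` {..<3}) {} \<subseteq> inside (tri_curve t')"
proof (rule ccontr)
  assume neg: "\<not> ?thesis"
  have tri_hub: "hub_path G (s ` {..<3}) s' 3" if s': "tri s'" and l: "\<And>i. i < 3 \<Longrightarrow> (s' i, s i) \<in> parcs G"
      and d: "s' ` {..<3} \<inter> s ` {..<3} = {}" for s s'
  proof -
    have "(s' j, s' (Suc j)) \<in> parcs G" if "Suc j < 3" for j
      using s' that unfolding tri_def by (auto simp: numeral_3_eq_3 numeral_2_eq_2 less_Suc_eq)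
    moreover have "\<forall>v\<in>s ` {..<3}. \<exists>j<3. (s' j, v) \<in> parcs G" using l by blast
    ultimately show ?thesis using d unfolding hub_path_def by simp
  qed
  \<comment> \<open>The sides of one triangle avoid the corners of the other, so removing the latter
    from the hub leaves these sides intact.\<close>
  have sub: "tri_curve s' \<subseteq> hub (s' ` {..<3}) (s ` {..<3}) {}" if "tri s'" "tri s" "s' ` {..<3} \<inter> s ` {..<3} = {}" for s s'
  proof -
    have "img x y \<subseteq> hub (s' ` {..<3}) (s ` {..<3}) {}" if xy: "(x, y) \<in> parcs G" "x \<in> s' ` {..<3}" "y \<in> s' ` {..<3}" for x y
    proof -
      have "w \<noteq> x \<and> w \<noteq> y" if "w \<in> s ` {..<3}" for w
        using xy(2,3) that \<open>s' ` {..<3} \<inter> s ` {..<3} = {}\<close> by blast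
      then have "img x y \<inter> p ` (s ` {..<3}) = {}"
        using img_vertex[OF xy(1)] tri_verts[OF \<open>tri s\<close>] by blast
      then have "img x y \<subseteq> img x y - p ` (s ` {..<3} - {})" by blast
      also have "\<dots> \<subseteq> hub (s' ` {..<3}) (s ` {..<3}) {}" using xy unfolding hub_def by fast
      finally show ?thesis .
    qed
    then show ?thesis using \<open>tri s'\<close> unfolding tri_curve_def tri_def image_lessThan_3 by auto
  qed
  have "hub_path G (t ` {..<3}) t' 3" using tri_hub[OF t'] links arc_sym tt' by blast
  then have "hub (t' ` {..<3}) (t ` {..<3}) {} \<subseteq> inside (tri_curve t)"
    using hub_inside[OF t h _ disj(1)] neg by blast
  then have in1: "tri_curve t' \<subseteq> inside (tri_curve t)" using sub[OF t' t] tt' by blast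
  have "hub_path G (t' ` {..<3}) t 3" using tri_hub[OF t] links tt' by blast
  then have "hub (t ` {..<3}) (t' ` {..<3}) {} \<subseteq> inside (tri_curve t')"
    using hub_inside[OF t' h' _ disj(2)] neg by blast
  then have in2: "tri_curve t \<subseteq> inside (tri_curve t')" using sub[OF t t'] tt' by blast
  obtain j where j: "simple_path j" "pathfinish j = pathstart j" "path_image j = tri_curve t"
    using tri_curve_simple_path[OF t] .
  have "tri_curve t \<subseteq> outside (tri_curve t')" using nested_closed_curve_outside[OF j(1,2)] in1 j(3) by simp
  moreover have "tri_curve t \<noteq> {}" using j(3) path_image_nonempty by metis
  ultimately show False using in2 inside_Int_outside[of "tri_curve t'"] by blast
qed

end

section \<open>Drawings with at most one bend per edge\<close>

lemma inside_subset_convex_hull: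
  fixes S :: "complex set"
  shows "inside S \<subseteq> convex hull S"
  using outside_subset_convex[OF convex_convex_hull hull_subset[of S convex]] inside_Int_outside[of S] by blast

lemma connected_segment_delete:
  fixes u v :: complex
  assumes "u \<noteq> v"
  shows "connected (closed_segment u v - {v})"
  using path_connected_arc_minus_finish[of "linepath u v"] assms path_connected_imp_connected by simp

lemma open_not_subset_hull_collinear:
  assumes "cross2 (y - x) (z - x) = 0" "open S" "S \<noteq> {}"
  shows "\<not> S \<subseteq> convex hull {x, y, z}"
proof
  assume sub: "S \<subseteq> convex hull {x, y, z}"
  obtain s where s: "s \<noteq> 0" "cross2 s (y - x) = 0" "cross2 s (z - x) = 0"
  proof (cases "y = x")
    case True
    show thesis
    proof (cases "z = x")
      case zx: True
      show thesis using that[of 1] True zx by simp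
    next
      case False
      show thesis using that[of "z - x"] True False by simp
    qed
  next
    case False
    show thesis using that[of "y - x"] assms(1) False by (simp del: cross2_simps(3,4))
  qed
  have line: "cross2 s (q - x) = 0" if "q \<in> S" for q
  proof -
    have "q \<in> convex hull {x, y, z}" using that sub by blast
    then obtain u v where q: "q = x + u *\<^sub>R (y - x) + v *\<^sub>R (z - x)"
      unfolding convex_hull_3_alt by blast
    have "q - x = u *\<^sub>R (y - x) + v *\<^sub>R (z - x)" unfolding q by simp
    then have "cross2 s (q - x) = u * cross2 s (y - x) + v * cross2 s (z - x)"
      by (simp only: cross2_simps)
    then show ?thesis using s by simp
  qed
  obtain q r where q: "q \<in> S" "r > 0" "ball q r \<subseteq> S" using assms(2,3) open_contains_ball by blast
  \<comment> \<open>A step of length \<open>r / 2\<close> perpendicular to \<open>s\<close>, since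
    multiplication by \<open>\<i>\<close> is a quarter turn. It stays in \<open>S\<close> but leaves
    the line.\<close>
  define w where "w = q + (r / (2 * norm s)) *\<^sub>R (\<i> * s)"
  have "dist q w = r / 2" using q(2) s(1) by (simp add: w_def dist_norm norm_mult)
  then have "w \<in> S" using q by auto
  then have "cross2 s (w - x) = 0" by (rule line)
  moreover have "cross2 s (q - x) = 0" using line q by blast
  ultimately have "cross2 s ((r / (2 * norm s)) *\<^sub>R (\<i> * s)) = 0" unfolding w_def by simp
  then have "cross2 s (\<i> * s) = 0" using q(2) s(1) by simp
  then have "(Re s)\<^sup>2 + (Im s)\<^sup>2 = 0" by (simp add: cross2_def power2_eq_square)
  then show False using s(1) by (simp add: complex_eq_iff sum_power2_eq_zero_iff)
qed

text \<open>Each bracketed pair of segments is one bent edge: its halves meet in the bend only, and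
  different edges meet in their common corner only. \<open>K\<close> stands for the hub without the
  corners, and it is empty if there are no hub vertices.\<close>

locale hexagon_curve =
  fixes K :: "complex set" and a x b y c z :: complex
  assumes bends: "closed_segment a x \<inter> closed_segment x b = {x}" "closed_segment b y \<inter> closed_segment y c = {y}"
      "closed_segment c z \<inter> closed_segment z a = {z}"
    and corners: "(closed_segment a x \<union> closed_segment x b) \<inter> (closed_segment b y \<union> closed_segment y c) = {b}"
      "(closed_segment b y \<union> closed_segment y c) \<inter> (closed_segment c z \<union> closed_segment z a) = {c}"
      "(closed_segment c z \<union> closed_segment z a) \<inter> (closed_segment a x \<union> closed_segment x b) = {a}"
    and distinct: "a \<noteq> x" "x \<noteq> b" "b \<noteq> y" "y \<noteq> c" "c \<noteq> z" "z \<noteq> a"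
    and K: "connected K" "K \<noteq> {} \<Longrightarrow> {a, b, c} \<subseteq> closure K"
    and KJ: "K \<inter> (closed_segment a x \<union> closed_segment x b \<union> (closed_segment b y \<union> closed_segment y c) \<union>
      (closed_segment c z \<union> closed_segment z a)) = {}"
begin

definition \<Gamma> :: "complex set" where
  "\<Gamma> = closed_segment a x \<union> closed_segment x b \<union> (closed_segment b y \<union> closed_segment y c) \<union>
      (closed_segment c z \<union> closed_segment z a) \<union> K"

lemma rotate: "hexagon_curve K b y c z a x"
proof
  show "K \<noteq> {} \<Longrightarrow> {b, c, a} \<subseteq> closure K" using K by auto
  show "K \<inter> (closed_segment b y \<union> closed_segment y c \<union> (closed_segment c z \<union> closed_segment z a) \<union>
      (closed_segment a x \<union> closed_segment x b)) = {}" using KJ by blast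
qed (use bends corners distinct K(1) in auto)

lemma \<Gamma>_rotate: "hexagon_curve.\<Gamma> K b y c z a x = \<Gamma>"
  unfolding hexagon_curve.\<Gamma>_def[OF rotate] \<Gamma>_def by blast

lemma ends: "p \<in> closed_segment p q" "q \<in> closed_segment p q" for p q :: complex
  by simp_all

lemma Int_singD: "A \<inter> B = {q} \<Longrightarrow> r \<in> A \<Longrightarrow> r \<in> B \<Longrightarrow> r = q" for q :: complex
  by auto

lemma off: "a \<notin> closed_segment x b" "b \<notin> closed_segment a x" "a \<notin> closed_segment c z" "c \<notin> closed_segment z a"
  "b \<notin> closed_segment y c" "c \<notin> closed_segment b y"
  using Int_singD[OF bends(1), of a] Int_singD[OF bends(1), of b] Int_singD[OF bends(2), of b]
    Int_singD[OF bends(2), of c] Int_singD[OF bends(3), of a] Int_singD[OF bends(3), of c] distinct ends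
  by metis+

lemma segs_disjoint: "closed_segment a x \<inter> closed_segment b y = {}" "closed_segment z a \<inter> closed_segment x b = {}"
  "closed_segment z a \<inter> closed_segment b y = {}" "closed_segment z a \<inter> closed_segment a x = {a}"
  "closed_segment x b \<inter> closed_segment b y = {b}" "closed_segment c z \<inter> closed_segment x b = {}"
  "closed_segment c z \<inter> closed_segment b y = {}" "closed_segment y c \<inter> closed_segment x b = {}"
  "closed_segment y c \<inter> closed_segment b y = {y}" "closed_segment x b \<inter> closed_segment a x = {x}"
proof -
  note c = Int_singD[OF corners(1)] Int_singD[OF corners(2)] Int_singD[OF corners(3)]
  have 1: "r = b" if "r \<in> closed_segment a x \<or> r \<in> closed_segment x b" "r \<in> closed_segment b y \<or> r \<in> closed_segment y c" for r
    using c(1)[of r] that by simp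
  have 2: "r = c" if "r \<in> closed_segment b y \<or> r \<in> closed_segment y c" "r \<in> closed_segment c z \<or> r \<in> closed_segment z a" for r
    using c(2)[of r] that by simp
  have 3: "r = a" if "r \<in> closed_segment c z \<or> r \<in> closed_segment z a" "r \<in> closed_segment a x \<or> r \<in> closed_segment x b" for r
    using c(3)[of r] that by simp
  show "closed_segment a x \<inter> closed_segment b y = {}" using off(2) 1 by (metis disjoint_iff)
  show "closed_segment z a \<inter> closed_segment x b = {}" using off(1) 3 by (metis disjoint_iff)
  show "closed_segment z a \<inter> closed_segment b y = {}" using off(4) 2 by (metis disjoint_iff)
  show "closed_segment z a \<inter> closed_segment a x = {a}" using 3 ends by (intro equalityI subsetI) auto
  show "closed_segment x b \<inter> closed_segment b y = {b}" using 1 ends by (intro equalityI subsetI) auto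
  show "closed_segment c z \<inter> closed_segment x b = {}" using off(3) 3 by (metis disjoint_iff)
  show "closed_segment c z \<inter> closed_segment b y = {}" using off(6) 2 by (metis disjoint_iff)
  show "closed_segment y c \<inter> closed_segment x b = {}" using off(5) 1 by (metis disjoint_iff)
  show "closed_segment y c \<inter> closed_segment b y = {y}" using bends(2) by (simp add: Int_commute)
  show "closed_segment x b \<inter> closed_segment a x = {x}" using bends(1) by (simp add: Int_commute)
qed

lemma roof_simple:
  "(closed_segment z a \<union> closed_segment a x) \<inter> (closed_segment x b \<union> closed_segment b y) = {x}"
  unfolding Int_Un_distrib Int_Un_distrib2 using segs_disjoint(1-3,10) by (simp add: Int_commute)

lemma corner_ne: "b \<notin> {x, y, z}" "x \<noteq> y" "z \<notin> closed_segment x b \<union> closed_segment b y"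
proof -
  show z: "z \<notin> closed_segment x b \<union> closed_segment b y"
    using segs_disjoint(6,7) ends(2)[of z c] by (auto simp: disjoint_iff)
  then have "z \<noteq> b" using ends(2)[of b x] by blast
  then show "b \<notin> {x, y, z}" using distinct by auto
  show "x \<noteq> y" using segs_disjoint(1) ends(2)[of x a] ends(2)[of y b] by (metis IntI empty_iff)
qed

text \<open>Without the roof, the hexagon is a connected curve running from \<open>y\<close> to
  \<open>x\<close> through \<open>c\<close>, \<open>z\<close> and \<open>a\<close>, ends excluded,
  and \<open>K\<close> is attached to it at \<open>a\<close>. So the rest of \<open>\<Gamma>\<close>
  is connected and contains \<open>z\<close>, and \<open>connected_avoids_roof\<close> keeps it out
  of the triangle.\<close>

lemma roof_empty:
  assumes ncol: "cross2 (y - x) (z - x) \<noteq> 0" and \<Gamma>: "\<Gamma> \<subseteq> convex hull {x, y, z}"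
  shows "\<Gamma> \<inter> convex hull {x, b, y} \<subseteq> closed_segment x b \<union> closed_segment b y"
proof -
  let ?R = "closed_segment x b \<union> closed_segment b y"
  let ?J = "(closed_segment c y - {y}) \<union> closed_segment c z \<union> closed_segment z a \<union> (closed_segment a x - {x})"
  have 1: "connected ((closed_segment c y - {y}) \<union> closed_segment c z)"
    by (rule connected_Un[OF connected_segment_delete connected_segment(1)]) (use distinct ends(1) in auto)
  have 2: "connected ((closed_segment c y - {y}) \<union> closed_segment c z \<union> closed_segment z a)"
    by (rule connected_Un[OF 1 connected_segment(1)]) (use ends[of c z] ends[of z a] in blast)
  have J: "connected ?J"
    by (rule connected_Un[OF 2 connected_segment_delete]) (use distinct ends[of z a] ends[of a x] in blast)+
  have a: "a \<in> ?J" by simp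
  have "connected (?J \<union> K)"
  proof (cases "K = {}")
    case False
    have "connected (insert a K)"
      using K False by (intro connected_intermediate_closure[OF K(1)]) (use closure_subset[of K] in auto)
    then have "connected (?J \<union> insert a K)" by (rule connected_Un[OF J]) (use a in blast)
    moreover have "?J \<union> insert a K = ?J \<union> K" using a by blast
    ultimately show ?thesis by simp
  qed (use J in simp)
  moreover have "?J \<union> K = \<Gamma> - ?R"
  proof -
    have cy: "closed_segment c y = closed_segment y c" by (rule closed_segment_commute)
    have "?J \<inter> ?R = {}" unfolding cy using segs_disjoint(1-3,6-10) by (simp add: Int_Un_distrib Int_Un_distrib2 Diff_Int_distrib2) (auto simp: Int_commute)
    moreover have "K \<inter> ?R = {}" using KJ by blast
    moreover have "\<Gamma> \<subseteq> ?J \<union> K \<union> ?R"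
      unfolding \<Gamma>_def cy using ends(1)[of x b] ends(2)[of y b] by blast
    moreover have "?J \<union> K \<subseteq> \<Gamma>" unfolding \<Gamma>_def cy by blast
    ultimately show ?thesis by blast
  qed
  ultimately have "connected (\<Gamma> - ?R)" by simp
  moreover have "z \<in> \<Gamma> - ?R" using corner_ne(3) ends(2)[of z c] unfolding \<Gamma>_def by blast
  moreover have "b \<in> convex hull {x, y, z}" using \<Gamma> ends(1)[of b y] unfolding \<Gamma>_def by blast
  ultimately have "(\<Gamma> - ?R) \<inter> convex hull {x, b, y} = {}"
    using \<Gamma> by (intro connected_avoids_roof[OF ncol]) auto
  then show ?thesis by blast
qed

lemma reflex:
  assumes ncol: "cross2 (y - x) (z - x) \<noteq> 0" and \<Gamma>: "\<Gamma> \<subseteq> convex hull {x, y, z}"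
  shows "reflex_hexagon \<Gamma> a b c x y z"
proof -
  interpret r: hexagon_curve K b y c z a x by (rule rotate)
  interpret rr: hexagon_curve K c z a x b y by (rule r.rotate)
  have g: "r.\<Gamma> = \<Gamma>" "rr.\<Gamma> = \<Gamma>" using \<Gamma>_rotate r.\<Gamma>_rotate by simp_all
  have n: "cross2 (z - y) (x - y) \<noteq> 0" "cross2 (x - z) (y - z) \<noteq> 0"
    using ncol by (simp_all add: cross2_def algebra_simps)
  have h: "\<Gamma> \<subseteq> convex hull {y, z, x}" "\<Gamma> \<subseteq> convex hull {z, x, y}" using \<Gamma> by (simp_all add: insert_commute)
  show ?thesis
  proof
    show "\<Gamma> \<inter> convex hull {z, a, x} \<subseteq> closed_segment z a \<union> closed_segment a x"
      using rr.roof_empty n(2) h(2) g by simp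
    show "\<Gamma> \<inter> convex hull {x, b, y} \<subseteq> closed_segment x b \<union> closed_segment b y"
      using roof_empty ncol \<Gamma> by simp
    show "\<Gamma> \<inter> convex hull {y, c, z} \<subseteq> closed_segment y c \<union> closed_segment c z"
      using r.roof_empty n(1) h(1) g by simp
    show "a \<notin> {x, y, z}" "b \<notin> {x, y, z}" "c \<notin> {x, y, z}"
      using corner_ne r.corner_ne rr.corner_ne by auto
  qed (use ncol \<Gamma> roof_simple r.roof_simple rr.roof_simple in \<open>auto simp: \<Gamma>_def\<close>)
qed

end

section \<open>First segments of edges with at most one bend\<close>

locale one_bend_graph =
  fixes G :: "'a pair_pre_digraph" and p \<beta>
  assumes graph: "pair_graph G" and poly: "polygonal_drawing 1 G p \<beta>"
begin

sublocale drawn_graph G p "\<lambda>e. polygonal_path (edge_points p \<beta> e)"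
  by (rule drawn_graph.intro[OF graph]) (use poly in \<open>simp add: polygonal_drawing_def\<close>)

text \<open>Index \<open>1\<close> is the bend if the arc has one and the other end vertex if not,
  so in both cases it is the end of the first drawn segment.\<close>

definition first :: "'a \<Rightarrow> 'a \<Rightarrow> complex" where
  "first u v = edge_points p \<beta> (u, v) ! 1"

text \<open>A straight edge counts as bent at its midpoint.\<close>

lemma bend:
  assumes "(u, v) \<in> parcs G"
  obtains x where "img u v = closed_segment (p u) x \<union> closed_segment x (p v)" "x \<noteq> p u" "x \<noteq> p v"
    "closed_segment (p u) x \<inter> closed_segment x (p v) = {x}" "\<beta> (u, v) \<noteq> [] \<Longrightarrow> first u v = x"
    "\<beta> (u, v) = [] \<Longrightarrow> first u v = p v"
proof -
  have len: "length (\<beta> (u, v)) \<le> 1" using assms poly by (auto simp: polygonal_drawing_def)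
  note arc = arcD(1)[OF assms]
  show thesis
  proof (cases "\<beta> (u, v)")
    case Nil
    then have path: "polygonal_path (edge_points p \<beta> (u, v)) = linepath (p u) (p v)" by (simp add: edge_points_def)
    have ne: "p u \<noteq> p v" using arc_distinct_ends[OF arc] arcD(2,3)[OF assms] by simp
    define x where "x = midpoint (p u) (p v)"
    have x: "x \<in> closed_segment (p u) (p v)" by (simp add: x_def)
    show thesis
    proof (rule that[of x])
      show "img u v = closed_segment (p u) x \<union> closed_segment x (p v)"
        unfolding path using Un_closed_segment[OF x] by simp
      show "x \<noteq> p u" "x \<noteq> p v" using ne by (auto simp: x_def)
      show "closed_segment (p u) x \<inter> closed_segment x (p v) = {x}"
        using Int_closed_segment[of x "p u" "p v"] x by simp
    qed (use Nil in \<open>simp_all add: first_def edge_points_def\<close>)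
  next
    case (Cons x xs)
    then have b: "\<beta> (u, v) = [x]" using len by simp
    then have path: "polygonal_path (edge_points p \<beta> (u, v)) = linepath (p u) x +++ linepath x (p v)"
      by (simp add: edge_points_def)
    have "arc (linepath (p u) x +++ linepath x (p v))" using arc path by simp
    then have *: "arc (linepath (p u) x)" "arc (linepath x (p v))"
      "closed_segment (p u) x \<inter> closed_segment x (p v) = {x}"
      by (simp_all add: arc_join_eq_alt)
    show thesis
    proof (rule that[of x])
      show "img u v = closed_segment (p u) x \<union> closed_segment x (p v)" unfolding path by (simp add: path_image_join)
      show "x \<noteq> p u" "x \<noteq> p v" using *(1,2) arc_distinct_ends by fastforce+
    qed (use b * in \<open>simp_all add: first_def edge_points_def\<close>)
  qed
qed

lemma first_facts:
  assumes "(u, v) \<in> parcs G"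
  shows "first u v \<noteq> p u" "closed_segment (p u) (first u v) \<subseteq> img u v"
    "slope (p u) (first u v) \<in> drawing_slopes G p \<beta>"
proof -
  obtain x where x: "img u v = closed_segment (p u) x \<union> closed_segment x (p v)" "x \<noteq> p u" "x \<noteq> p v"
    "closed_segment (p u) x \<inter> closed_segment x (p v) = {x}" "\<beta> (u, v) \<noteq> [] \<Longrightarrow> first u v = x"
    "\<beta> (u, v) = [] \<Longrightarrow> first u v = p v"
    by (rule bend[OF assms]) blast
  have ne: "p u \<noteq> p v" using arc_distinct_ends[OF arcD(1)[OF assms]] arcD(2,3)[OF assms] by simp
  show "first u v \<noteq> p u" using x ne by (cases "\<beta> (u, v) = []") auto
  show "closed_segment (p u) (first u v) \<subseteq> img u v"
  proof (cases "\<beta> (u, v) = []")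
    case True
    then have "polygonal_path (edge_points p \<beta> (u, v)) = linepath (p u) (p v)" by (simp add: edge_points_def)
    then show ?thesis using x(6) True by simp
  next
    case False
    then show ?thesis using x by simp
  qed
  show "slope (p u) (first u v) \<in> drawing_slopes G p \<beta>"
    unfolding drawing_slopes_def
    by (intro CollectI exI[of _ "(u, v)"] exI[of _ "0::nat"]) (use assms in \<open>simp add: first_def edge_points_def\<close>)
qed

lemma finite_slopes: "finite (drawing_slopes G p \<beta>)"
proof -
  have "finite (parcs G)"
    using graph by (simp add: pair_graph_def pair_digraph_def pair_fin_digraph_def pair_fin_digraph_axioms_def)
  then have "finite (\<Union>e\<in>parcs G. (\<lambda>i. slope (edge_points p \<beta> e ! i) (edge_points p \<beta> e ! Suc i)) ` {..<length (edge_points p \<beta> e)})"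
    by simp
  moreover have "drawing_slopes G p \<beta> \<subseteq> \<dots>" unfolding drawing_slopes_def by fastforce
  ultimately show ?thesis by (rule rev_finite_subset)
qed

lemma same_direction_imp_eq:
  assumes uv: "(u, v) \<in> parcs G" and uw: "(u, w) \<in> parcs G"
    and k: "first u w - p u = k *\<^sub>R (first u v - p u)" "k > 0"
  shows "v = w"
proof (rule ccontr)
  assume "v \<noteq> w"
  then have Int: "img u v \<inter> img u w = {p u}"
    using img_Int[OF uv uw] arc_distinct_ends[OF arcD(1)[OF uv]] arc_distinct_ends[OF arcD(1)[OF uw]] 
      arcD(2,3)[OF uv] arcD(2,3)[OF uw] by (auto simp: doubleton_eq_iff)
  \<comment> \<open>Chosen so that \<open>q\<close> is the far end of the shorter of the two first
    segments and hence lies on both.\<close>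
  define m where "m = min 1 k"
  have m: "0 < m" "m \<le> 1" "m \<le> k" using k by (auto simp: m_def)
  define q where "q = p u + m *\<^sub>R (first u v - p u)"
  have "q = (1 - m) *\<^sub>R p u + m *\<^sub>R first u v" by (simp add: q_def algebra_simps)
  then have q1: "q \<in> closed_segment (p u) (first u v)" unfolding in_segment using m by (intro exI[of _ m]) simp
  have "q = p u + (m / k) *\<^sub>R (first u w - p u)" unfolding k(1) q_def using k(2) by simp
  then have "q = (1 - m / k) *\<^sub>R p u + (m / k) *\<^sub>R first u w" by (simp add: algebra_simps)
  then have q2: "q \<in> closed_segment (p u) (first u w)" unfolding in_segment using m k by (intro exI[of _ "m / k"]) simp
  have "q = p u" using Int q1 q2 first_facts(2)[OF uv] first_facts(2)[OF uw] by blast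
  then show False using m first_facts(1)[OF uv] by (simp add: q_def)
qed

end

section \<open>Counting slopes at a triangle enclosing its hub\<close>

lemma hull_corner_cone:
  fixes a b c q :: complex
  assumes "q \<in> convex hull {a, b, c}" "q \<notin> closed_segment a c"
  obtains s r where "q - a = s *\<^sub>R (b - a) + r *\<^sub>R (c - a)" "s > 0" "r \<ge> 0"
proof -
  obtain s r where q: "q = a + s *\<^sub>R (b - a) + r *\<^sub>R (c - a)" and sr: "0 \<le> s" "0 \<le> r" "s + r \<le> 1"
    using assms(1) unfolding convex_hull_3_alt by blast
  have "s \<noteq> 0"
  proof
    assume "s = 0"
    then have "q = (1 - r) *\<^sub>R a + r *\<^sub>R c" using q by (simp add: algebra_simps)
    then have "q \<in> closed_segment a c" unfolding in_segment using sr \<open>s = 0\<close> by (intro exI[of _ r]) simp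
    then show False using assms(2) by simp
  qed
  moreover have "q - a = s *\<^sub>R (b - a) + r *\<^sub>R (c - a)" unfolding q by simp
  ultimately show thesis using that sr by simp
qed

lemma convex_hull_least: "S \<subseteq> convex hull T \<Longrightarrow> convex hull S \<subseteq> convex hull T"
  by (simp add: hull_minimal)

lemma div_lt_3: "j < 3 * n \<Longrightarrow> j div n < (3::nat)"
  by (simp add: less_mult_imp_div_less)

text \<open>Double counting; in the application the indices are the corners and the values are the
  slopes of first segments.\<close>

lemma sum_card_le_fibres:
  fixes g :: "nat \<Rightarrow> 'a \<Rightarrow> 'b"
  assumes "finite D" "\<And>i. i < m \<Longrightarrow> finite (N i)" "\<And>i. i < m \<Longrightarrow> g i ` N i \<subseteq> D"
    and le: "\<And>\<sigma>. \<sigma> \<in> D \<Longrightarrow> (\<Sum>i<m. card {v \<in> N i. g i v = \<sigma>}) \<le> b"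
  shows "(\<Sum>i<m. card (N i)) \<le> b * card D"
proof -
  have "(\<Sum>i<m. card (N i)) = (\<Sum>i<m. \<Sum>\<sigma>\<in>D. card {v \<in> N i. g i v = \<sigma>})"
  proof (rule sum.cong)
    fix i assume "i \<in> {..<m}"
    then show "card (N i) = (\<Sum>\<sigma>\<in>D. card {v \<in> N i. g i v = \<sigma>})"
      using sum.group[of "N i" D "g i" "\<lambda>_. 1::nat"] assms by simp
  qed simp
  also have "\<dots> = (\<Sum>\<sigma>\<in>D. \<Sum>i<m. card {v \<in> N i. g i v = \<sigma>})" by (rule sum.swap)
  also have "\<dots> \<le> (\<Sum>\<sigma>\<in>D. b)" using le by (intro sum_mono)
  finally show ?thesis by (simp add: mult.commute)
qed

text \<open>A triangle that encloses its hub. Hub vertices with \<open>j div n = i\<close> hang at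
  the corner \<open>t i\<close>; the matching edges are not mentioned. For \<open>n = 0\<close>
  there is no hub, hence the guards. Straight-line drawings are included as the case without
  bends.\<close>

locale gadget = one_bend_graph G p \<beta> for G :: "'a pair_pre_digraph" and p \<beta> +
  fixes t h :: "nat \<Rightarrow> 'a" and n :: nat
  assumes t: "tri t" and h_inj: "inj_on h {..<3 * n}" and th: "h ` {..<3 * n} \<inter> t ` {..<3} = {}"
    and spoke: "\<And>j. j < 3 * n \<Longrightarrow> (t (j div n), h j) \<in> parcs G"
    and hub_conn: "0 < n \<Longrightarrow> hub_path G (t ` {..<3}) h (3 * n)"
    and hub_in: "0 < n \<Longrightarrow> hub (h ` {..<3 * n}) (t ` {..<3}) {} \<subseteq> inside (tri_curve t)"
begin

definition K :: "complex set" where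
  "K = (if n = 0 then {} else hub (h ` {..<3 * n}) (t ` {..<3}) {})"

definition \<Gamma> :: "complex set" where "\<Gamma> = tri_curve t \<union> K"

lemma t_inj: "inj_on t {..<3}"
proof -
  have "{..<3::nat} = {0, 1, 2}" by auto
  then show ?thesis using t unfolding tri_def by auto
qed

lemma t_verts: "t ` {..<3} \<subseteq> pverts G"
  by (rule tri_verts[OF t])

lemma t_arc: "i < 3 \<Longrightarrow> j < 3 \<Longrightarrow> i \<noteq> j \<Longrightarrow> (t i, t j) \<in> parcs G \<and> img (t i) (t j) \<subseteq> tri_curve t"
proof -
  assume "i < 3" "j < 3" "i \<noteq> j"
  then have ij: "i \<in> {0, 1, 2}" "j \<in> {0, 1, 2}" "i \<noteq> j" by auto
  have a: "(t 0, t 1) \<in> parcs G" "(t 1, t 2) \<in> parcs G" "(t 2, t 0) \<in> parcs G" using t unfolding tri_def by auto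
  then show ?thesis using ij arc_sym[OF a(1)] arc_sym[OF a(2)] arc_sym[OF a(3)]
      arcD(4)[OF a(1)] arcD(4)[OF a(2)] arcD(4)[OF a(3)] unfolding tri_curve_def by fastforce
qed

lemma spoke_img:
  assumes "j < 3 * n"
  shows "img (t (j div n)) (h j) \<subseteq> \<Gamma>"
proof -
  let ?i = "j div n"
  have i: "?i < 3" using div_lt_3 assms by simp
  have arc: "(t ?i, h j) \<in> parcs G" using spoke assms by simp
  note arc' = arc_sym[OF arc]
  have hj: "h j \<in> h ` {..<3 * n}" "t ?i \<in> t ` {..<3}" using assms i by auto
  have "img (h j) (t ?i) - p ` (t ` {..<3} - {}) \<subseteq> hub (h ` {..<3 * n}) (t ` {..<3}) {}"
    using hj arc' unfolding hub_def by fast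
  moreover have "n \<noteq> 0" using assms by auto
  ultimately have 1: "img (h j) (t ?i) - p ` t ` {..<3} \<subseteq> K" by (simp add: K_def)
  have ti: "p (t ?i) \<in> tri_curve t"
  proof -
    obtain i' where i': "i' < 3" "i' \<noteq> ?i" using i by (metis zero_less_numeral one_less_numeral_iff num.distinct(3) semiring_norm(77) zero_neq_one)
    then show ?thesis using t_arc[OF i i'(1)] arcD(6)[of "t ?i" "t i'"] by auto
  qed
  have "z \<in> tri_curve t" if z: "z \<in> img (h j) (t ?i)" "z \<in> p ` t ` {..<3}" for z
  proof -
    obtain w where w: "w \<in> t ` {..<3}" "z = p w" using z(2) by blast
    then have "w = h j \<or> w = t ?i" using img_vertex[OF arc', of w] z(1) t_verts by auto
    moreover have "w \<noteq> h j" using w(1) hj(1) th by (metis IntI empty_iff)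
    ultimately show ?thesis using w ti by simp
  qed
  then have "img (h j) (t ?i) \<subseteq> tri_curve t \<union> K" 
  proof (intro subsetI)
    fix z assume "z \<in> img (h j) (t ?i)"
    then show "z \<in> tri_curve t \<union> K" using 1 \<open>\<And>z. z \<in> img (h j) (t ?i) \<Longrightarrow> z \<in> p ` t ` {..<3} \<Longrightarrow> z \<in> tri_curve t\<close>[of z] by auto
  qed
  then show ?thesis unfolding \<Gamma>_def arcD(4)[OF arc] .
qed

lemma K_inside: "K \<subseteq> inside (tri_curve t)"
  using hub_in by (simp add: K_def)

lemma \<Gamma>_hull: "\<Gamma> \<subseteq> convex hull (tri_curve t)"
  using K_inside inside_subset_convex_hull[of "tri_curve t"] hull_subset[of "tri_curve t" convex]
  unfolding \<Gamma>_def by blast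

text \<open>Otherwise the inside of the triangle, a nonempty open set, would be contained in a
  line.\<close>

lemma hull_noncollinear:
  assumes "tri_curve t \<subseteq> convex hull {x, y, z}"
  shows "cross2 (y - x) (z - x) \<noteq> 0"
proof
  assume c: "cross2 (y - x) (z - x) = 0"
  obtain j where j: "simple_path j" "pathfinish j = pathstart j" "path_image j = tri_curve t"
    using tri_curve_simple_path[OF t] .
  have "open (inside (tri_curve t))" "inside (tri_curve t) \<noteq> {}"
    using Jordan_inside_outside[OF j(1,2)] j(3) by simp_all
  moreover have "inside (tri_curve t) \<subseteq> convex hull {x, y, z}"
    using inside_subset_convex_hull[of "tri_curve t"] convex_hull_least[OF assms] by blast
  ultimately show False using open_not_subset_hull_collinear[OF c] by blast
qed

text \<open>The neighbours of a corner except its partner in the other triangle: exactly those whose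
  edges are known to stay in \<open>\<Gamma>\<close>.\<close>

definition nbrs :: "nat \<Rightarrow> 'a set" where
  "nbrs i = t ` ({..<3} - {i}) \<union> h ` {i * n..<i * n + n}"

lemma block: "i < 3 \<Longrightarrow> j \<in> {i * n..<i * n + n} \<Longrightarrow> j < 3 * n \<and> j div n = i"
proof -
  assume i: "i < 3" and j: "j \<in> {i * n..<i * n + n}"
  have "i * n + n \<le> 3 * n" using i by (metis Suc_leI add.commute mult_Suc mult_le_mono1)
  then have "j < 3 * n" using j by (meson atLeastLessThan_iff less_le_trans)
  moreover have "j div n = i" using j by (intro div_nat_eqI) (simp_all add: mult.commute)
  ultimately show ?thesis by simp
qed

lemma nbrs_arc: "i < 3 \<Longrightarrow> v \<in> nbrs i \<Longrightarrow> (t i, v) \<in> parcs G \<and> img (t i) v \<subseteq> \<Gamma>"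
proof -
  assume i: "i < 3" and v: "v \<in> nbrs i"
  consider i' where "i' < 3" "i' \<noteq> i" "v = t i'" | j where "j \<in> {i * n..<i * n + n}" "v = h j"
    using v unfolding nbrs_def by auto
  then show ?thesis
  proof cases
    case 1
    then show ?thesis using t_arc[OF i, of i'] unfolding \<Gamma>_def by auto
  next
    case 2
    then show ?thesis using spoke[of j] spoke_img[of j] block[OF i 2(1)] by simp
  qed
qed

lemma card_nbrs: "i < 3 \<Longrightarrow> card (nbrs i) = n + 2" "finite (nbrs i)"
proof -
  assume i: "i < 3"
  have sub: "{i * n..<i * n + n} \<subseteq> {..<3 * n}" using block[OF i] by auto
  have "card (t ` ({..<3} - {i})) = 2"
    using card_image[OF inj_on_subset[OF t_inj], of "{..<3} - {i}"] i by simp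
  moreover have "card (h ` {i * n..<i * n + n}) = n"
    using card_image[OF inj_on_subset[OF h_inj sub]] by simp
  moreover have "t ` ({..<3} - {i}) \<inter> h ` {i * n..<i * n + n} = {}" using th sub by blast
  ultimately show "card (nbrs i) = n + 2" unfolding nbrs_def by (subst card_Un_disjoint) auto
next
  show "finite (nbrs i)" by (simp add: nbrs_def)
qed

abbreviation dirs :: "nat \<Rightarrow> 'a \<Rightarrow> complex" where "dirs i v \<equiv> first (t i) v - p (t i)"

lemma dirs_parallel:
  assumes "i < 3" "v \<in> nbrs i" "i' < 3" "v' \<in> nbrs i'"
    and "slope (p (t i)) (first (t i) v) = slope (p (t i')) (first (t i') v')"
  obtains k where "dirs i' v' = k *\<^sub>R dirs i v" "k \<noteq> 0"
proof -
  have ne: "first (t i) v \<noteq> p (t i)" "first (t i') v' \<noteq> p (t i')"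
    using first_facts(1) nbrs_arc assms by blast+
  then have "cross2 (dirs i v) (dirs i' v') = 0"
    using assms(5) slope_eq_iff[of "p (t i)" "first (t i) v" "p (t i')" "first (t i') v'"] by metis
  then obtain k where k: "dirs i' v' = k *\<^sub>R dirs i v"
    using cross2_eq_0_imp_scaled[of "dirs i v" "dirs i' v'"] ne by auto
  moreover have "k \<noteq> 0" using k ne(2) by auto
  ultimately show thesis using that by blast
qed

lemma dirs_eq:
  assumes "i < 3" "v \<in> nbrs i" "v' \<in> nbrs i" "dirs i v' = k *\<^sub>R dirs i v" "k > 0"
  shows "v = v'"
  by (rule same_direction_imp_eq[OF nbrs_arc[OF assms(1,2), THEN conjunct1]
        nbrs_arc[OF assms(1,3), THEN conjunct1] assms(4,5)])

lemma first_in_\<Gamma>: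
  assumes "i < 3" "v \<in> nbrs i" "0 \<le> r" "r \<le> 1"
  shows "p (t i) + r *\<^sub>R dirs i v \<in> \<Gamma>"
proof -
  have "p (t i) + r *\<^sub>R dirs i v = (1 - r) *\<^sub>R p (t i) + r *\<^sub>R first (t i) v" by (simp add: algebra_simps)
  then have "p (t i) + r *\<^sub>R dirs i v \<in> closed_segment (p (t i)) (first (t i) v)"
    unfolding in_segment using assms by blast
  then show ?thesis using first_facts(2) nbrs_arc assms by blast
qed

text \<open>Two edges of equal slope at a corner leave it in the same or in opposite directions. The
  former makes them overlap, the latter puts the corner strictly between two points of the
  hull.\<close>

lemma slopes_extreme_corner:
  assumes i: "i < 3" and ext: "p (t i) extreme_point_of (convex hull (tri_curve t))"
  shows "n + 2 \<le> card (drawing_slopes G p \<beta>)"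
proof -
  let ?f = "\<lambda>v. slope (p (t i)) (first (t i) v)"
  have "inj_on ?f (nbrs i)"
  proof (rule inj_onI)
    fix v v' assume v: "v \<in> nbrs i" "v' \<in> nbrs i" and eq: "?f v = ?f v'"
    obtain k where k: "dirs i v' = k *\<^sub>R dirs i v" "k \<noteq> 0" using dirs_parallel[OF i v(1) i v(2) eq] .
    show "v = v'"
    proof (cases "k > 0")
      case True
      then show ?thesis using dirs_eq[OF i v k(1)] by simp
    next
      case False
      then have k0: "k < 0" using k(2) by simp
      have "first (t i) v \<in> convex hull (tri_curve t)" "first (t i) v' \<in> convex hull (tri_curve t)"
        using first_in_\<Gamma>[OF i v(1), of 1] first_in_\<Gamma>[OF i v(2), of 1] \<Gamma>_hull by auto
      moreover have "p (t i) \<in> open_segment (first (t i) v) (first (t i) v')"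
      proof -
        \<comment> \<open>The weight at which the two opposite vectors cancel.\<close>
        define u where "u = 1 / (1 - k)"
        have u: "0 < u" "u < 1" using k0 by (simp_all add: u_def field_simps)
        have "(1 - u) + u * k = 0" using k0 by (simp add: u_def field_simps)
        then have "((1 - u) + u * k) *\<^sub>R dirs i v = 0" by simp
        then have "(1 - u) *\<^sub>R dirs i v + u *\<^sub>R dirs i v' = 0" unfolding k(1) by (simp add: scaleR_left_distrib)
        then have "p (t i) = (1 - u) *\<^sub>R first (t i) v + u *\<^sub>R first (t i) v'"
          by (simp add: algebra_simps)
        moreover have "first (t i) v \<noteq> first (t i) v'"
        proof
          assume "first (t i) v = first (t i) v'"
          then have "(1 - k) *\<^sub>R dirs i v = 0" using k(1) by (simp add: scaleR_left_diff_distrib)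
          then show False using k0 first_facts(1) nbrs_arc[OF i v(1)] by simp
        qed
        ultimately show ?thesis unfolding in_segment using u by blast
      qed
      ultimately show ?thesis using ext unfolding extreme_point_of_def by blast
    qed
  qed
  moreover have "?f ` nbrs i \<subseteq> drawing_slopes G p \<beta>" using first_facts(3) nbrs_arc[OF i] by blast
  ultimately show ?thesis using card_inj_on_le[OF _ _ finite_slopes] card_nbrs(1)[OF i] by metis
qed

lemma K_connected: "connected K"
proof (cases "n = 0")
  case False
  then show ?thesis using path_connected_imp_connected[OF path_connected_hub[OF hub_conn t_verts]] by (simp add: K_def)
next
  case True
  then show ?thesis unfolding K_def by simp
qed

lemma K_closure: "K \<noteq> {} \<Longrightarrow> i < 3 \<Longrightarrow> p (t i) \<in> closure K"
  using hub_closure[OF hub_conn t_verts] by (simp add: K_def split: if_splits)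

lemma K_disjoint: "K \<inter> tri_curve t = {}"
  using K_inside inside_no_overlap[of "tri_curve t"] by blast

lemma slopes_reflex:
  assumes "reflex_hexagon \<Gamma> (p (t 0)) (p (t 1)) (p (t 2)) x y z"
  shows "3 * (n + 2) \<le> 4 * card (drawing_slopes G p \<beta>)"
proof -
  interpret r: reflex_hexagon \<Gamma> "p (t 0)" "p (t 1)" "p (t 2)" x y z by fact
  let ?f = "\<lambda>i v. slope (p (t i)) (first (t i) v)"
  have "(\<Sum>i<3. card (nbrs i)) \<le> 4 * card (drawing_slopes G p \<beta>)"
  proof (rule sum_card_le_fibres[OF finite_slopes, of _ _ ?f])
    show "finite (nbrs i)" for i by (rule card_nbrs)
    show "?f i ` nbrs i \<subseteq> drawing_slopes G p \<beta>" if "i < 3" for i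
      using first_facts(3) nbrs_arc[OF that] by blast
  next
    fix \<sigma>
    define E where "E = (\<lambda>i. {v \<in> nbrs i. ?f i v = \<sigma>})"
    have "(\<Sum>i<3. card (E i)) \<le> 4"
    proof (cases "\<exists>i<3. E i \<noteq> {}")
      case False
      then have "(\<Sum>i<3. card (E i)) = 0" by simp
      then show ?thesis by linarith
    next
      case True
      \<comment> \<open>Any first segment of slope \<open>\<sigma>\<close> supplies a direction
        \<open>s\<close>; all others of this slope run along \<open>s\<close> or
        \<open>- s\<close>.\<close>
      then obtain i0 v0 where v0: "i0 < 3" "v0 \<in> nbrs i0" "?f i0 v0 = \<sigma>" unfolding E_def by blast
      define s where "s = dirs i0 v0"
      have s: "s \<noteq> 0" using first_facts(1) nbrs_arc v0 by (simp add: s_def)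
      have E_le: "card (E i) \<le> of_bool (r.sees (p (t i)) s) + of_bool (r.sees (p (t i)) (- s))" if i: "i < 3" for i
      proof -
        \<comment> \<open>The neighbours reached in the direction \<open>s'\<close>. There is at
          most one, because edges leaving in the same direction overlap, and none unless the corner
          sees \<open>s'\<close>.\<close>
        define D where "D = (\<lambda>s'. {v \<in> nbrs i. \<exists>k>0. dirs i v = k *\<^sub>R s'})"
        have "E i \<subseteq> D s \<union> D (- s)"
        proof
          fix v assume "v \<in> E i"
          then have v: "v \<in> nbrs i" "?f i0 v0 = ?f i v" using v0 unfolding E_def by auto
          obtain k where k: "dirs i v = k *\<^sub>R s" "k \<noteq> 0" unfolding s_def using dirs_parallel[OF v0(1,2) i v] .
          show "v \<in> D s \<union> D (- s)"
          proof (cases "k > 0")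
            case False
            then have "- k > 0" "dirs i v = (- k) *\<^sub>R (- s)" using k by simp_all
            then show ?thesis using v unfolding D_def by blast
          qed (use k v in \<open>auto simp: D_def\<close>)
        qed
        moreover have D: "finite (D s')" "card (D s') \<le> of_bool (r.sees (p (t i)) s')" if "s' \<noteq> 0" for s'
        proof -
          show fin: "finite (D s')" unfolding D_def using card_nbrs(2)[of i] by simp
          have "v = w" if "v \<in> D s'" "w \<in> D s'" for v w
          proof -
            obtain k l where kl: "k > 0" "l > 0" "dirs i v = k *\<^sub>R s'" "dirs i w = l *\<^sub>R s'" "v \<in> nbrs i" "w \<in> nbrs i"
              using \<open>v \<in> D s'\<close> \<open>w \<in> D s'\<close> unfolding D_def by blast
            then have "dirs i w = (l / k) *\<^sub>R dirs i v" "l / k > 0" by simp_all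
            then show ?thesis using dirs_eq[OF i kl(5,6)] by blast
          qed
          then have "card (D s') \<le> 1" using fin by (simp add: card_le_Suc0_iff_eq)
          moreover have "r.sees (p (t i)) s'" if ne: "D s' \<noteq> {}"
          proof -
            obtain v k where v: "v \<in> nbrs i" "k > 0" "dirs i v = k *\<^sub>R s'" using ne unfolding D_def by blast
            have "p (t i) + l *\<^sub>R s' \<in> \<Gamma>" if l: "0 \<le> l" "l \<le> k" for l
              using first_in_\<Gamma>[OF i v(1), of "l / k"] l v(2,3) by simp
            then show ?thesis unfolding r.sees_def using v(2) by blast
          qed
          ultimately show "card (D s') \<le> of_bool (r.sees (p (t i)) s')" by (cases "D s' = {}") auto
        qed
        ultimately have "card (E i) \<le> card (D s \<union> D (- s))" using s by (intro card_mono) auto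
        also have "\<dots> \<le> card (D s) + card (D (- s))" by (rule card_Un_le)
        also have "\<dots> \<le> of_bool (r.sees (p (t i)) s) + of_bool (r.sees (p (t i)) (- s))"
          using D(2)[of s] D(2)[of "- s"] s by simp
        finally show ?thesis .
      qed
      have "(\<Sum>i<3. card (E i)) = card (E 0) + card (E 1) + card (E 2)"
        by (simp add: numeral_3_eq_3 numeral_2_eq_2)
      moreover have "card (E 0) + card (E 1) + card (E 2) \<le> 4"
        using E_le[of 0] E_le[of 1] E_le[of 2] r.two_not_sees_both[OF s] by (auto simp: of_bool_def split: if_splits)
      ultimately show ?thesis by simp
    qed
    then show "(\<Sum>i<3. card {v \<in> nbrs i. ?f i v = \<sigma>}) \<le> 4" unfolding E_def .
  qed
  then show ?thesis by (simp add: card_nbrs(1))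
qed

theorem one_bend_slopes: "3 * (n + 2) \<le> 4 * card (drawing_slopes G p \<beta>)"
proof (cases "\<exists>i<3. p (t i) extreme_point_of (convex hull (tri_curve t))")
  case True
  then show ?thesis using slopes_extreme_corner by fastforce
next
  case False
  define a b c where "a = p (t 0)" and "b = p (t 1)" and "c = p (t 2)"
  have arcs: "(t 0, t 1) \<in> parcs G" "(t 1, t 2) \<in> parcs G" "(t 2, t 0) \<in> parcs G"
    and tne: "t 0 \<noteq> t 1" "t 1 \<noteq> t 2" "t 0 \<noteq> t 2" using t unfolding tri_def by auto
  obtain x where x: "img (t 0) (t 1) = closed_segment a x \<union> closed_segment x b" "x \<noteq> a" "x \<noteq> b"
    "closed_segment a x \<inter> closed_segment x b = {x}" unfolding a_def b_def by (rule bend[OF arcs(1)]) blast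
  obtain y where y: "img (t 1) (t 2) = closed_segment b y \<union> closed_segment y c" "y \<noteq> b" "y \<noteq> c"
    "closed_segment b y \<inter> closed_segment y c = {y}" unfolding b_def c_def by (rule bend[OF arcs(2)]) blast
  obtain z where z: "img (t 2) (t 0) = closed_segment c z \<union> closed_segment z a" "z \<noteq> c" "z \<noteq> a"
    "closed_segment c z \<inter> closed_segment z a = {z}" unfolding c_def a_def by (rule bend[OF arcs(3)]) blast
  have J: "tri_curve t = closed_segment a x \<union> closed_segment x b \<union> (closed_segment b y \<union> closed_segment y c) \<union>
      (closed_segment c z \<union> closed_segment z a)"
    unfolding tri_curve_def x(1) y(1) z(1) ..
  interpret hx: hexagon_curve K a x b y c z
  proof
    show "(closed_segment a x \<union> closed_segment x b) \<inter> (closed_segment b y \<union> closed_segment y c) = {b}"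
      using img_Int[OF arcs(1,2)] tne unfolding x(1) y(1) b_def by (auto simp: doubleton_eq_iff)
    show "(closed_segment b y \<union> closed_segment y c) \<inter> (closed_segment c z \<union> closed_segment z a) = {c}"
      using img_Int[OF arcs(2,3)] tne unfolding z(1) y(1) c_def by (auto simp: doubleton_eq_iff)
    show "(closed_segment c z \<union> closed_segment z a) \<inter> (closed_segment a x \<union> closed_segment x b) = {a}"
      using img_Int[OF arcs(3,1)] tne unfolding z(1) x(1) a_def by (auto simp: doubleton_eq_iff)
    show "connected K" by (rule K_connected)
    show "K \<noteq> {} \<Longrightarrow> {a, b, c} \<subseteq> closure K" using K_closure by (simp add: a_def b_def c_def)
    show "K \<inter> (closed_segment a x \<union> closed_segment x b \<union> (closed_segment b y \<union> closed_segment y c) \<union>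
      (closed_segment c z \<union> closed_segment z a)) = {}" using K_disjoint unfolding J .
  qed (use x y z in auto)
  have G: "hx.\<Gamma> = \<Gamma>" unfolding hx.\<Gamma>_def \<Gamma>_def J ..
  let ?H = "convex hull (tri_curve t)"
  have H6: "?H = convex hull {a, b, c, x, y, z}"
  proof
    have "closed_segment u v \<subseteq> convex hull {a, b, c, x, y, z}" if "u \<in> {a, b, c, x, y, z}" "v \<in> {a, b, c, x, y, z}" for u v
      using that unfolding segment_convex_hull by (intro hull_mono) auto
    then have "tri_curve t \<subseteq> convex hull {a, b, c, x, y, z}" unfolding J by (intro Un_least) blast+
    then show "?H \<subseteq> convex hull {a, b, c, x, y, z}" by (rule convex_hull_least)
    have "{a, b, c, x, y, z} \<subseteq> tri_curve t" unfolding J by simp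
    then show "convex hull {a, b, c, x, y, z} \<subseteq> ?H" by (rule hull_mono)
  qed
  \<comment> \<open>Extreme points are vertices of the hexagon, and in this case no corner is
    extreme, so the bends alone span the hull.\<close>
  have "{v. v extreme_point_of ?H} \<subseteq> {x, y, z}"
  proof
    fix v assume "v \<in> {v. v extreme_point_of ?H}"
    then have v: "v extreme_point_of ?H" by simp
    then have "v \<in> {a, b, c, x, y, z}" unfolding H6 by (rule extreme_point_of_convex_hull)
    moreover have "v \<noteq> a" "v \<noteq> b" "v \<noteq> c" using False v unfolding a_def b_def c_def by fastforce+
    ultimately show "v \<in> {x, y, z}" by simp
  qed
  moreover have "?H = convex hull {v. v extreme_point_of ?H}"
    unfolding H6 by (intro Krein_Milman_Minkowski compact_convex_hull convex_convex_hull finite_imp_compact) simp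
  ultimately have H: "?H \<subseteq> convex hull {x, y, z}" by (metis hull_mono)
  have "cross2 (y - x) (z - x) \<noteq> 0" using H hull_subset[of "tri_curve t" convex] by (intro hull_noncollinear) blast
  then have "reflex_hexagon \<Gamma> a b c x y z" using hx.reflex G \<Gamma>_hull H by auto
  then show ?thesis unfolding a_def b_def c_def by (rule slopes_reflex)
qed

section \<open>Straight-line drawings: the cones at the corners\<close>

definition cor :: "nat \<Rightarrow> 'a" where "cor i = t (i mod 3)"

text \<open>All counted edges at a corner lie in its cone. Any two of the three corners are
  consecutive in cyclic order, where \<open>cross2_corner_cones_pos\<close> excludes parallel edges;
  at a single corner the cone contains no two opposite directions.\<close>

theorem straight_slopes:
  assumes straight: "\<And>e. e \<in> parcs G \<Longrightarrow> \<beta> e = []"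
  shows "3 * n + 3 \<le> card (drawing_slopes G p \<beta>)"
proof -
  let ?Q = "\<lambda>i. p (cor i)"
  have seg: "img u v = closed_segment (p u) (p v)" "first u v = p v" if "(u, v) \<in> parcs G" for u v
    using straight[OF that] by (simp_all add: edge_points_def first_def)
  have three: "{?Q i, ?Q (i + 1), ?Q (i + 2)} = {?Q 0, ?Q 1, ?Q 2}" for i
  proof -
    have "i mod 3 = 0 \<or> i mod 3 = 1 \<or> i mod 3 = 2" by linarith
    then show ?thesis by (elim disjE) (auto simp: cor_def mod_Suc numeral_2_eq_2)
  qed
  have mod_ne: "i mod 3 \<noteq> (i + 1) mod 3" "i mod 3 \<noteq> (i + 2) mod 3" "(i + 1) mod 3 \<noteq> (i + 2) mod 3" for i :: nat
    by presburger+
  have m3: "i mod 3 < 3" for i :: nat by simp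
  have c_arc: "(cor i, cor (i + 2)) \<in> parcs G" for i
    using t_arc[OF m3 m3] mod_ne unfolding cor_def by blast
  have c_ne: "cor (i + 1) \<noteq> cor (i + 2)" for i
    using inj_onD[OF t_inj] mod_ne m3 unfolding cor_def lessThan_iff by metis
  have hull: "convex hull (tri_curve t) \<subseteq> convex hull {?Q i, ?Q (i + 1), ?Q (i + 2)}" for i
  proof -
    have "closed_segment (?Q u) (?Q v) \<subseteq> convex hull {?Q 0, ?Q 1, ?Q 2}" if "u \<in> {0, 1, 2}" "v \<in> {0, 1, 2}" for u v
      using that unfolding segment_convex_hull by (intro hull_mono) auto
    moreover have "tri_curve t = closed_segment (?Q 0) (?Q 1) \<union> closed_segment (?Q 1) (?Q 2) \<union> closed_segment (?Q 2) (?Q 0)"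
      unfolding tri_curve_def using t seg(1) unfolding tri_def cor_def by simp
    ultimately have "tri_curve t \<subseteq> convex hull {?Q 0, ?Q 1, ?Q 2}" by auto
    then show ?thesis unfolding three by (rule convex_hull_least)
  qed
  have ncol: "cross2 (?Q (i + 1) - ?Q i) (?Q (i + 2) - ?Q i) \<noteq> 0" for i
    using hull[of i] hull_subset[of "tri_curve t" convex] by (intro hull_noncollinear) blast
  \<comment> \<open>Each corner is charged with its spokes and with the side to the next corner. The
    side to \<open>cor (i + 2)\<close> is counted at its other end, and its ray is missing from the
    cone.\<close>
  define S where "S = (\<lambda>i. (t i, cor (i + 1))) ` {..<3} \<union> (\<lambda>j. (t (j div n), h j)) ` {..<3 * n}"
  have S_cases: "\<exists>i<3. u = cor i \<and> u = t i \<and> v \<in> nbrs i \<and> v \<noteq> cor (i + 2)" if "(u, v) \<in> S" for u v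
  proof -
    consider i where "i < 3" "u = t i" "v = cor (i + 1)" | j where "j < 3 * n" "u = t (j div n)" "v = h j"
      using \<open>(u, v) \<in> S\<close> unfolding S_def by blast
    then show ?thesis
    proof cases
      case 1
      then have "v \<in> nbrs i" unfolding nbrs_def cor_def using mod_ne(1)[of i] by auto
      then show ?thesis using 1 c_ne[of i] by (intro exI[of _ i]) (auto simp: cor_def)
    next
      case 2
      have n: "n \<noteq> 0" using 2 by auto
      have "j div n * n \<le> j" "j < j div n * n + n"
        using div_mult_mod_eq[of j n] mod_less_divisor[of n j] n by linarith+
      then have "v \<in> nbrs (j div n)" using 2 unfolding nbrs_def by auto
      moreover have "v \<noteq> cor (j div n + 2)" using 2 th unfolding cor_def by auto
      ultimately show ?thesis using 2 div_lt_3[of j] by (intro exI[of _ "j div n"]) (auto simp: cor_def)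
    qed
  qed
  have cone: "\<exists>s r. p v - ?Q i = s *\<^sub>R (?Q (i + 1) - ?Q i) + r *\<^sub>R (?Q (i + 2) - ?Q i) \<and> s > 0 \<and> r \<ge> 0"
    if i: "i < 3" and v: "v \<in> nbrs i" "v \<noteq> cor (i + 2)" for i v
  proof -
    have ti: "t i = cor i" using i by (simp add: cor_def)
    note arc = nbrs_arc[OF i v(1), THEN conjunct1]
    have "p v \<in> \<Gamma>" using nbrs_arc[OF i v(1)] arcD(7)[OF arc] by blast
    then have "p v \<in> convex hull {?Q i, ?Q (i + 1), ?Q (i + 2)}" using \<Gamma>_hull hull[of i] by blast
    moreover have "p v \<notin> closed_segment (?Q i) (?Q (i + 2))"
    proof -
      have "v \<noteq> cor i" using arc arc_distinct_ends[OF arcD(1)[OF arc]] arcD(2,3)[OF arc] ti by auto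
      then have "p v \<notin> img (cor i) (cor (i + 2))"
        using img_vertex[OF c_arc[of i], of v] arc_verts[OF arc] v(2) by blast
      then show ?thesis using seg(1)[OF c_arc] by simp
    qed
    ultimately show ?thesis by (metis hull_corner_cone)
  qed
  have next_corner: "slope (p u) (p v) \<noteq> slope (p u') (p v')"
    if uv: "(t i, v) \<in> parcs G" "i < 3" "v \<in> nbrs i" "v \<noteq> cor (i + 2)" "u = t i"
      and uv': "i' < 3" "v' \<in> nbrs i'" "v' \<noteq> cor (i' + 2)" "u' = t i'" and i': "i' = (i + 1) mod 3" for u v u' v' i i'
  proof -
    have Q: "?Q i' = ?Q (i + 1)" "?Q (i' + 1) = ?Q (i + 2)" "?Q (i' + 2) = ?Q i"
      using i' \<open>i < 3\<close> by (simp_all add: cor_def mod_simps)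
    obtain s r where 1: "p v - ?Q i = s *\<^sub>R (?Q (i + 1) - ?Q i) + r *\<^sub>R (?Q (i + 2) - ?Q i)" "s > 0" "r \<ge> 0"
      using cone[OF uv(2-4)] by blast
    obtain s' r' where 2: "p v' - ?Q i' = s' *\<^sub>R (?Q (i' + 1) - ?Q i') + r' *\<^sub>R (?Q (i' + 2) - ?Q i')" "s' > 0" "r' \<ge> 0"
      using cone[OF uv'(1-3)] by blast
    have 2: "p v' - ?Q (i + 1) = s' *\<^sub>R (?Q (i + 2) - ?Q (i + 1)) + r' *\<^sub>R (?Q i - ?Q (i + 1))" "s' > 0" "r' \<ge> 0"
      using 2 unfolding Q by simp_all
    have "cross2 (p v - ?Q i) (p v' - ?Q i') \<noteq> 0"
      using cross2_corner_cones_pos[OF ncol[of i] 1(2,3) 2(2,3)] unfolding 1(1) Q(1) 2(1) .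
    moreover have "u = cor i" "u' = cor i'" using uv uv' by (simp_all add: cor_def)
    moreover have "p u \<noteq> p v" "p u' \<noteq> p v'"
      using first_facts(1)[OF nbrs_arc[OF uv(2,3), THEN conjunct1]] seg(2)[OF nbrs_arc[OF uv(2,3), THEN conjunct1]]
        first_facts(1)[OF nbrs_arc[OF uv'(1,2), THEN conjunct1]] seg(2)[OF nbrs_arc[OF uv'(1,2), THEN conjunct1]] uv(5) uv'(4) by auto
    ultimately show ?thesis using slope_eq_iff by metis
  qed
  let ?f = "\<lambda>(u, v). slope (p u) (p v)"
  have "inj_on ?f S"
  proof (rule inj_onI, clarify)
    fix u v u' v' assume S: "(u, v) \<in> S" "(u', v') \<in> S" and eq: "slope (p u) (p v) = slope (p u') (p v')"
    obtain i where i: "i < 3" "u = t i" "v \<in> nbrs i" "v \<noteq> cor (i + 2)" using S_cases[OF S(1)] by blast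
    obtain i' where i': "i' < 3" "u' = t i'" "v' \<in> nbrs i'" "v' \<noteq> cor (i' + 2)" using S_cases[OF S(2)] by blast
    have a: "(t i, v) \<in> parcs G" "(t i', v') \<in> parcs G" using nbrs_arc i i' by blast+
    have "i' \<noteq> (i + 1) mod 3" using next_corner[OF a(1) i(1,3,4,2) i'(1,3,4,2)] eq by blast
    moreover have "i \<noteq> (i' + 1) mod 3" using next_corner[OF a(2) i'(1,3,4,2) i(1,3,4,2)] eq by metis
    moreover have "i \<in> {0, 1, 2}" "i' \<in> {0, 1, 2}" using i(1) i'(1) by auto
    ultimately have ii: "i' = i" by auto
    have eq': "slope (p (t i)) (first (t i) v) = slope (p (t i)) (first (t i) v')"
      using eq i i' ii seg(2)[OF a(1)] seg(2)[OF a(2)] by simp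
    obtain k where k: "dirs i v' = k *\<^sub>R dirs i v"
      using dirs_parallel[OF i(1,3) i(1) _ eq'] i'(3) ii by metis
    have ti: "t i = cor i" using i(1) by (simp add: cor_def)
    have d: "dirs i v = p v - ?Q i" "dirs i v' = p v' - ?Q i" using seg(2) a ii ti by auto
    obtain s r where 1: "p v - ?Q i = s *\<^sub>R (?Q (i + 1) - ?Q i) + r *\<^sub>R (?Q (i + 2) - ?Q i)" "s > 0" "r \<ge> 0"
      using cone[OF i(1,3,4)] by blast
    obtain s' r' where 2: "p v' - ?Q i = s' *\<^sub>R (?Q (i + 1) - ?Q i) + r' *\<^sub>R (?Q (i + 2) - ?Q i)" "s' > 0" "r' \<ge> 0"
      using cone[OF i(1)] i'(3,4) ii by blast
    define B C where "B = ?Q (i + 1) - ?Q i" and "C = ?Q (i + 2) - ?Q i"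
    have "s' *\<^sub>R B + r' *\<^sub>R C = k *\<^sub>R (s *\<^sub>R B + r *\<^sub>R C)"
      using k unfolding d 1(1) 2(1) B_def C_def .
    \<comment> \<open>Compares the components along \<open>B\<close>. Both are positive, which
      forces \<open>k > 0\<close>, and equal directions at a corner belong to the same
      neighbour.\<close>
    then have "cross2 (s' *\<^sub>R B + r' *\<^sub>R C) C = cross2 (k *\<^sub>R (s *\<^sub>R B + r *\<^sub>R C)) C" by simp
    then have "s' * cross2 B C = (k * s) * cross2 B C" by simp
    moreover have "cross2 B C \<noteq> 0" using ncol[of i] unfolding B_def C_def .
    ultimately have "s' = k * s" by simp
    then have "k > 0" using 1(2) 2(2) by (metis zero_less_mult_pos2)
    then have "v = v'" using dirs_eq[OF i(1,3) _ k] i'(3) ii by simp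
    then show "u = u' \<and> v = v'" using i(2) i'(2) ii by simp
  qed
  moreover have "?f ` S \<subseteq> drawing_slopes G p \<beta>"
  proof clarify
    fix u v assume "(u, v) \<in> S"
    then obtain i where i: "i < 3" "u = t i" "v \<in> nbrs i" using S_cases by blast
    then have "(u, v) \<in> parcs G" using nbrs_arc by blast
    then show "slope (p u) (p v) \<in> drawing_slopes G p \<beta>" using first_facts(3) seg(2) by metis
  qed
  ultimately have "card S \<le> card (drawing_slopes G p \<beta>)" by (rule card_inj_on_le[OF _ _ finite_slopes])
  moreover have "card S = 3 + 3 * n"
  proof -
    have "inj_on (\<lambda>i. (t i, cor (i + 1))) {..<3}" using t_inj unfolding inj_on_def by blast
    moreover have "inj_on (\<lambda>j. (t (j div n), h j)) {..<3 * n}" using h_inj unfolding inj_on_def by blast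
    moreover have "(\<lambda>i. (t i, cor (i + 1))) ` {..<3} \<inter> (\<lambda>j. (t (j div n), h j)) ` {..<3 * n} = {}"
    proof -
      have "cor (i + 1) \<noteq> h j" if "j < 3 * n" for i j using th that m3[of "i + 1"] unfolding cor_def by (metis IntI empty_iff imageI lessThan_iff)
      then show ?thesis by auto
    qed
    ultimately show ?thesis unfolding S_def by (subst card_Un_disjoint) (auto simp: card_image)
  qed
  ultimately show ?thesis by simp
qed

end

section \<open>The graph\<close>

text \<open>Parity keeps corners and hub vertices apart; \<open>s\<close> selects the
  triangle.\<close>

definition cor_vertex :: "nat \<Rightarrow> nat \<Rightarrow> nat" where "cor_vertex s i = 2 * prod_encode (s, i)"

definition hub_vertex :: "nat \<Rightarrow> nat \<Rightarrow> nat" where "hub_vertex s j = Suc (2 * prod_encode (s, j))"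

lemma vertex_eq_iff [simp]:
  "cor_vertex s i = cor_vertex s' i' \<longleftrightarrow> s = s' \<and> i = i'"
  "hub_vertex s i = hub_vertex s' i' \<longleftrightarrow> s = s' \<and> i = i'"
  "cor_vertex s i \<noteq> hub_vertex s' i'" "hub_vertex s' i' \<noteq> cor_vertex s i"
  unfolding cor_vertex_def hub_vertex_def by (simp_all, presburger+)

text \<open>The corners own consecutive blocks of \<open>n\<close> vertices on the hub path, via
  \<open>j div n\<close>. The partner of triangle \<open>s\<close> is \<open>1 - s\<close>, so
  letting \<open>s\<close> range over both triangles lists each matching edge in both
  orientations.\<close>

definition slope_graph :: "nat \<Rightarrow> nat pair_pre_digraph" where
  "slope_graph n =
     \<lparr>pverts = {cor_vertex s i | s i. s < 2 \<and> i < 3} \<union> {hub_vertex s j | s j. s < 2 \<and> j < 3 * n},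
      parcs = {(cor_vertex s i, cor_vertex s i') | s i i'. s < 2 \<and> i < 3 \<and> i' < 3 \<and> i \<noteq> i'} \<union>
        {(cor_vertex s i, cor_vertex (1 - s) i) | s i. s < 2 \<and> i < 3} \<union>
        {(cor_vertex s (j div n), hub_vertex s j) | s j. s < 2 \<and> j < 3 * n} \<union>
        {(hub_vertex s j, cor_vertex s (j div n)) | s j. s < 2 \<and> j < 3 * n} \<union>
        {(hub_vertex s j, hub_vertex s (Suc j)) | s j. s < 2 \<and> Suc j < 3 * n} \<union>
        {(hub_vertex s (Suc j), hub_vertex s j) | s j. s < 2 \<and> Suc j < 3 * n}\<rparr>"

lemma finite_slope_graph_verts: "finite (pverts (slope_graph n))"
proof -
  have "pverts (slope_graph n) = (\<lambda>(s, i). cor_vertex s i) ` ({..<2} \<times> {..<3}) \<union>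
      (\<lambda>(s, j). hub_vertex s j) ` ({..<2} \<times> {..<3 * n})"
    by (auto simp: slope_graph_def)
  then show ?thesis by simp
qed

lemma slope_graph_arc_cases:
  assumes "(u, v) \<in> parcs (slope_graph n)"
  obtains (triangle) s i i' where "u = cor_vertex s i" "v = cor_vertex s i'" "s < 2" "i < 3" "i' < 3" "i \<noteq> i'"
    | (link) s i where "u = cor_vertex s i" "v = cor_vertex (1 - s) i" "s < 2" "i < 3"
    | (spoke) s j where "u = cor_vertex s (j div n)" "v = hub_vertex s j" "s < 2" "j < 3 * n"
    | (spoke') s j where "u = hub_vertex s j" "v = cor_vertex s (j div n)" "s < 2" "j < 3 * n"
    | (path) s j where "u = hub_vertex s j" "v = hub_vertex s (Suc j)" "s < 2" "Suc j < 3 * n"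
    | (path') s j where "u = hub_vertex s (Suc j)" "v = hub_vertex s j" "s < 2" "Suc j < 3 * n"
  using assms unfolding slope_graph_def by auto

lemma slope_graph_arcs:
  "s < 2 \<Longrightarrow> i < 3 \<Longrightarrow> i' < 3 \<Longrightarrow> i \<noteq> i' \<Longrightarrow> (cor_vertex s i, cor_vertex s i') \<in> parcs (slope_graph n)"
  "s < 2 \<Longrightarrow> i < 3 \<Longrightarrow> (cor_vertex s i, cor_vertex (1 - s) i) \<in> parcs (slope_graph n)"
  "s < 2 \<Longrightarrow> j < 3 * n \<Longrightarrow> (cor_vertex s (j div n), hub_vertex s j) \<in> parcs (slope_graph n)"
  "s < 2 \<Longrightarrow> j < 3 * n \<Longrightarrow> (hub_vertex s j, cor_vertex s (j div n)) \<in> parcs (slope_graph n)"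
  "s < 2 \<Longrightarrow> Suc j < 3 * n \<Longrightarrow> (hub_vertex s j, hub_vertex s (Suc j)) \<in> parcs (slope_graph n)"
  "s < 2 \<Longrightarrow> Suc j < 3 * n \<Longrightarrow> (hub_vertex s (Suc j), hub_vertex s j) \<in> parcs (slope_graph n)"
  unfolding slope_graph_def by auto

lemma slope_graph_verts:
  "s < 2 \<Longrightarrow> i < 3 \<Longrightarrow> cor_vertex s i \<in> pverts (slope_graph n)"
  "s < 2 \<Longrightarrow> j < 3 * n \<Longrightarrow> hub_vertex s j \<in> pverts (slope_graph n)"
  unfolding slope_graph_def by auto

lemma slope_graph_arc_props:
  assumes "(u, v) \<in> parcs (slope_graph n)"
  shows "u \<in> pverts (slope_graph n) \<and> v \<in> pverts (slope_graph n) \<and> u \<noteq> v \<and> (v, u) \<in> parcs (slope_graph n)"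
  using assms
proof (cases rule: slope_graph_arc_cases)
  case (triangle s i i')
  then show ?thesis by (auto intro: slope_graph_verts slope_graph_arcs)
next
  case (link s i)
  then have "s = 0 \<or> s = 1" by auto
  then have "s = 1 - (1 - s)" "s \<noteq> 1 - s" "1 - s < 2" by auto
  then show ?thesis using link slope_graph_arcs(2)[of "1 - s" i n] by (auto intro: slope_graph_verts)
next
  case (spoke s j)
  then show ?thesis using div_lt_3 by (auto intro: slope_graph_verts slope_graph_arcs)
next
  case (spoke' s j)
  then show ?thesis using div_lt_3 by (auto intro: slope_graph_verts slope_graph_arcs)
next
  case (path s j)
  then show ?thesis by (auto intro: slope_graph_verts slope_graph_arcs)
next
  case (path' s j)
  then show ?thesis by (auto intro: slope_graph_verts slope_graph_arcs)
qed

lemma pair_graph_slope_graph: "pair_graph (slope_graph n)"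
proof
  have "parcs (slope_graph n) \<subseteq> pverts (slope_graph n) \<times> pverts (slope_graph n)"
    using slope_graph_arc_props by auto
  then show "finite (parcs (slope_graph n))" using finite_slope_graph_verts finite_subset by blast
  show "symmetric (with_proj (slope_graph n))"
    unfolding symmetric_def by (auto simp: sym_def slope_graph_arc_props)
qed (use finite_slope_graph_verts slope_graph_arc_props in force)+

lemma out_degree_slope_graph:
  "out_degree (with_proj (slope_graph n)) v = card {w. (v, w) \<in> parcs (slope_graph n)}"
proof -
  have "out_arcs (with_proj (slope_graph n)) v = Pair v ` {w. (v, w) \<in> parcs (slope_graph n)}"
    by (auto simp: out_arcs_def)
  then show ?thesis unfolding out_degree_def by (simp add: card_image inj_on_def)
qed

lemma div_eq_interval: "0 < n \<Longrightarrow> {j. j div n = i} \<subseteq> {i * n..<i * n + n}" for i n :: nat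
proof
  fix j assume "0 < n" "j \<in> {j. j div n = i}"
  moreover from this(1) have "j div n * n \<le> j" "j < j div n * n + n"
    using div_mult_mod_eq[of j n] mod_less_divisor[of n j] by linarith+
  ultimately show "j \<in> {i * n..<i * n + n}" by simp
qed

text \<open>A corner has two neighbours in its triangle, one partner and \<open>n\<close> spokes; a
  hub vertex has one spoke and at most two neighbours on the path.\<close>

lemma max_degree_slope_graph: "max_degree (slope_graph n) = n + 3"
  unfolding max_degree_def
proof (rule Max_eqI)
  show "finite (out_degree (with_proj (slope_graph n)) ` pverts (slope_graph n))"
    using finite_slope_graph_verts by simp
next
  fix k assume "k \<in> out_degree (with_proj (slope_graph n)) ` pverts (slope_graph n)"
  then obtain v where k: "k = card {w. (v, w) \<in> parcs (slope_graph n)}" and v: "v \<in> pverts (slope_graph n)"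
    by (auto simp: out_degree_slope_graph)
  consider s i where "v = cor_vertex s i" "i < 3" | s j where "v = hub_vertex s j"
    using v unfolding slope_graph_def by auto
  then show "k \<le> n + 3"
  proof cases
    case 1
    let ?H = "{j. j < 3 * n \<and> j div n = i}"
    have "{w. (v, w) \<in> parcs (slope_graph n)} \<subseteq>
        cor_vertex s ` ({..<3} - {i}) \<union> {cor_vertex (1 - s) i} \<union> hub_vertex s ` ?H"
    proof
      fix w assume "w \<in> {w. (v, w) \<in> parcs (slope_graph n)}"
      then have "(v, w) \<in> parcs (slope_graph n)" by simp
      then show "w \<in> cor_vertex s ` ({..<3} - {i}) \<union> {cor_vertex (1 - s) i} \<union> hub_vertex s ` ?H"
        by (cases rule: slope_graph_arc_cases) (use 1 in auto)
    qed
    then have "k \<le> card (cor_vertex s ` ({..<3} - {i}) \<union> {cor_vertex (1 - s) i} \<union> hub_vertex s ` ?H)"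
      unfolding k by (intro card_mono) auto
    also have "\<dots> \<le> card (cor_vertex s ` ({..<3} - {i})) + card {cor_vertex (1 - s) i} + card (hub_vertex s ` ?H)"
      by (meson card_Un_le add_le_mono1 order_trans)
    also have "\<dots> \<le> 2 + 1 + n"
    proof -
      have "card (cor_vertex s ` ({..<3} - {i})) \<le> 2"
        using card_image_le[of "{..<3} - {i}" "cor_vertex s"] 1 by simp
      moreover have "card (hub_vertex s ` ?H) \<le> n"
      proof (cases "n = 0")
        case False
        then have "?H \<subseteq> {i * n..<i * n + n}" using div_eq_interval[of n i] by blast
        then have "card ?H \<le> n" using card_mono[of "{i * n..<i * n + n}" ?H] by simp
        moreover have "card (hub_vertex s ` ?H) \<le> card ?H" by (rule card_image_le) simp
        ultimately show ?thesis by simp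
      qed simp
      ultimately show ?thesis by simp
    qed
    finally show ?thesis by simp
  next
    case 2
    \<comment> \<open>For \<open>j = 0\<close> the last element is \<open>v\<close> itself, which
      does no harm to an upper bound.\<close>
    have "{w. (v, w) \<in> parcs (slope_graph n)} \<subseteq> {cor_vertex s (j div n), hub_vertex s (Suc j), hub_vertex s (j - 1)}"
    proof
      fix w assume "w \<in> {w. (v, w) \<in> parcs (slope_graph n)}"
      then have "(v, w) \<in> parcs (slope_graph n)" by simp
      then show "w \<in> {cor_vertex s (j div n), hub_vertex s (Suc j), hub_vertex s (j - 1)}"
        by (cases rule: slope_graph_arc_cases) (use 2 in auto)
    qed
    then have "k \<le> card {cor_vertex s (j div n), hub_vertex s (Suc j), hub_vertex s (j - 1)}"
      unfolding k by (intro card_mono) auto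
    also have "\<dots> \<le> 3" by (simp add: card_insert_if)
    finally show ?thesis by simp
  qed
next
  have "{w. (cor_vertex 0 0, w) \<in> parcs (slope_graph n)} =
      {cor_vertex 0 1, cor_vertex 0 2, cor_vertex 1 0} \<union> hub_vertex 0 ` {..<n}"
  proof (intro equalityI subsetI)
    fix w assume "w \<in> {w. (cor_vertex 0 0, w) \<in> parcs (slope_graph n)}"
    then have "(cor_vertex 0 0, w) \<in> parcs (slope_graph n)" by simp
    then show "w \<in> {cor_vertex 0 1, cor_vertex 0 2, cor_vertex 1 0} \<union> hub_vertex 0 ` {..<n}"
    proof (cases rule: slope_graph_arc_cases)
      case (spoke s j)
      then have "s = 0" "j div n = 0" by auto
      then have "j < n" using spoke by (auto simp: div_eq_0_iff)
      then show ?thesis using spoke \<open>s = 0\<close> by auto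
    qed (auto simp: less_Suc_eq numeral_3_eq_3 numeral_2_eq_2)
  next
    fix w assume "w \<in> {cor_vertex 0 1, cor_vertex 0 2, cor_vertex 1 0} \<union> hub_vertex 0 ` {..<n}"
    then show "w \<in> {w. (cor_vertex 0 0, w) \<in> parcs (slope_graph n)}"
    proof (elim UnE imageE)
      fix j assume "w = hub_vertex 0 j" "j \<in> {..<n}"
      then show ?thesis using slope_graph_arcs(3)[of 0 j n] by simp
    qed (use slope_graph_arcs(1)[of 0 0 1 n] slope_graph_arcs(1)[of 0 0 2 n] slope_graph_arcs(2)[of 0 0 n] in auto)
  qed
  moreover have "card ({cor_vertex 0 1, cor_vertex 0 2, cor_vertex 1 0} \<union> hub_vertex 0 ` {..<n}) = 3 + n"
    by (subst card_Un_disjoint) (auto simp: card_image inj_on_def)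
  ultimately have "out_degree (with_proj (slope_graph n)) (cor_vertex 0 0) = n + 3"
    by (simp add: out_degree_slope_graph)
  moreover have "cor_vertex 0 0 \<in> pverts (slope_graph n)" by (rule slope_graph_verts) auto
  ultimately show "n + 3 \<in> out_degree (with_proj (slope_graph n)) ` pverts (slope_graph n)"
    by (metis imageI)
qed

text \<open>The path grows in both directions from index \<open>n\<close>, where the block of corner
  \<open>1\<close> begins: upwards in a face at the corners \<open>1\<close> and \<open>2\<close>,
  downwards in a face at the corner \<open>0\<close>. The upper vertices are joined to both corners
  \<open>1\<close> and \<open>2\<close>; surplus edges do no harm, as a supergraph is being
  drawn.\<close>

lemma stacked_hub:
  assumes st: "stacked V E F" and f: "(u, v, hub_vertex s n) \<in> F" "(cor_vertex s 0, w, hub_vertex s n) \<in> F"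
    and uv: "{u, v} = {cor_vertex s 1, cor_vertex s 2}"
    and e: "(hub_vertex s n, cor_vertex s 1) \<in> E \<union> E\<inverse>"
    and fresh: "\<forall>j. j \<noteq> n \<longrightarrow> hub_vertex s j \<notin> V"
  shows "\<exists>V' E'. stacked V' E' (F - {(u, v, hub_vertex s n), (cor_vertex s 0, w, hub_vertex s n)}) \<and>
    V \<subseteq> V' \<and> hub_vertex s ` {..<3 * n} \<subseteq> V' \<and> V' \<subseteq> V \<union> range (hub_vertex s) \<and> E \<subseteq> E' \<and>
    (\<forall>j<3 * n. (hub_vertex s j, cor_vertex s (j div n)) \<in> E' \<union> E'\<inverse>) \<and>
    (\<forall>j. Suc j < 3 * n \<longrightarrow> (hub_vertex s j, hub_vertex s (Suc j)) \<in> E' \<union> E'\<inverse>)"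
proof -
  let ?x = "\<lambda>i. hub_vertex s (n + i)" and ?y = "\<lambda>i. hub_vertex s (n - i)"
  \<comment> \<open>The upper chain has the indices \<open>n + 1\<close> to
    \<open>3 * n - 1\<close>. For \<open>n = 0\<close> truncated subtraction gives \<open>0\<close>,
    both chains add nothing, and the vertex of index \<open>n\<close> is an extra vertex of the
    supergraph.\<close>
  let ?m = "2 * n - 1"
  have nV: "hub_vertex s n \<in> V" using st f(1) by (auto simp: stacked_def straight_drawing_def)
  have "\<exists>E'. stacked (V \<union> ?x ` {..?m}) E' (F - {(u, v, ?x 0)}) \<and> E \<subseteq> E' \<and>
    (\<forall>i<?m. (?x (Suc i), u) \<in> E' \<and> (?x (Suc i), v) \<in> E' \<and> (?x (Suc i), ?x i) \<in> E')"
    using st f(1) fresh by (intro stacked_chain) (auto simp: inj_on_def)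
  then obtain E1 where E1: "stacked (V \<union> ?x ` {..?m}) E1 (F - {(u, v, hub_vertex s n)})" "E \<subseteq> E1"
    "\<And>i. i < ?m \<Longrightarrow> (?x (Suc i), u) \<in> E1 \<and> (?x (Suc i), v) \<in> E1 \<and> (?x (Suc i), ?x i) \<in> E1" by auto
  have "cor_vertex s 0 \<noteq> u"
    using uv by (metis insertI1 insertE singletonD vertex_eq_iff(1) zero_neq_one zero_neq_numeral)
  then have f2: "(cor_vertex s 0, w, ?y 0) \<in> F - {(u, v, hub_vertex s n)}" using f(2) by simp
  have "\<exists>E'. stacked (V \<union> ?x ` {..?m} \<union> ?y ` {..n}) E' (F - {(u, v, hub_vertex s n)} - {(cor_vertex s 0, w, ?y 0)}) \<and> E1 \<subseteq> E' \<and>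
    (\<forall>i<n. (?y (Suc i), cor_vertex s 0) \<in> E' \<and> (?y (Suc i), w) \<in> E' \<and> (?y (Suc i), ?y i) \<in> E')"
    using fresh by (intro stacked_chain[where x = ?y, OF E1(1) f2]) (auto simp: inj_on_def)
  moreover have "F - {(u, v, hub_vertex s n)} - {(cor_vertex s 0, w, ?y 0)} =
      F - {(u, v, hub_vertex s n), (cor_vertex s 0, w, hub_vertex s n)}" by auto
  ultimately obtain E2 where E2: "stacked (V \<union> ?x ` {..?m} \<union> ?y ` {..n}) E2
      (F - {(u, v, hub_vertex s n), (cor_vertex s 0, w, hub_vertex s n)})"
    "E1 \<subseteq> E2" "\<And>i. i < n \<Longrightarrow> (?y (Suc i), cor_vertex s 0) \<in> E2 \<and> (?y (Suc i), ?y i) \<in> E2"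
    by metis
  let ?V = "V \<union> ?x ` {..?m} \<union> ?y ` {..n}"
  have below: "(hub_vertex s j, cor_vertex s 0) \<in> E2 \<and> (hub_vertex s j, hub_vertex s (Suc j)) \<in> E2 \<and> hub_vertex s j \<in> ?V"
    if "j < n" for j
    using E2(3)[of "n - Suc j"] that by (auto simp: Suc_diff_Suc intro!: image_eqI[of _ ?y "n - j"])
  have above: "(hub_vertex s (Suc j), cor_vertex s 1) \<in> E2 \<and> (hub_vertex s (Suc j), cor_vertex s 2) \<in> E2 \<and>
      (hub_vertex s (Suc j), hub_vertex s j) \<in> E2 \<and> hub_vertex s (Suc j) \<in> ?V" if "n \<le> j" "Suc j < 3 * n" for j
  proof -
    have "j - n < ?m" "n + Suc (j - n) = Suc j" "n + (j - n) = j" using that by auto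
    then have *: "(hub_vertex s (Suc j), u) \<in> E1" "(hub_vertex s (Suc j), v) \<in> E1" "(hub_vertex s (Suc j), hub_vertex s j) \<in> E1"
      using E1(3)[of "j - n"] by metis+
    have "hub_vertex s (Suc j) \<in> ?x ` {..?m}"
      using \<open>j - n < ?m\<close> \<open>n + Suc (j - n) = Suc j\<close> by (intro image_eqI[of _ _ "Suc (j - n)"]) auto
    moreover have "u = cor_vertex s 1 \<and> v = cor_vertex s 2 \<or> u = cor_vertex s 2 \<and> v = cor_vertex s 1"
      using uv by (simp add: doubleton_eq_iff)
    ultimately show ?thesis using * E2(2) by blast
  qed
  have verts: "hub_vertex s j \<in> ?V" if "j < 3 * n" for j
  proof -
    consider "j < n" | "j = n" | k where "j = Suc k" "n \<le> k" by (metis less_Suc_eq_le linorder_neqE_nat not0_implies_Suc not_less0)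
    then show ?thesis using below above that nV by cases auto
  qed
  have spokes: "(hub_vertex s j, cor_vertex s (j div n)) \<in> E2 \<union> E2\<inverse>" if j: "j < 3 * n" for j
  proof -
    have n: "0 < n" using j by auto
    consider "j < n" | "j = n" | k where "j = Suc k" "n \<le> k" by (metis less_Suc_eq_le linorder_neqE_nat not0_implies_Suc not_less0)
    then show ?thesis
    proof cases
      case 1 then show ?thesis using below by simp
    next
      case 2 then show ?thesis using e E1(2) E2(2) n by auto
    next
      case 3
      have "j div n < 3" using j by (rule div_lt_3)
      moreover have "1 \<le> j div n" using 3 n by (simp add: div_greater_zero_iff Suc_le_eq)
      ultimately have "j div n = 1 \<or> j div n = 2" by linarith
      moreover have "(hub_vertex s j, cor_vertex s 1) \<in> E2" "(hub_vertex s j, cor_vertex s 2) \<in> E2"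
        using above[of k] 3 j by blast+
      ultimately show ?thesis by (metis UnI1)
    qed
  qed
  have paths: "(hub_vertex s j, hub_vertex s (Suc j)) \<in> E2 \<union> E2\<inverse>" if "Suc j < 3 * n" for j
    using below[of j] above[of j] that by (cases "j < n") auto
  show ?thesis using E2(1) verts spokes paths E1(2) E2(2)
    by (intro exI[of _ ?V] exI[of _ E2] conjI) auto
qed

lemma slope_graph_straight_drawing: "\<exists>p. polygonal_drawing 0 (slope_graph n) p (\<lambda>_. [])"
proof -
  define a b c q where "a = cor_vertex 0 0" and "b = cor_vertex 0 1" and "c = cor_vertex 0 2" and "q = hub_vertex 0 n"
  define a' b' c' q' where "a' = cor_vertex 1 0" and "b' = cor_vertex 1 1" and "c' = cor_vertex 1 2" and "q' = hub_vertex 1 n"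
  note defs = a_def b_def c_def q_def a'_def b'_def c'_def q'_def
  \<comment> \<open>Starting from the outer triangle \<open>a b q\<close> leaves the triangle \<open>a b c\<close> an empty face, with its
    hub outside, so that the second triangle fits into it.\<close>
  have "stacked {a, b, q} {(a, b), (b, q), (q, a)} {(a, b, q)}"
    by (rule stacked_triangle) (simp_all add: defs)
  then have "stacked (insert c {a, b, q}) ({(a, b), (b, q), (q, a)} \<union> {(c, a), (c, b), (c, q)})
      ({(a, b, q)} - {(a, b, q)} \<union> {(c, b, q), (a, c, q), (a, b, c)})"
    by (rule stacked_insert) (simp_all add: defs)
  then have "stacked {a, b, c, q} {(a, b), (b, q), (q, a), (c, a), (c, b), (c, q)} {(c, b, q), (a, c, q), (a, b, c)}"
    by (simp add: insert_commute)
  note S0 = this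
  have p: "{c, b} = {cor_vertex 0 1, cor_vertex 0 2}" "(c, b, hub_vertex 0 n) \<in> {(c, b, q), (a, c, q), (a, b, c)}"
    "(cor_vertex 0 0, c, hub_vertex 0 n) \<in> {(c, b, q), (a, c, q), (a, b, c)}"
    "(hub_vertex 0 n, cor_vertex 0 1) \<in> {(a, b), (b, q), (q, a), (c, a), (c, b), (c, q)} \<union> {(a, b), (b, q), (q, a), (c, a), (c, b), (c, q)}\<inverse>"
    "\<forall>j. j \<noteq> n \<longrightarrow> hub_vertex 0 j \<notin> {a, b, c, q}" by (auto simp: defs)
  obtain V1 E1 where 1: "stacked V1 E1 ({(c, b, q), (a, c, q), (a, b, c)} - {(c, b, hub_vertex 0 n), (cor_vertex 0 0, c, hub_vertex 0 n)})"
    and abcq: "{a, b, c, q} \<subseteq> V1" and hub0: "hub_vertex 0 ` {..<3 * n} \<subseteq> V1" and V1sub: "V1 \<subseteq> {a, b, c, q} \<union> range (hub_vertex 0)"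
    and E1: "{(a, b), (b, q), (q, a), (c, a), (c, b), (c, q)} \<subseteq> E1"
    and spoke0: "\<forall>j<3 * n. (hub_vertex 0 j, cor_vertex 0 (j div n)) \<in> E1 \<union> E1\<inverse>"
    and path0: "\<forall>j. Suc j < 3 * n \<longrightarrow> (hub_vertex 0 j, hub_vertex 0 (Suc j)) \<in> E1 \<union> E1\<inverse>"
    using stacked_hub[OF S0 p(2,3,1,4,5)] by (elim exE conjE) (rule that)
  have V1: "cor_vertex 1 i \<notin> V1" "hub_vertex 1 j \<notin> V1" for i j using V1sub unfolding defs by auto
  have "stacked V1 E1 {(a, b, c)}"
    by (rule stacked_face_subset[OF 1]) (simp add: defs)
  \<comment> \<open>The second triangle is nested into the face \<open>a b c\<close>. Replacing the
    corners of this face one at a time by \<open>a'\<close>, \<open>b'\<close> and \<open>c'\<close>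
    produces the matching edges as well as the new sides.\<close>
  then have "stacked (insert a' V1) (E1 \<union> {(a', a), (a', b), (a', c)}) ({(a, b, c)} - {(a, b, c)} \<union> {(a', b, c), (a, a', c), (a, b, a')})"
    by (rule stacked_insert) (use V1 in \<open>simp_all add: a'_def\<close>)
  then have "stacked (insert a' V1) (E1 \<union> {(a', a), (a', b), (a', c)}) {(a', b, c)}"
    by (rule stacked_face_subset) simp
  then have "stacked (insert b' (insert a' V1)) (E1 \<union> {(a', a), (a', b), (a', c)} \<union> {(b', a'), (b', b), (b', c)})
      ({(a', b, c)} - {(a', b, c)} \<union> {(b', b, c), (a', b', c), (a', b, b')})"
    by (rule stacked_insert) (use V1 in \<open>simp_all add: a'_def b'_def\<close>)
  then have "stacked (insert b' (insert a' V1)) (E1 \<union> {(a', a), (a', b), (a', c)} \<union> {(b', a'), (b', b), (b', c)}) {(a', b', c)}"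
    by (rule stacked_face_subset) simp
  then have "stacked (insert c' (insert b' (insert a' V1)))
      (E1 \<union> {(a', a), (a', b), (a', c)} \<union> {(b', a'), (b', b), (b', c)} \<union> {(c', a'), (c', b'), (c', c)})
      ({(a', b', c)} - {(a', b', c)} \<union> {(c', b', c), (a', c', c), (a', b', c')})"
    by (rule stacked_insert) (use V1 in \<open>simp_all add: a'_def b'_def c'_def\<close>)
  then have "stacked (insert c' (insert b' (insert a' V1)))
      (E1 \<union> {(a', a), (a', b), (a', c)} \<union> {(b', a'), (b', b), (b', c)} \<union> {(c', a'), (c', b'), (c', c)}) {(a', b', c')}"
    by (rule stacked_face_subset) simp
  then have "stacked (insert q' (insert c' (insert b' (insert a' V1))))
      (E1 \<union> {(a', a), (a', b), (a', c)} \<union> {(b', a'), (b', b), (b', c)} \<union> {(c', a'), (c', b'), (c', c)} \<union> {(q', a'), (q', b'), (q', c')})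
      ({(a', b', c')} - {(a', b', c')} \<union> {(q', b', c'), (a', q', c'), (a', b', q')})"
    by (rule stacked_insert) (use V1 in \<open>simp_all add: a'_def b'_def c'_def q'_def\<close>)
  moreover define V2 where "V2 = insert q' (insert c' (insert b' (insert a' V1)))"
  moreover define E2 where "E2 = E1 \<union> {(a', a), (a', b), (a', c)} \<union> {(b', a'), (b', b), (b', c)} \<union> {(c', a'), (c', b'), (c', c)} \<union> {(q', a'), (q', b'), (q', c')}"
  ultimately have "stacked V2 E2 ({(a', b', c')} - {(a', b', c')} \<union> {(q', b', c'), (a', q', c'), (a', b', q')})" by simp
  \<comment> \<open>Both faces have to end in \<open>q'\<close>, the vertex from which the second
    hub grows.\<close>
  then have "stacked V2 E2 {(b', c', q'), (a', b', q')}"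
    by (rule stacked_rotate[of _ _ _ q' b' c']) (simp_all add: defs)
  note S2 = this
  have p': "{b', c'} = {cor_vertex 1 1, cor_vertex 1 2}" "(b', c', hub_vertex 1 n) \<in> {(b', c', q'), (a', b', q')}"
    "(cor_vertex 1 0, b', hub_vertex 1 n) \<in> {(b', c', q'), (a', b', q')}"
    "(hub_vertex 1 n, cor_vertex 1 1) \<in> E2 \<union> E2\<inverse>" by (simp_all add: defs E2_def)
  have fresh2: "\<forall>j. j \<noteq> n \<longrightarrow> hub_vertex 1 j \<notin> V2" using V1 unfolding V2_def defs by simp
  obtain V3 E3 where 3: "stacked V3 E3 ({(b', c', q'), (a', b', q')} - {(b', c', hub_vertex 1 n), (cor_vertex 1 0, b', hub_vertex 1 n)})"
    and V23: "V2 \<subseteq> V3" and hub1: "hub_vertex 1 ` {..<3 * n} \<subseteq> V3" and "V3 \<subseteq> V2 \<union> range (hub_vertex 1)"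
    and E23: "E2 \<subseteq> E3"
    and spoke1: "\<forall>j<3 * n. (hub_vertex 1 j, cor_vertex 1 (j div n)) \<in> E3 \<union> E3\<inverse>"
    and path1: "\<forall>j. Suc j < 3 * n \<longrightarrow> (hub_vertex 1 j, hub_vertex 1 (Suc j)) \<in> E3 \<union> E3\<inverse>"
    using stacked_hub[OF S2 p'(2,3,1,4) fresh2] by (elim exE conjE) (rule that)
  have E13: "E1 \<subseteq> E3" "V1 \<subseteq> V3" using V23 E23 unfolding E2_def V2_def by blast+
  have two: "s = 0 \<or> s = 1" if "s < 2" for s :: nat using that by auto
  have three: "i = 0 \<or> i = 1 \<or> i = 2" if "i < 3" for i :: nat using that by auto
  have tri_in: "(cor_vertex s i, cor_vertex s i') \<in> E3 \<union> E3\<inverse>" if "s < 2" "i < 3" "i' < 3" "i \<noteq> i'" for s i i'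
  proof -
    have "{(a, b), (c, a), (c, b)} \<subseteq> E3" using E1 E13 by blast
    moreover have "{(b', a'), (c', a'), (c', b')} \<subseteq> E3" using E23 unfolding E2_def by blast
    ultimately show ?thesis using two[OF that(1)] three[OF that(2)] three[OF that(3)] that(4) unfolding defs by auto
  qed
  have link_in: "(cor_vertex s i, cor_vertex (1 - s) i) \<in> E3 \<union> E3\<inverse>" if "s < 2" "i < 3" for s i
  proof -
    have "{(a', a), (b', b), (c', c)} \<subseteq> E3" using E23 unfolding E2_def by blast
    then show ?thesis using two[OF that(1)] three[OF that(2)] unfolding defs by auto
  qed
  have spoke_in: "(hub_vertex s j, cor_vertex s (j div n)) \<in> E3 \<union> E3\<inverse>" if "s < 2" "j < 3 * n" for s j
    using two[OF that(1)] spoke0 spoke1 that(2) E13 by auto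
  have path_in: "(hub_vertex s j, hub_vertex s (Suc j)) \<in> E3 \<union> E3\<inverse>" if "s < 2" "Suc j < 3 * n" for s j
    using two[OF that(1)] path0 path1 that(2) E13 by auto
  have "pverts (slope_graph n) \<subseteq> V3"
  proof
    fix v assume "v \<in> pverts (slope_graph n)"
    then consider s i where "v = cor_vertex s i" "s < 2" "i < 3" | s j where "v = hub_vertex s j" "s < 2" "j < 3 * n"
      unfolding slope_graph_def by auto
    then show "v \<in> V3"
    proof cases
      case 1
      have "{a, b, c, a', b', c'} \<subseteq> V3" using abcq E13 V23 unfolding V2_def by blast
      then show ?thesis using 1 two[OF 1(2)] three[OF 1(3)] unfolding defs by auto
    next
      case 2
      then show ?thesis using two[OF 2(2)] hub0 E13 hub1 by blast
    qed
  qed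
  moreover have "parcs (slope_graph n) \<subseteq> E3 \<union> E3\<inverse>"
  proof
    fix e assume e: "e \<in> parcs (slope_graph n)"
    obtain u v where uv: "e = (u, v)" by (cases e)
    have "(u, v) \<in> E3 \<union> E3\<inverse>" using e unfolding uv
    proof (cases rule: slope_graph_arc_cases)
      case (triangle s i i') then show ?thesis using tri_in by simp
    next
      case (link s i) then show ?thesis using link_in by simp
    next
      case (spoke s j) then show ?thesis using spoke_in[of s j] by auto
    next
      case (spoke' s j) then show ?thesis using spoke_in by simp
    next
      case (path s j) then show ?thesis using path_in by simp
    next
      case (path' s j) then show ?thesis using path_in[of s j] by auto
    qed
    then show "e \<in> E3 \<union> E3\<inverse>" unfolding uv .
  qed
  ultimately show ?thesis using stacked_imp_polygonal_drawing[OF 3 pair_graph_slope_graph] by blast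
qed

section \<open>Lower bounds for every drawing of the graph\<close>

lemma slope_graph_gadget:
  assumes "polygonal_drawing 1 (slope_graph n) p \<beta>"
  obtains s where "gadget (slope_graph n) p \<beta> (cor_vertex s) (hub_vertex s) n"
proof -
  interpret one_bend_graph "slope_graph n" p \<beta>
    by (rule one_bend_graph.intro[OF pair_graph_slope_graph assms])
  have tri: "tri (cor_vertex s)" if "s < 2" for s
    unfolding tri_def using slope_graph_arcs(1)[OF that] by simp
  have hub: "hub_path (slope_graph n) (cor_vertex s ` {..<3}) (hub_vertex s) (3 * n)" if "s < 2" "0 < n" for s
  proof -
    \<comment> \<open>The witness \<open>i * n\<close> is the first index of the block of corner
      \<open>i\<close>.\<close>
    have "\<exists>j<3 * n. (hub_vertex s j, cor_vertex s i) \<in> parcs (slope_graph n)" if "i < 3" for i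
      using slope_graph_arcs(4)[OF \<open>s < 2\<close>, of "i * n" n] \<open>0 < n\<close> that by (intro exI[of _ "i * n"]) simp
    then show ?thesis unfolding hub_path_def using that slope_graph_arcs(5) by auto
  qed
  have gadgetI: "gadget (slope_graph n) p \<beta> (cor_vertex s) (hub_vertex s) n"
    if "s < 2" "0 < n \<Longrightarrow> local.hub (hub_vertex s ` {..<3 * n}) (cor_vertex s ` {..<3}) {} \<subseteq> inside (tri_curve (cor_vertex s))" for s
    by unfold_locales (use that tri hub slope_graph_arcs(3) in \<open>auto simp: inj_on_def\<close>)
  show thesis
  proof (cases "n = 0")
    \<comment> \<open>Without hub vertices nothing has to be enclosed, and the triangle of index
      \<open>0\<close> serves.\<close>
    case True
    then show ?thesis using that[OF gadgetI[of 0]] by simp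
  next
    case False
    have "local.hub (hub_vertex 0 ` {..<3 * n}) (cor_vertex 0 ` {..<3}) {} \<subseteq> inside (tri_curve (cor_vertex 0)) \<or>
        local.hub (hub_vertex 1 ` {..<3 * n}) (cor_vertex 1 ` {..<3}) {} \<subseteq> inside (tri_curve (cor_vertex 1))"
      by (rule nested_hub_inside) (use False tri hub slope_graph_arcs(2)[of 0] in auto)
    then show ?thesis using that[OF gadgetI[of 0]] that[OF gadgetI[of 1]] by auto
  qed
qed

lemma polygonal_drawing_mono:
  assumes "polygonal_drawing k G p \<beta>" "k \<le> l"
  shows "polygonal_drawing l G p \<beta>"
  using assms unfolding polygonal_drawing_def by fastforce

lemma slope_graph_straight_slopes:
  assumes "polygonal_drawing 0 (slope_graph n) p \<beta>"
  shows "3 * n + 3 \<le> card (drawing_slopes (slope_graph n) p \<beta>)"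
proof -
  obtain s where "gadget (slope_graph n) p \<beta> (cor_vertex s) (hub_vertex s) n"
    using slope_graph_gadget[OF polygonal_drawing_mono[OF assms]] by auto
  then show ?thesis
    by (rule gadget.straight_slopes) (use assms in \<open>simp add: polygonal_drawing_def\<close>)
qed

lemma slope_graph_one_bend_slopes:
  assumes "polygonal_drawing 1 (slope_graph n) p \<beta>"
  shows "3 * (n + 2) \<le> 4 * card (drawing_slopes (slope_graph n) p \<beta>)"
  using slope_graph_gadget[OF assms] gadget.one_bend_slopes by metis

theorem theorem8p13:
  fixes d :: nat
  assumes "d \<ge> 3"
  shows "\<exists>G :: nat pair_pre_digraph.
    pair_graph G \<and> planar G \<and> max_degree G = d \<and>
    planar_slope_number G \<ge> 3 * d - 6 \<and>
    (\<forall>p \<beta>. polygonal_drawing 1 G p \<beta> \<longrightarrow>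
       real (card (drawing_slopes G p \<beta>)) \<ge> 3 / 4 * (real d - 1))"
proof -
  define n where "n = d - 3"
  have d: "d = n + 3" using assms by (simp add: n_def)
  let ?G = "slope_graph n"
  obtain p where p: "polygonal_drawing 0 ?G p (\<lambda>_. [])" using slope_graph_straight_drawing by blast
  have "planar ?G" using p unfolding planar_def polygonal_drawing_def by blast
  moreover have "3 * d - 6 \<le> planar_slope_number ?G"
  proof -
    \<comment> \<open>The straight-line drawing of the graph ensures that the minimum is attained,
      so the bound for all drawings passes to \<open>LEAST\<close>.\<close>
    have "\<exists>s. \<exists>p \<beta>. polygonal_drawing 0 ?G p \<beta> \<and> card (drawing_slopes ?G p \<beta>) \<le> s" using p by blast
    from LeastI_ex[OF this] obtain p \<beta> where
      "polygonal_drawing 0 ?G p \<beta>" "card (drawing_slopes ?G p \<beta>) \<le> planar_slope_number ?G"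
      unfolding planar_slope_number_def by blast
    then show ?thesis using slope_graph_straight_slopes[of n p \<beta>] d by simp
  qed
  moreover have "3 / 4 * (real d - 1) \<le> real (card (drawing_slopes ?G p \<beta>))"
    if "polygonal_drawing 1 ?G p \<beta>" for p \<beta>
  proof -
    have "real (3 * (n + 2)) \<le> real (4 * card (drawing_slopes ?G p \<beta>))"
      using slope_graph_one_bend_slopes[OF that] by (simp only: of_nat_le_iff)
    then show ?thesis using d by simp
  qed
  ultimately show ?thesis
    using pair_graph_slope_graph max_degree_slope_graph d by (intro exI[of _ ?G]) auto
qed

end
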